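(* Let $n\in\{1,2\}$, $k>0$, and let $\Gamma\subset\Gamma_\infty=\mathbb{R}^n\times\{0\}$ be an IFS attractor satisfying the open set condition with $n-1<d=\dim_{\mathrm H}(\Gamma)<n$. For $0<h\le\mathrm{diam}(\Gamma)$ let $N=\#L_h$, let $f^1,\dots,f^N$ be an ordering of $\{\chi_{\boldsymbol m}:\boldsymbol m\in L_h\}$, $V_N=Y_h$, and let $A\in\mathbb{C}^{N\times N}$ be the Galerkin matrix $$A_{ij}=\int_\Gamma\int_\Gamma\Phi(x,y)f^j(y)\overline{f^i(x)}\,d\mathcal{H}^d(y)\,d\mathcal{H}^d(x).$$ Then $\|A\|_2\le\|\mathbb{S}\|_2$, where $\|A\|_2$ is the matrix $2$-norm and $\|\mathbb{S}\|_2$ is the norm of $\mathbb{S}$ as an operator on $\mathbb{L}_2(\Gamma)$. If also $\Gamma$ is disjoint then, for some $c>0$, $$|\vec a^{\,H}A\vec a|\ge c\,h^{2t_d}\|\vec a\|_2^2\quad\text{for all }\vec a\in\mathbb{C}^N,$$ so that also $$\|A^{-1}\|_2\le c^{-1}h^{-2t_d}.$$ In particular, these two bounds hold with $c=\alpha c_{t_d}^{-2}$, where $\alpha>0$ is the coercivity constant in $|a(\phi,\phi)|\ge\alpha\|\phi\|^2_{H^{-1/2}_\Gamma}$, $\phi\in H^{-1/2}_\Gamma$, and $c_{t_d}>0$ (independent of $h$) is the constant in the inverse estimate $\|\Psi_h\|_{\mathbb{L}_2(\Gamma)}\le c_{t_d}h^{-t_d}\|\Psi_h\|_{\mathbb{H}^{-t_d}(\Gamma)}$,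 $\Psi_h\in\mathbb{Y}_h$, $0<h\le\mathrm{diam}(\Gamma)$.
   Context: IFS attractors. Let $M\ge2$ and let $s_1,\dots,s_M:\mathbb{R}^n\to\mathbb{R}^n$ satisfy $|s_m(x)-s_m(y)|=\rho_m|x-y|$ with $\rho_m\in(0,1)$. The attractor is the unique non-empty compact $\Gamma$ with $\Gamma=s(\Gamma)$, $s(E):=\bigcup_ms_m(E)$; it is disjoint if the sets $s_m(\Gamma)$ are pairwise disjoint. Open set condition (OSC): there is a non-empty bounded open $O\subset\mathbb{R}^n$ with $s(O)\subset O$ and $s_m(O)\cap s_{m'}(O)=\emptyset$, $m\ne m'$. Under the OSC, $\Gamma$ is a $d$-set, where $d=\dim_{\mathrm H}(\Gamma)$ solves $\sum_m\rho_m^d=1$. Function spaces. $H^s(\mathbb{R}^n)$ has norm $\|\varphi\|^2_{H^s(\mathbb{R}^n)}=\int(1+|\xi|^2)^s|\widehat\varphi(\xi)|^2\,d\xi$ (unitary Fourier transform), with pairing $\langle\phi,\psi\rangle_{H^{-s}\times H^s}=\int\widehat\phi\,\overline{\widehat\psi}\,d\xi$ (and likewise $H^s\times H^{-s}$). For $\Omega$ open, $\widetilde H^s(\Omega)$ is the closure of $C_0^\infty(\Omega)$ in $H^s(\mathbb{R}^n)$; for $E$ closed, $H^s_E=\{u\in H^s(\mathbb{R}^n):\mathrm{supp}\,u\subset E\}$ with the $H^s(\mathbb{R}^n)$ norm; ${}^\perp$ is orthogonal complement in $H^s(\mathbb{R}^n)$. A closed $\Gamma\subset\mathbb{R}^n$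 is a $d$-set if $c_1r^d\le\mathcal{H}^d(\Gamma\cap B_r(x))\le c_2r^d$ for all $x\in\Gamma$, $0<r\le1$, some $c_1,c_2>0$ ($\mathcal{H}^d$ Hausdorff measure). $\mathbb{L}_2(\Gamma)$ is the $L_2$ space with respect to $\mathcal{H}^d|_\Gamma$. For $s>(n-d)/2$, $t=s-(n-d)/2>0$, $\mathrm{tr}_\Gamma:H^s(\mathbb{R}^n)\to\mathbb{L}_2(\Gamma)$ is the continuous extension of $\varphi\mapsto\varphi|_\Gamma$, $\varphi\in C_0^\infty(\mathbb{R}^n)$; $\mathbb{H}^t(\Gamma):=\mathrm{tr}_\Gamma(H^s(\mathbb{R}^n))$ with the quotient norm; $\mathbb{H}^{-t}(\Gamma):=(\mathbb{H}^t(\Gamma))^*$ (antilinear functionals), with $\mathbb{L}_2(\Gamma)$ embedded via $f\mapsto(f,\cdot)_{\mathbb{L}_2(\Gamma)}$. $\mathrm{tr}_\Gamma^*:\mathbb{H}^{-t}(\Gamma)\to H^{-s}(\mathbb{R}^n)$ is defined by $\langle\varphi,\mathrm{tr}_\Gamma^*f\rangle_{H^s\times H^{-s}}=\langle\mathrm{tr}_\Gamma\varphi,f\rangle_{\mathbb{H}^t(\Gamma)\times\mathbb{H}^{-t}(\Gamma)}$ for all $\varphi\in H^s(\mathbb{R}^n)$. For $0<t<1$, $\mathrm{tr}_\Gamma^*$ is known to be a unitary isomorphism onto $H^{-s}_\Gamma$. Operators. $\Gamma_\infty$ is identified with $\mathbb{R}^n$. $\Gamma^c=\Gamma_\infty\setminus\Gamma$,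 $D=\mathbb{R}^{n+1}\setminus\Gamma$, $U^\pm=\{\pm x_{n+1}>0\}$, $\gamma^\pm:W^1(U^\pm)\to H^{1/2}(\Gamma_\infty)$ are the Dirichlet traces, $C^\infty_{0,\Gamma}$ is the set of $\sigma\in C_0^\infty(\mathbb{R}^{n+1})$ equal to one in a neighbourhood of $\Gamma$, and $P:H^{1/2}(\Gamma_\infty)\to\widetilde H^{1/2}(\Gamma^c)^\perp$ is orthogonal projection. $\Phi(x,y)=e^{ik|x-y|}/(4\pi|x-y|)$ for $n=2$, $\Phi(x,y)=\frac i4H^{(1)}_0(k|x-y|)$ for $n=1$. The single-layer potential $\mathcal{S}:H^{-1/2}_\Gamma\to C^2(D)\cap W^{1,\mathrm{loc}}(\mathbb{R}^{n+1})$ is $\mathcal{S}\psi(x)=\langle\gamma^\pm(\sigma\Phi(x,\cdot)|_{U^\pm}),\overline\psi\rangle_{H^{1/2}(\Gamma_\infty)\times H^{-1/2}(\Gamma_\infty)}$, $x\in D$, for any $\sigma\in C^\infty_{0,\Gamma}$ with $x\notin\mathrm{supp}\,\sigma$; $S:H^{-1/2}_\Gamma\to\widetilde H^{1/2}(\Gamma^c)^\perp$ is $S\psi=P\gamma^\pm(\sigma\mathcal{S}\psi|_{U^\pm})$, $\sigma\in C^\infty_{0,\Gamma}$ arbitrary. $a(\phi,\psi):=\langle S\phi,\psi\rangle_{H^{1/2}(\Gamma_\infty)\times H^{-1/2}(\Gamma_\infty)}$ on $H^{-1/2}_\Gamma\times H^{-1/2}_\Gamma$, known to be continuous and coercive.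 $t_d=\frac12-\frac{n-d}2$, $\mathbb{S}:=\mathrm{tr}_\Gamma\,S\,\mathrm{tr}_\Gamma^*:\mathbb{H}^{-t_d}(\Gamma)\to\mathbb{H}^{t_d}(\Gamma)$; it restricts to a bounded operator on $\mathbb{L}_2(\Gamma)$. One has $A_{ij}=a(\mathrm{tr}_\Gamma^*f^j,\mathrm{tr}_\Gamma^*f^i)=(\mathbb{S}f^j,f^i)_{\mathbb{L}_2(\Gamma)}$. Approximation spaces. $I_{\mathbb{N}}=\bigcup_{\ell\ge1}\{1,\dots,M\}^\ell$; $\Gamma_0=\Gamma$, $\Gamma_{\boldsymbol m}=s_{m_1}\circ\cdots\circ s_{m_\ell}(\Gamma)$; $\boldsymbol m_-=(m_1,\dots,m_{\ell-1})$ if $\ell\ge2$, $\boldsymbol m_-=0$ if $\ell=1$. $\chi_{\boldsymbol m}=\mathcal{H}^d(\Gamma_{\boldsymbol m})^{-1/2}$ on $\Gamma_{\boldsymbol m}$, $0$ elsewhere. $L_h=\{0\}$ if $h=\mathrm{diam}(\Gamma)$, and for $0<h<\mathrm{diam}(\Gamma)$, $L_h=\{\boldsymbol m\in I_{\mathbb{N}}:\mathrm{diam}(\Gamma_{\boldsymbol m})\le h,\ \mathrm{diam}(\Gamma_{\boldsymbol m_-})>h\}$. $\mathbb{Y}_h=\mathrm{span}\{\chi_{\boldsymbol m}:\boldsymbol m\in L_h\}$, $Y_h=\mathrm{tr}_\Gamma^*(\mathbb{Y}_h)$. When $\Gamma$ is disjoint the inverse estimate quoted in the claim is known to hold for some $c_{t_d}$.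 $\vec a^{\,H}$ is the conjugate transpose. *)

theory Defs
  imports "HOL-Analysis.Analysis" "Jordan_Normal_Form.Matrix"
begin

(* Throughout, 'a is the ambient space R^n, n = DIM('a), and 'a \<times> real is R^(n+1), in which
   Gamma_infinity is the hyperplane {(x, 0)}; subsets of Gamma_infinity are given as sets in 'a. *)

section \<open>Hausdorff measure and dimension\<close>

(* The case distinction implements 0^0 = 1 for non-empty sets and weight 0 for the empty set. *)
definition hausdorff_weight :: "real \<Rightarrow> 'a::euclidean_space set \<Rightarrow> real" where
  "hausdorff_weight d U =
     (if U = {} then 0 else if d = 0 then 1 else diameter U powr d)"

definition hausdorff_outer :: "real \<Rightarrow> 'a::euclidean_space set \<Rightarrow> ennreal" where
  "hausdorff_outer d A =
     (SUP \<delta>\<in>{0<..}. INF U\<in>{U :: nat \<Rightarrow> 'a set. A \<subseteq> (\<Union>i. U i) \<and> (\<forall>i. bounded (U i) \<and> diameter (U i) \<le> \<delta>)}.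
        (\<Sum>i. ennreal (hausdorff_weight d (U i))))"

definition hausdorff_measure :: "real \<Rightarrow> 'a::euclidean_space measure" where
  "hausdorff_measure d = measure_of UNIV (sets borel) (hausdorff_outer d)"

definition hausdorff_dim :: "'a::euclidean_space set \<Rightarrow> real" where
  "hausdorff_dim A = Inf {d. 0 \<le> d \<and> hausdorff_outer d A = 0}"

section \<open>Iterated function systems\<close>

definition ifs :: "nat \<Rightarrow> (nat \<Rightarrow> 'a::euclidean_space \<Rightarrow> 'a) \<Rightarrow> (nat \<Rightarrow> real) \<Rightarrow> bool" where
  "ifs M s \<rho> \<longleftrightarrow> 2 \<le> M \<and>
     (\<forall>m\<in>{1..M}. 0 < \<rho> m \<and> \<rho> m < 1 \<and> (\<forall>x y. norm (s m x - s m y) = \<rho> m * norm (x - y)))"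

definition ifs_attractor :: "nat \<Rightarrow> (nat \<Rightarrow> 'a::euclidean_space \<Rightarrow> 'a) \<Rightarrow> 'a set \<Rightarrow> bool" where
  "ifs_attractor M s \<Gamma> \<longleftrightarrow> \<Gamma> \<noteq> {} \<and> compact \<Gamma> \<and> \<Gamma> = (\<Union>m\<in>{1..M}. s m ` \<Gamma>)"

definition ifs_disjoint :: "nat \<Rightarrow> (nat \<Rightarrow> 'a::euclidean_space \<Rightarrow> 'a) \<Rightarrow> 'a set \<Rightarrow> bool" where
  "ifs_disjoint M s \<Gamma> \<longleftrightarrow>
     (\<forall>m\<in>{1..M}. \<forall>m'\<in>{1..M}. m \<noteq> m' \<longrightarrow> s m ` \<Gamma> \<inter> s m' ` \<Gamma> = {})"

definition open_set_condition :: "nat \<Rightarrow> (nat \<Rightarrow> 'a::euclidean_space \<Rightarrow> 'a) \<Rightarrow> bool" where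
  "open_set_condition M s \<longleftrightarrow>
     (\<exists>U. U \<noteq> {} \<and> bounded U \<and> open U \<and> (\<Union>m\<in>{1..M}. s m ` U) \<subseteq> U \<and>
        (\<forall>m\<in>{1..M}. \<forall>m'\<in>{1..M}. m \<noteq> m' \<longrightarrow> s m ` U \<inter> s m' ` U = {}))"

(* Words are lists [m1, ..., ml]; the empty list plays the role of the index 0, so that
   Gamma_0 = Gamma is ifs_piece s \<Gamma> [] and the truncation of a word is butlast. *)
definition ifs_piece :: "(nat \<Rightarrow> 'a \<Rightarrow> 'a) \<Rightarrow> 'a set \<Rightarrow> nat list \<Rightarrow> 'a::euclidean_space set" where
  "ifs_piece s \<Gamma> w = foldr (\<lambda>m E. s m ` E) w \<Gamma>"

definition L_index :: "nat \<Rightarrow> (nat \<Rightarrow> 'a::euclidean_space \<Rightarrow> 'a) \<Rightarrow> 'a set \<Rightarrow> real \<Rightarrow> nat list set" where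
  "L_index M s \<Gamma> h =
     (if h = diameter \<Gamma> then {[]}
      else {w. w \<noteq> [] \<and> set w \<subseteq> {1..M} \<and> diameter (ifs_piece s \<Gamma> w) \<le> h \<and>
               h < diameter (ifs_piece s \<Gamma> (butlast w))})"

definition chi :: "real \<Rightarrow> (nat \<Rightarrow> 'a \<Rightarrow> 'a) \<Rightarrow> 'a set \<Rightarrow> nat list \<Rightarrow> 'a::euclidean_space \<Rightarrow> complex" where
  "chi d s \<Gamma> w x =
     (if x \<in> ifs_piece s \<Gamma> w
      then complex_of_real (measure (hausdorff_measure d) (ifs_piece s \<Gamma> w) powr (-1/2)) else 0)"

definition Y_space ::
  "real \<Rightarrow> nat \<Rightarrow> (nat \<Rightarrow> 'a \<Rightarrow> 'a) \<Rightarrow> 'a set \<Rightarrow> real \<Rightarrow> ('a::euclidean_space \<Rightarrow> complex) set" where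
  "Y_space d M s \<Gamma> h =
     {\<lambda>x. \<Sum>w\<in>L_index M s \<Gamma> h. c w * chi d s \<Gamma> w x | c :: nat list \<Rightarrow> complex. True}"

definition basis_ordering ::
  "real \<Rightarrow> nat \<Rightarrow> (nat \<Rightarrow> 'a \<Rightarrow> 'a) \<Rightarrow> 'a set \<Rightarrow> real \<Rightarrow> nat \<Rightarrow> (nat \<Rightarrow> 'a::euclidean_space \<Rightarrow> complex) \<Rightarrow> bool" where
  "basis_ordering d M s \<Gamma> h N f \<longleftrightarrow>
     (\<exists>w. bij_betw w {..<N} (L_index M s \<Gamma> h) \<and> (\<forall>i<N. f i = chi d s \<Gamma> (w i)))"

section \<open>Square-integrable functions\<close>

(* Elements of L_2 are represented by functions; equality in L_2 is equality almost everywhere. *)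
definition L2 :: "'b measure \<Rightarrow> ('b \<Rightarrow> complex) set" where
  "L2 \<mu> = {f \<in> borel_measurable \<mu>. integrable \<mu> (\<lambda>x. (cmod (f x))\<^sup>2)}"

definition L2_norm :: "'b measure \<Rightarrow> ('b \<Rightarrow> complex) \<Rightarrow> real" where
  "L2_norm \<mu> f = sqrt (integral\<^sup>L \<mu> (\<lambda>x. (cmod (f x))\<^sup>2))"

definition L2_inner :: "'b measure \<Rightarrow> ('b \<Rightarrow> complex) \<Rightarrow> ('b \<Rightarrow> complex) \<Rightarrow> complex" where
  "L2_inner \<mu> f g = integral\<^sup>L \<mu> (\<lambda>x. f x * cnj (g x))"

definition hausdorff_on :: "real \<Rightarrow> 'a::euclidean_space set \<Rightarrow> 'a measure" where
  "hausdorff_on d \<Gamma> = restrict_space (hausdorff_measure d) \<Gamma>"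

section \<open>Test functions and tempered distributions\<close>

fun iter_pderiv :: "'b list \<Rightarrow> ('b::euclidean_space \<Rightarrow> complex) \<Rightarrow> 'b \<Rightarrow> complex" where
  "iter_pderiv [] f = f"
| "iter_pderiv (b # bs) f = (\<lambda>x. frechet_derivative (iter_pderiv bs f) (at x) b)"

(* Differentiability of all iterated partial derivatives is equivalent to f being C^infinity. *)
definition smooth_fun :: "('b::euclidean_space \<Rightarrow> complex) \<Rightarrow> bool" where
  "smooth_fun f \<longleftrightarrow> (\<forall>bs\<in>lists Basis. iter_pderiv bs f differentiable_on UNIV)"

definition fun_support :: "('b::euclidean_space \<Rightarrow> complex) \<Rightarrow> 'b set" where
  "fun_support f = closure {x. f x \<noteq> 0}"

definition test_functions :: "'b::euclidean_space set \<Rightarrow> ('b \<Rightarrow> complex) set" where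
  "test_functions \<Omega> = {f. smooth_fun f \<and> compact (fun_support f) \<and> fun_support f \<subseteq> \<Omega>}"

definition schwartz :: "('b::euclidean_space \<Rightarrow> complex) set" where
  "schwartz = {f. smooth_fun f \<and>
     (\<forall>bs\<in>lists Basis. \<forall>N::nat. \<exists>C. \<forall>x. (1 + norm x) ^ N * cmod (iter_pderiv bs f x) \<le> C)}"

definition fourier :: "('a::euclidean_space \<Rightarrow> complex) \<Rightarrow> 'a \<Rightarrow> complex" where
  "fourier f \<xi> = complex_of_real ((2 * pi) powr (- real DIM('a) / 2)) *
     integral\<^sup>L lborel (\<lambda>x. cis (- inner x \<xi>) * f x)"

type_synonym 'a dist = "('a \<Rightarrow> complex) \<Rightarrow> complex"

(* Linear functionals on Schwartz functions that are bounded by finitely many of the Schwartz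
   seminorms; they are set to 0 elsewhere, so that equality of distributions is HOL equality. *)
definition tempered :: "'a::euclidean_space dist set" where
  "tempered = {u.
     (\<forall>\<phi>. \<phi> \<notin> schwartz \<longrightarrow> u \<phi> = 0) \<and>
     (\<forall>\<phi>\<in>schwartz. \<forall>\<psi>\<in>schwartz. \<forall>a b. u (\<lambda>x. a * \<phi> x + b * \<psi> x) = a * u \<phi> + b * u \<psi>) \<and>
     (\<exists>C N. \<forall>\<phi>\<in>schwartz. \<forall>B.
        (\<forall>bs\<in>lists Basis. length bs \<le> N \<longrightarrow> (\<forall>x. (1 + norm x) ^ N * cmod (iter_pderiv bs \<phi> x) \<le> B))
        \<longrightarrow> cmod (u \<phi>) \<le> C * B)}"

definition dist_of_fun :: "('a::euclidean_space \<Rightarrow> complex) \<Rightarrow> 'a dist" where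
  "dist_of_fun f \<phi> = (if \<phi> \<in> schwartz then integral\<^sup>L lborel (\<lambda>x. f x * \<phi> x) else 0)"

definition dist_cnj :: "'a dist \<Rightarrow> 'a dist" where
  "dist_cnj u \<phi> = cnj (u (\<lambda>x. cnj (\<phi> x)))"

definition dist_support :: "'a::euclidean_space dist \<Rightarrow> 'a set" where
  "dist_support u = - \<Union>{U. open U \<and> (\<forall>\<phi>\<in>test_functions U. u \<phi> = 0)}"

(* The Fourier transform of the distribution u, defined by \<phi> \<mapsto> u (fourier \<phi>), is the function g. *)
definition has_fourier :: "'a::euclidean_space dist \<Rightarrow> ('a \<Rightarrow> complex) \<Rightarrow> bool" where
  "has_fourier u g \<longleftrightarrow> g \<in> borel_measurable lborel \<and>
     (\<forall>\<phi>\<in>schwartz. integrable lborel (\<lambda>\<xi>. g \<xi> * \<phi> \<xi>) \<and>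
        u (fourier \<phi>) = integral\<^sup>L lborel (\<lambda>\<xi>. g \<xi> * \<phi> \<xi>))"

(* Unique up to null sets where it exists, in particular on every H^s. *)
definition dist_fourier :: "'a::euclidean_space dist \<Rightarrow> 'a \<Rightarrow> complex" where
  "dist_fourier u = (SOME g. has_fourier u g)"

section \<open>Sobolev spaces on R^n\<close>

definition sobolev :: "real \<Rightarrow> 'a::euclidean_space dist set" where
  "sobolev s = {u \<in> tempered. \<exists>g. has_fourier u g \<and>
     integrable lborel (\<lambda>\<xi>. (1 + (norm \<xi>)\<^sup>2) powr s * (cmod (g \<xi>))\<^sup>2)}"

definition sobolev_norm :: "real \<Rightarrow> 'a::euclidean_space dist \<Rightarrow> real" where
  "sobolev_norm s u =
     sqrt (integral\<^sup>L lborel (\<lambda>\<xi>. (1 + (norm \<xi>)\<^sup>2) powr s * (cmod (dist_fourier u \<xi>))\<^sup>2))"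

definition sobolev_inner :: "real \<Rightarrow> 'a::euclidean_space dist \<Rightarrow> 'a dist \<Rightarrow> complex" where
  "sobolev_inner s u v = integral\<^sup>L lborel
     (\<lambda>\<xi>. complex_of_real ((1 + (norm \<xi>)\<^sup>2) powr s) * (dist_fourier u \<xi> * cnj (dist_fourier v \<xi>)))"

(* The pairing of H^s with H^(-s); the formula is the same for every sign of s. *)
definition sobolev_pairing :: "'a::euclidean_space dist \<Rightarrow> 'a dist \<Rightarrow> complex" where
  "sobolev_pairing u v = integral\<^sup>L lborel (\<lambda>\<xi>. dist_fourier u \<xi> * cnj (dist_fourier v \<xi>))"

definition dist_diff :: "'a dist \<Rightarrow> 'a dist \<Rightarrow> 'a dist" where
  "dist_diff u v = (\<lambda>\<phi>. u \<phi> - v \<phi>)"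

definition sobolev_tilde :: "real \<Rightarrow> 'a::euclidean_space set \<Rightarrow> 'a dist set" where
  "sobolev_tilde s \<Omega> = {u \<in> sobolev s. \<forall>e>0. \<exists>\<phi>\<in>test_functions \<Omega>.
     sobolev_norm s (dist_diff u (dist_of_fun \<phi>)) < e}"

definition sobolev_supp :: "real \<Rightarrow> 'a::euclidean_space set \<Rightarrow> 'a dist set" where
  "sobolev_supp s E = {u \<in> sobolev s. dist_support u \<subseteq> E}"

definition sobolev_orth :: "real \<Rightarrow> 'a::euclidean_space dist set \<Rightarrow> 'a dist set" where
  "sobolev_orth s V = {u \<in> sobolev s. \<forall>v\<in>V. sobolev_inner s u v = 0}"

definition orth_projection :: "real \<Rightarrow> 'a::euclidean_space dist set \<Rightarrow> 'a dist \<Rightarrow> 'a dist" where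
  "orth_projection s W u = (THE v. v \<in> W \<and> (\<forall>w\<in>W. sobolev_inner s (dist_diff u v) w = 0))"

section \<open>Traces on a d-set and the spaces on it\<close>

(* g is the value at u of the continuous extension of \<phi> \<mapsto> \<phi>|Gamma from C_0^infinity to H^s. *)
definition is_trace :: "real \<Rightarrow> real \<Rightarrow> 'a set \<Rightarrow> 'a::euclidean_space dist \<Rightarrow> ('a \<Rightarrow> complex) \<Rightarrow> bool" where
  "is_trace s d \<Gamma> u g \<longleftrightarrow> g \<in> L2 (hausdorff_on d \<Gamma>) \<and>
     (\<forall>\<phi> :: nat \<Rightarrow> 'a \<Rightarrow> complex. (\<forall>j. \<phi> j \<in> test_functions UNIV) \<and>
        (\<lambda>j. sobolev_norm s (dist_diff (dist_of_fun (\<phi> j)) u)) \<longlonglongrightarrow> 0 \<longrightarrow>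
        (\<lambda>j. L2_norm (hausdorff_on d \<Gamma>) (\<lambda>x. \<phi> j x - g x)) \<longlonglongrightarrow> 0)"

definition tr :: "real \<Rightarrow> real \<Rightarrow> 'a set \<Rightarrow> 'a::euclidean_space dist \<Rightarrow> 'a \<Rightarrow> complex" where
  "tr s d \<Gamma> u = (SOME g. is_trace s d \<Gamma> u g)"

(* In what follows the parameter t > 0 determines the exponent s = t + (n - d)/2 on R^n. *)
definition lift_exp :: "real \<Rightarrow> real \<Rightarrow> 'a::euclidean_space set \<Rightarrow> real" where
  "lift_exp t d \<Gamma> = t + (real DIM('a) - d) / 2"

definition HH :: "real \<Rightarrow> real \<Rightarrow> 'a::euclidean_space set \<Rightarrow> ('a \<Rightarrow> complex) set" where
  "HH t d \<Gamma> = {g. \<exists>u\<in>sobolev (lift_exp t d \<Gamma>). is_trace (lift_exp t d \<Gamma>) d \<Gamma> u g}"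

definition HH_norm :: "real \<Rightarrow> real \<Rightarrow> 'a::euclidean_space set \<Rightarrow> ('a \<Rightarrow> complex) \<Rightarrow> real" where
  "HH_norm t d \<Gamma> g = Inf {sobolev_norm (lift_exp t d \<Gamma>) u | u.
     u \<in> sobolev (lift_exp t d \<Gamma>) \<and> is_trace (lift_exp t d \<Gamma>) d \<Gamma> u g}"

(* Continuous antilinear functionals on HH t. Continuity implies that they do not distinguish
   functions that are equal almost everywhere on Gamma. *)
definition HH_dual :: "real \<Rightarrow> real \<Rightarrow> 'a::euclidean_space set \<Rightarrow> (('a \<Rightarrow> complex) \<Rightarrow> complex) set" where
  "HH_dual t d \<Gamma> = {F.
     (\<forall>g. g \<notin> HH t d \<Gamma> \<longrightarrow> F g = 0) \<and>
     (\<forall>g1\<in>HH t d \<Gamma>. \<forall>g2\<in>HH t d \<Gamma>. \<forall>a b. F (\<lambda>x. a * g1 x + b * g2 x) = cnj a * F g1 + cnj b * F g2) \<and>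
     (\<exists>C. \<forall>g\<in>HH t d \<Gamma>. cmod (F g) \<le> C * HH_norm t d \<Gamma> g)}"

definition HH_dual_norm ::
  "real \<Rightarrow> real \<Rightarrow> 'a::euclidean_space set \<Rightarrow> (('a \<Rightarrow> complex) \<Rightarrow> complex) \<Rightarrow> real" where
  "HH_dual_norm t d \<Gamma> F = Sup {cmod (F g) | g. g \<in> HH t d \<Gamma> \<and> HH_norm t d \<Gamma> g \<le> 1}"

definition L2_embed ::
  "real \<Rightarrow> real \<Rightarrow> 'a::euclidean_space set \<Rightarrow> ('a \<Rightarrow> complex) \<Rightarrow> ('a \<Rightarrow> complex) \<Rightarrow> complex" where
  "L2_embed t d \<Gamma> f g = (if g \<in> HH t d \<Gamma> then L2_inner (hausdorff_on d \<Gamma>) f g else 0)"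

(* As F is antilinear, the pairing of g in HH t with F in its dual is cnj (F g). *)
definition tr_adj ::
  "real \<Rightarrow> real \<Rightarrow> 'a::euclidean_space set \<Rightarrow> (('a \<Rightarrow> complex) \<Rightarrow> complex) \<Rightarrow> 'a dist" where
  "tr_adj t d \<Gamma> F = (THE v. v \<in> sobolev (- lift_exp t d \<Gamma>) \<and>
     (\<forall>\<phi>\<in>sobolev (lift_exp t d \<Gamma>). sobolev_pairing \<phi> v = cnj (F (tr (lift_exp t d \<Gamma>) d \<Gamma> \<phi>))))"

section \<open>Dirichlet traces from the half-spaces\<close>

definition half_space :: "real \<Rightarrow> ('a::euclidean_space \<times> real) set" where
  "half_space e = {p. e * snd p > 0}"

definition weak_pderiv ::
  "'b set \<Rightarrow> 'b \<Rightarrow> ('b::euclidean_space \<Rightarrow> complex) \<Rightarrow> ('b \<Rightarrow> complex) \<Rightarrow> bool" where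
  "weak_pderiv U b u v \<longleftrightarrow> v \<in> L2 (restrict_space lborel U) \<and>
     (\<forall>\<phi>\<in>test_functions U.
        integral\<^sup>L (restrict_space lborel U) (\<lambda>x. u x * frechet_derivative \<phi> (at x) b) =
        - integral\<^sup>L (restrict_space lborel U) (\<lambda>x. v x * \<phi> x))"

definition W1 :: "'b::euclidean_space set \<Rightarrow> ('b \<Rightarrow> complex) set" where
  "W1 U = {u \<in> L2 (restrict_space lborel U). \<forall>b\<in>Basis. \<exists>v. weak_pderiv U b u v}"

definition W1_norm :: "'b::euclidean_space set \<Rightarrow> ('b \<Rightarrow> complex) \<Rightarrow> real" where
  "W1_norm U u = sqrt ((L2_norm (restrict_space lborel U) u)\<^sup>2 +
     (\<Sum>b\<in>Basis. (L2_norm (restrict_space lborel U) (SOME v. weak_pderiv U b u v))\<^sup>2))"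

(* The continuous extension to W^1 of the half-space of \<phi> \<mapsto> \<phi>(., 0), \<phi> in C_0^infinity(R^(n+1)),
   with values in H^(1/2); e = 1 gives the trace from above and e = -1 the trace from below. *)
definition dirichlet_trace :: "real \<Rightarrow> ('a::euclidean_space \<times> real \<Rightarrow> complex) \<Rightarrow> 'a dist" where
  "dirichlet_trace e u = (THE g. g \<in> sobolev (1/2) \<and>
     (\<forall>\<phi> :: nat \<Rightarrow> 'a \<times> real \<Rightarrow> complex. (\<forall>j. \<phi> j \<in> test_functions UNIV) \<and>
        (\<lambda>j. W1_norm (half_space e) (\<lambda>p. \<phi> j p - u p)) \<longlonglongrightarrow> 0 \<longrightarrow>
        (\<lambda>j. sobolev_norm (1/2) (dist_diff (dist_of_fun (\<lambda>x. \<phi> j (x, 0))) g)) \<longlonglongrightarrow> 0))"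

section \<open>The single-layer operator\<close>

definition bessel_J0 :: "real \<Rightarrow> real" where
  "bessel_J0 r = (\<Sum>m. (- 1) ^ m * (r\<^sup>2 / 4) ^ m / (fact m)\<^sup>2)"

(* The classical expansion of the Bessel function of the second kind, for r > 0. *)
definition bessel_Y0 :: "real \<Rightarrow> real" where
  "bessel_Y0 r = 2 / pi * ((ln (r / 2) + euler_mascheroni) * bessel_J0 r +
     (\<Sum>m. (- 1) ^ (m + 1) * harm m * (r\<^sup>2 / 4) ^ m / (fact m)\<^sup>2))"

definition hankel1_0 :: "real \<Rightarrow> complex" where
  "hankel1_0 r = Complex (bessel_J0 r) (bessel_Y0 r)"

(* Only DIM('a) = 1 and DIM('a) = 2 are meaningful. *)
definition Phi :: "real \<Rightarrow> 'a::euclidean_space \<times> real \<Rightarrow> 'a \<times> real \<Rightarrow> complex" where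
  "Phi k p q =
     (if DIM('a) = 2 then exp (\<i> * complex_of_real (k * dist p q)) / complex_of_real (4 * pi * dist p q)
      else \<i> / 4 * hankel1_0 (k * dist p q))"

definition cutoffs :: "'a::euclidean_space set \<Rightarrow> ('a \<times> real \<Rightarrow> complex) set" where
  "cutoffs \<Gamma> = {\<sigma> \<in> test_functions UNIV. \<exists>U. open U \<and> \<Gamma> \<times> {0} \<subseteq> U \<and> (\<forall>p\<in>U. \<sigma> p = 1)}"

(* The value is the common one for all admissible cut-offs and both signs; likewise in slp_op.
   The value 0 on Gamma, a null set, is immaterial. *)
definition slp_potential :: "real \<Rightarrow> 'a::euclidean_space set \<Rightarrow> 'a dist \<Rightarrow> 'a \<times> real \<Rightarrow> complex" where
  "slp_potential k \<Gamma> \<psi> p =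
     (if p \<in> \<Gamma> \<times> {0} then 0
      else THE z. \<forall>\<sigma>\<in>cutoffs \<Gamma>. p \<notin> fun_support \<sigma> \<longrightarrow> (\<forall>e\<in>{1, -1}.
        z = sobolev_pairing (dirichlet_trace e (\<lambda>q. \<sigma> q * Phi k p q)) (dist_cnj \<psi>)))"

definition slp_op :: "real \<Rightarrow> 'a::euclidean_space set \<Rightarrow> 'a dist \<Rightarrow> 'a dist" where
  "slp_op k \<Gamma> \<psi> = (THE v. \<forall>\<sigma>\<in>cutoffs \<Gamma>. \<forall>e\<in>{1, -1}.
     v = orth_projection (1/2) (sobolev_orth (1/2) (sobolev_tilde (1/2) (- \<Gamma>)))
           (dirichlet_trace e (\<lambda>p. \<sigma> p * slp_potential k \<Gamma> \<psi> p)))"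

definition slp_form :: "real \<Rightarrow> 'a::euclidean_space set \<Rightarrow> 'a dist \<Rightarrow> 'a dist \<Rightarrow> complex" where
  "slp_form k \<Gamma> \<phi> \<psi> = sobolev_pairing (slp_op k \<Gamma> \<phi>) \<psi>"

definition t_exp :: "real \<Rightarrow> 'a::euclidean_space set \<Rightarrow> real" where
  "t_exp d \<Gamma> = 1/2 - (real DIM('a) - d) / 2"

(* tr_adj carries the dual of HH (t_exp d \<Gamma>) into H^(-1/2), as lift_exp (t_exp d \<Gamma>) d \<Gamma> = 1/2. *)
definition SS :: "real \<Rightarrow> real \<Rightarrow> 'a::euclidean_space set \<Rightarrow> (('a \<Rightarrow> complex) \<Rightarrow> complex) \<Rightarrow> 'a \<Rightarrow> complex" where
  "SS k d \<Gamma> F = tr (1/2) d \<Gamma> (slp_op k \<Gamma> (tr_adj (t_exp d \<Gamma>) d \<Gamma> F))"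

definition SS_L2 :: "real \<Rightarrow> real \<Rightarrow> 'a::euclidean_space set \<Rightarrow> ('a \<Rightarrow> complex) \<Rightarrow> 'a \<Rightarrow> complex" where
  "SS_L2 k d \<Gamma> f = SS k d \<Gamma> (L2_embed (t_exp d \<Gamma>) d \<Gamma> f)"

definition L2_op_norm :: "'b measure \<Rightarrow> (('b \<Rightarrow> complex) \<Rightarrow> 'b \<Rightarrow> complex) \<Rightarrow> real" where
  "L2_op_norm \<mu> T = Sup {L2_norm \<mu> (T f) | f. f \<in> L2 \<mu> \<and> L2_norm \<mu> f \<le> 1}"

section \<open>Properties of operators and forms\<close>

definition L2_bounded_operator :: "'b measure \<Rightarrow> (('b \<Rightarrow> complex) \<Rightarrow> 'b \<Rightarrow> complex) \<Rightarrow> bool" where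
  "L2_bounded_operator \<mu> T \<longleftrightarrow>
     (\<forall>f\<in>L2 \<mu>. T f \<in> L2 \<mu>) \<and>
     (\<forall>f\<in>L2 \<mu>. \<forall>g\<in>L2 \<mu>. \<forall>a b. AE x in \<mu>. T (\<lambda>y. a * f y + b * g y) x = a * T f x + b * T g x) \<and>
     (\<exists>C. \<forall>f\<in>L2 \<mu>. L2_norm \<mu> (T f) \<le> C * L2_norm \<mu> f)"

definition unitary_isomorphism ::
  "('x \<Rightarrow> complex) set \<Rightarrow> (('x \<Rightarrow> complex) \<Rightarrow> real) \<Rightarrow> ('y \<Rightarrow> complex) set \<Rightarrow> (('y \<Rightarrow> complex) \<Rightarrow> real) \<Rightarrow>
   (('x \<Rightarrow> complex) \<Rightarrow> 'y \<Rightarrow> complex) \<Rightarrow> bool" where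
  "unitary_isomorphism V nV W nW T \<longleftrightarrow> bij_betw T V W \<and>
     (\<forall>u\<in>V. \<forall>v\<in>V. \<forall>a b. T (\<lambda>x. a * u x + b * v x) = (\<lambda>y. a * T u y + b * T v y)) \<and>
     (\<forall>u\<in>V. nW (T u) = nV u)"

definition continuous_sesquilinear ::
  "('x \<Rightarrow> complex) set \<Rightarrow> (('x \<Rightarrow> complex) \<Rightarrow> real) \<Rightarrow> (('x \<Rightarrow> complex) \<Rightarrow> ('x \<Rightarrow> complex) \<Rightarrow> complex) \<Rightarrow> bool" where
  "continuous_sesquilinear V nV B \<longleftrightarrow>
     (\<forall>u\<in>V. \<forall>v\<in>V. \<forall>w\<in>V. \<forall>a b.
        B (\<lambda>x. a * u x + b * v x) w = a * B u w + b * B v w \<and>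
        B w (\<lambda>x. a * u x + b * v x) = cnj a * B w u + cnj b * B w v) \<and>
     (\<exists>C. \<forall>u\<in>V. \<forall>v\<in>V. cmod (B u v) \<le> C * nV u * nV v)"

definition slp_coercive :: "real \<Rightarrow> 'a::euclidean_space set \<Rightarrow> real \<Rightarrow> bool" where
  "slp_coercive k \<Gamma> \<alpha> \<longleftrightarrow>
     (\<forall>\<phi>\<in>sobolev_supp (-1/2) \<Gamma>. cmod (slp_form k \<Gamma> \<phi> \<phi>) \<ge> \<alpha> * (sobolev_norm (-1/2) \<phi>)\<^sup>2)"

definition inverse_estimate ::
  "real \<Rightarrow> nat \<Rightarrow> (nat \<Rightarrow> 'a \<Rightarrow> 'a) \<Rightarrow> 'a::euclidean_space set \<Rightarrow> real \<Rightarrow> bool" where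
  "inverse_estimate d M s \<Gamma> c \<longleftrightarrow>
     (\<forall>h. 0 < h \<and> h \<le> diameter \<Gamma> \<longrightarrow> (\<forall>\<Psi>\<in>Y_space d M s \<Gamma> h.
        L2_norm (hausdorff_on d \<Gamma>) \<Psi> \<le>
          c * h powr (- t_exp d \<Gamma>) * HH_dual_norm (t_exp d \<Gamma>) d \<Gamma> (L2_embed (t_exp d \<Gamma>) d \<Gamma> \<Psi>)))"

section \<open>Galerkin matrix\<close>

definition galerkin_entry ::
  "real \<Rightarrow> real \<Rightarrow> 'a::euclidean_space set \<Rightarrow> ('a \<Rightarrow> complex) \<Rightarrow> ('a \<Rightarrow> complex) \<Rightarrow> complex" where
  "galerkin_entry k d \<Gamma> f g = integral\<^sup>L (hausdorff_on d \<Gamma>) (\<lambda>x.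
     integral\<^sup>L (hausdorff_on d \<Gamma>) (\<lambda>y. Phi k (x, 0) (y, 0) * f y * cnj (g x)))"

(* Rows and columns are numbered from 0. *)
definition galerkin_matrix ::
  "real \<Rightarrow> real \<Rightarrow> 'a::euclidean_space set \<Rightarrow> nat \<Rightarrow> (nat \<Rightarrow> 'a \<Rightarrow> complex) \<Rightarrow> complex Matrix.mat" where
  "galerkin_matrix k d \<Gamma> N f = Matrix.mat N N (\<lambda>(i, j). galerkin_entry k d \<Gamma> (f j) (f i))"

definition vec_norm2 :: "complex Matrix.vec \<Rightarrow> real" where
  "vec_norm2 v = sqrt (\<Sum>i<dim_vec v. (cmod (vec_index v i))\<^sup>2)"

definition mat_norm2 :: "complex Matrix.mat \<Rightarrow> real" where
  "mat_norm2 A = Sup {vec_norm2 (A *\<^sub>v v) | v. v \<in> carrier_vec (dim_col A) \<and> vec_norm2 v \<le> 1}"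

end

theory Submission
  imports Defs "HOL-Library.Sublist" "Jordan_Normal_Form.Determinant"
begin

text \<open>
  The functions \<open>\<chi>\<^sub>w\<close>, \<open>w \<in> L\<^sub>h\<close>, are orthonormal in \<open>L\<^sub>2(\<Gamma>)\<close>: under the open set condition the Hausdorff
  measure of \<open>\<Gamma>\<close> is positive and finite and distinct pieces overlap in null sets.  So \<open>A\<close> is the compression of
  the single-layer operator to an orthonormal system, which gives the upper bound by Bessel's inequality.
  For the lower bound, \<open>a\<^sup>H A a\<close> is the form at \<open>\<phi> = tr\<^sup>* \<Psi>\<close> with \<open>\<Psi> = \<Sum> a\<^sub>i f\<^sup>i\<close>; coercivity, the isometry of \<open>tr\<^sup>*\<close>, the
  inverse estimate and \<open>\<parallel>\<Psi>\<parallel> = \<parallel>a\<parallel>\<close> bound it from below.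

  The last step needs \<open>L\<^sub>2(\<Gamma>)\<close> functions to be continuous functionals on the trace space.  Instead of a trace
  theorem, the inverse estimate is used: it bounds \<open>\<parallel>c \<Psi>\<parallel>\<close> for all \<open>c\<close> by the supremum that defines the dual
  norm.  The supremum of an unbounded set is a constant (junk) value, so the functional must be bounded on the
  unit ball.  This in turn forces every \<open>H\<^sup>1\<^sup>/\<^sup>2\<close> distribution to be a limit of test functions, and then the trace
  space to be linear.
\<close>

section \<open>Square-integrable functions\<close>

text \<open>The bulk of the work comes from three definitions. \<open>measure_of\<close> returns the
  zero measure when its set function is not a measure, so nothing is known about
  \<open>hausdorff_measure\<close> until Caratheodory's criterion has been checked for
  \<open>hausdorff_outer\<close>. The number \<open>d\<close> enters only as the Hausdorff
  dimension, an infimum: Moran's equation and a positive finite measure have to be derived from the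
  open set condition before the \<open>chi\<close> functions are known to be normalised. And
  \<open>dist_fourier\<close> is a choice, so the linearity of Sobolev norms rests on
  almost-everywhere uniqueness of the transform, shown with explicit bump functions.

  The known facts about the adjoint trace speak of members of \<open>HH_dual\<close> only, which is
  why each basis function must be shown to define a continuous functional before coercivity can be
  applied. The inverse estimate therefore acts twice: on the multiples \<open>c * f j\<close> with
  arbitrary positive \<open>c\<close>, to obtain this membership, and on \<open>\<Psi>\<close>, to
  obtain the bound.\<close>

lemma L2_measurable: "f \<in> L2 \<mu> \<Longrightarrow> f \<in> borel_measurable \<mu>"
  by (simp add: L2_def)

lemma L2_integrable_sq: "f \<in> L2 \<mu> \<Longrightarrow> integrable \<mu> (\<lambda>x. (cmod (f x))\<^sup>2)"
  by (simp add: L2_def)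

lemma L2_norm_nonneg: "0 \<le> L2_norm \<mu> f"
  by (simp add: L2_norm_def)

lemma L2_norm_sq: "(L2_norm \<mu> f)\<^sup>2 = (\<integral>x. (cmod (f x))\<^sup>2 \<partial>\<mu>)"
  by (simp add: L2_norm_def)

text \<open>From (x + y)^2 <= 2 x^2 + 2 y^2. It stands in for Minkowski's inequality: the factors 2
  do no harm, because the estimates built on it serve only for integrability and for norms that are
  or tend to zero.\<close>

lemma cmod_lincomb_sq_le:
  "(cmod (a * z + b * w))\<^sup>2 \<le> 2 * (cmod a)\<^sup>2 * (cmod z)\<^sup>2 + 2 * (cmod b)\<^sup>2 * (cmod w)\<^sup>2"
proof -
  have "(cmod (a * z + b * w))\<^sup>2 \<le> (cmod (a * z) + cmod (b * w))\<^sup>2"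
    by (intro power_mono norm_triangle_ineq) simp
  also have "\<dots> \<le> 2 * (cmod (a * z))\<^sup>2 + 2 * (cmod (b * w))\<^sup>2"
    using sum_squares_bound[of "cmod (a * z)" "cmod (b * w)"] by (simp add: power2_sum)
  finally show ?thesis by (simp add: norm_mult power_mult_distrib)
qed

lemma L2_lincomb:
  assumes "f \<in> L2 \<mu>" "g \<in> L2 \<mu>"
  shows "(\<lambda>x. a * f x + b * g x) \<in> L2 \<mu>"
proof -
  note [measurable] = L2_measurable[OF assms(1)] L2_measurable[OF assms(2)]
  have "integrable \<mu> (\<lambda>x. (cmod (a * f x + b * g x))\<^sup>2)"
  proof (rule Bochner_Integration.integrable_bound)
    show "integrable \<mu> (\<lambda>x. 2 * (cmod a)\<^sup>2 * (cmod (f x))\<^sup>2 + 2 * (cmod b)\<^sup>2 * (cmod (g x))\<^sup>2)"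
      using assms by (intro Bochner_Integration.integrable_add integrable_mult_right L2_integrable_sq)
  qed (use cmod_lincomb_sq_le in \<open>auto intro!: AE_I2\<close>)
  then show ?thesis by (simp add: L2_def)
qed

lemma L2_norm_lincomb_sq_le:
  assumes "f \<in> L2 \<mu>" "g \<in> L2 \<mu>"
  shows "(L2_norm \<mu> (\<lambda>x. a * f x + b * g x))\<^sup>2
           \<le> 2 * (cmod a)\<^sup>2 * (L2_norm \<mu> f)\<^sup>2 + 2 * (cmod b)\<^sup>2 * (L2_norm \<mu> g)\<^sup>2"
proof -
  have "(L2_norm \<mu> (\<lambda>x. a * f x + b * g x))\<^sup>2
      \<le> (\<integral>x. 2 * (cmod a)\<^sup>2 * (cmod (f x))\<^sup>2 + 2 * (cmod b)\<^sup>2 * (cmod (g x))\<^sup>2 \<partial>\<mu>)"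
    unfolding L2_norm_sq
    using assms L2_lincomb[OF assms] cmod_lincomb_sq_le
    by (intro integral_mono) (auto intro!: Bochner_Integration.integrable_add integrable_mult_right L2_integrable_sq)
  also have "\<dots> = 2 * (cmod a)\<^sup>2 * (L2_norm \<mu> f)\<^sup>2 + 2 * (cmod b)\<^sup>2 * (L2_norm \<mu> g)\<^sup>2"
    using assms by (simp add: L2_norm_sq L2_integrable_sq)
  finally show ?thesis .
qed

lemma L2_norm_cmult: "L2_norm \<mu> (\<lambda>x. c * f x) = cmod c * L2_norm \<mu> f"
  by (simp add: L2_norm_def norm_mult power_mult_distrib real_sqrt_mult)

lemma L2_zero: "(\<lambda>x. 0) \<in> L2 \<mu>"
  by (simp add: L2_def)

lemma L2_cmult: "f \<in> L2 \<mu> \<Longrightarrow> (\<lambda>x. c * f x) \<in> L2 \<mu>"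
  using L2_lincomb[of f \<mu> f c 0] by simp

lemma L2_sum:
  assumes "\<And>i. i \<in> I \<Longrightarrow> f i \<in> L2 \<mu>"
  shows "(\<lambda>x. \<Sum>i\<in>I. c i * f i x) \<in> L2 \<mu>"
  using assms
proof (induction I rule: infinite_finite_induct)
  case (insert i I)
  then show ?case using L2_lincomb[of "f i" \<mu> "\<lambda>x. \<Sum>i\<in>I. c i * f i x" "c i" 1] by simp
qed (simp_all add: L2_zero)

lemma L2_mult_integrable:
  assumes "f \<in> L2 \<mu>" "g \<in> L2 \<mu>"
  shows "integrable \<mu> (\<lambda>x. f x * cnj (g x))"
proof (rule Bochner_Integration.integrable_bound)
  note [measurable] = L2_measurable[OF assms(1)] L2_measurable[OF assms(2)]
  show "integrable \<mu> (\<lambda>x. (cmod (f x))\<^sup>2 + (cmod (g x))\<^sup>2)"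
    using assms by (simp add: L2_integrable_sq)
  have "cmod z * cmod w \<le> (cmod z)\<^sup>2 + (cmod w)\<^sup>2" for z w
    using sum_squares_bound[of "cmod z" "cmod w"] mult_nonneg_nonneg[of "cmod z" "cmod w"] by (simp del: mult_nonneg_nonneg)
  then show "AE x in \<mu>. norm (f x * cnj (g x)) \<le> norm ((cmod (f x))\<^sup>2 + (cmod (g x))\<^sup>2)"
    by (auto simp: norm_mult)
  show "(\<lambda>x. f x * cnj (g x)) \<in> borel_measurable \<mu>"
    using borel_measurable_continuous_onI[OF continuous_on_cnj[OF continuous_on_id]] by measurable
qed

lemma L2_inner_cnj: "cnj (L2_inner \<mu> f g) = L2_inner \<mu> g f"
proof -
  have "cnj (L2_inner \<mu> f g) = (\<integral>x. cnj (f x * cnj (g x)) \<partial>\<mu>)"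
    unfolding L2_inner_def by (rule Bochner_Integration.integral_cnj[symmetric])
  then show ?thesis by (simp add: L2_inner_def mult.commute)
qed

lemma L2_inner_cmult_left: "L2_inner \<mu> (\<lambda>x. c * f x) g = c * L2_inner \<mu> f g"
  unfolding L2_inner_def by (simp add: mult.assoc)

lemma L2_inner_cmult_right: "L2_inner \<mu> f (\<lambda>x. c * g x) = cnj c * L2_inner \<mu> f g"
  using L2_inner_cmult_left[of \<mu> c g f] by (metis L2_inner_cnj complex_cnj_mult)

lemma L2_inner_lincomb_left:
  assumes "f \<in> L2 \<mu>" "g \<in> L2 \<mu>" "h \<in> L2 \<mu>"
  shows "L2_inner \<mu> (\<lambda>x. a * f x + b * g x) h = a * L2_inner \<mu> f h + b * L2_inner \<mu> g h"
proof -
  have "L2_inner \<mu> (\<lambda>x. a * f x + b * g x) h = (\<integral>x. a * (f x * cnj (h x)) + b * (g x * cnj (h x)) \<partial>\<mu>)"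
    unfolding L2_inner_def by (simp add: algebra_simps)
  also have "\<dots> = a * L2_inner \<mu> f h + b * L2_inner \<mu> g h"
    using assms unfolding L2_inner_def by (simp add: L2_mult_integrable)
  finally show ?thesis .
qed

lemma L2_inner_lincomb_right:
  assumes "f \<in> L2 \<mu>" "g \<in> L2 \<mu>" "h \<in> L2 \<mu>"
  shows "L2_inner \<mu> h (\<lambda>x. a * f x + b * g x) = cnj a * L2_inner \<mu> h f + cnj b * L2_inner \<mu> h g"
  using L2_inner_lincomb_left[OF assms, of a b]
  by (metis L2_inner_cnj complex_cnj_add complex_cnj_mult)

lemma L2_inner_sum_left:
  assumes "\<And>i. i \<in> I \<Longrightarrow> f i \<in> L2 \<mu>" "h \<in> L2 \<mu>"
  shows "L2_inner \<mu> (\<lambda>x. \<Sum>i\<in>I. c i * f i x) h = (\<Sum>i\<in>I. c i * L2_inner \<mu> (f i) h)"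
  using assms
proof (induction I rule: infinite_finite_induct)
  case (insert i I)
  then show ?case
    using L2_inner_lincomb_left[of "f i" \<mu> "\<lambda>x. \<Sum>i\<in>I. c i * f i x" h "c i" 1] L2_sum[of I f \<mu> c] by simp
qed (simp_all add: L2_inner_def)

lemma L2_inner_sum_right:
  assumes "\<And>i. i \<in> I \<Longrightarrow> f i \<in> L2 \<mu>" "h \<in> L2 \<mu>"
  shows "L2_inner \<mu> h (\<lambda>x. \<Sum>i\<in>I. c i * f i x) = (\<Sum>i\<in>I. cnj (c i) * L2_inner \<mu> h (f i))"
proof -
  have "L2_inner \<mu> h (\<lambda>x. \<Sum>i\<in>I. c i * f i x) = cnj (\<Sum>i\<in>I. c i * L2_inner \<mu> (f i) h)"
    by (simp only: L2_inner_cnj L2_inner_sum_left[OF assms, symmetric])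
  then show ?thesis by (simp add: L2_inner_cnj)
qed

lemma L2_inner_self: "L2_inner \<mu> f f = complex_of_real ((L2_norm \<mu> f)\<^sup>2)"
proof -
  have "complex_of_real ((L2_norm \<mu> f)\<^sup>2) = (\<integral>x. complex_of_real ((cmod (f x))\<^sup>2) \<partial>\<mu>)"
    unfolding L2_norm_sq by (rule integral_complex_of_real[symmetric])
  then show ?thesis unfolding L2_inner_def by (simp only: complex_norm_square)
qed

lemma L2_norm_orthonormal_sum:
  assumes "finite I" "\<And>i. i \<in> I \<Longrightarrow> f i \<in> L2 \<mu>"
    and orth: "\<And>i j. i \<in> I \<Longrightarrow> j \<in> I \<Longrightarrow> L2_inner \<mu> (f i) (f j) = (if i = j then 1 else 0)"
  shows "(L2_norm \<mu> (\<lambda>x. \<Sum>i\<in>I. c i * f i x))\<^sup>2 = (\<Sum>i\<in>I. (cmod (c i))\<^sup>2)"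
proof -
  have "complex_of_real ((L2_norm \<mu> (\<lambda>x. \<Sum>i\<in>I. c i * f i x))\<^sup>2)
      = (\<Sum>i\<in>I. c i * (\<Sum>j\<in>I. cnj (c j) * L2_inner \<mu> (f i) (f j)))"
    unfolding L2_inner_self[symmetric] using assms(2) L2_sum[of I f \<mu> c]
    by (simp add: L2_inner_sum_left L2_inner_sum_right)
  also have "\<dots> = (\<Sum>i\<in>I. c i * cnj (c i))"
  proof (rule sum.cong[OF refl])
    fix i assume i: "i \<in> I"
    have "(\<Sum>j\<in>I. cnj (c j) * L2_inner \<mu> (f i) (f j)) = (\<Sum>j\<in>I. if i = j then cnj (c j) else 0)"
      by (rule sum.cong) (auto simp: orth i)
    then show "c i * (\<Sum>j\<in>I. cnj (c j) * L2_inner \<mu> (f i) (f j)) = c i * cnj (c i)"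
      using i assms(1) by simp
  qed
  also have "\<dots> = complex_of_real (\<Sum>i\<in>I. (cmod (c i))\<^sup>2)"
    by (simp add: complex_norm_square del: of_real_power)
  finally show ?thesis by (simp only: of_real_eq_iff)
qed

text \<open>Let \<open>p\<close> be the orthogonal projection of \<open>g\<close> on the span of the
  \<open>f i\<close>. The inner products of \<open>g\<close> with \<open>p\<close>, \<open>p\<close>
  with \<open>g\<close> and \<open>p\<close> with itself all equal the sum on the left, so the
  squared norm of \<open>g - p\<close> is the difference of the two sides.\<close>

lemma L2_bessel:
  assumes "finite I" "\<And>i. i \<in> I \<Longrightarrow> f i \<in> L2 \<mu>" "g \<in> L2 \<mu>"
    and orth: "\<And>i j. i \<in> I \<Longrightarrow> j \<in> I \<Longrightarrow> L2_inner \<mu> (f i) (f j) = (if i = j then 1 else 0)"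
  shows "(\<Sum>i\<in>I. (cmod (L2_inner \<mu> g (f i)))\<^sup>2) \<le> (L2_norm \<mu> g)\<^sup>2"
proof -
  define c where "c i = L2_inner \<mu> g (f i)" for i
  define p where "p x = (\<Sum>i\<in>I. c i * f i x)" for x
  have p: "p \<in> L2 \<mu>" unfolding p_def using assms(2) by (rule L2_sum)
  have gp: "L2_inner \<mu> g p = (\<Sum>i\<in>I. (cmod (c i))\<^sup>2)"
    unfolding p_def using assms(2,3)
    by (simp add: L2_inner_sum_right c_def[symmetric] complex_norm_square mult.commute del: of_real_power)
  have pp: "L2_inner \<mu> p p = (\<Sum>i\<in>I. (cmod (c i))\<^sup>2)"
    unfolding L2_inner_self p_def using L2_norm_orthonormal_sum[OF assms(1,2) orth, of c] by simp
  have pg: "L2_inner \<mu> p g = (\<Sum>i\<in>I. (cmod (c i))\<^sup>2)"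
    using arg_cong[OF gp, of cnj] by (simp add: L2_inner_cnj)
  define q where "q x = 1 * g x + (-1) * p x" for x
  have q: "q \<in> L2 \<mu>" unfolding q_def by (rule L2_lincomb[OF assms(3) p])
  have "complex_of_real ((L2_norm \<mu> q)\<^sup>2) = L2_inner \<mu> q q" by (simp add: L2_inner_self)
  also have "\<dots> = L2_inner \<mu> g q - L2_inner \<mu> p q"
    using L2_inner_lincomb_left[OF assms(3) p q, of 1 "-1"] unfolding q_def[abs_def, symmetric] by simp
  also have "\<dots> = (L2_inner \<mu> g g - L2_inner \<mu> g p) - (L2_inner \<mu> p g - L2_inner \<mu> p p)"
    using L2_inner_lincomb_right[OF assms(3) p assms(3), of 1 "-1"] L2_inner_lincomb_right[OF assms(3) p p, of 1 "-1"]
    unfolding q_def[abs_def, symmetric] by simp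
  also have "\<dots> = complex_of_real ((L2_norm \<mu> g)\<^sup>2 - (\<Sum>i\<in>I. (cmod (c i))\<^sup>2))"
    unfolding gp pg pp by (simp add: L2_inner_self)
  finally have "(L2_norm \<mu> q)\<^sup>2 = (L2_norm \<mu> g)\<^sup>2 - (\<Sum>i\<in>I. (cmod (c i))\<^sup>2)"
    by (simp only: of_real_eq_iff)
  then show ?thesis unfolding c_def using zero_le_power2[of "L2_norm \<mu> q"] by linarith
qed

section \<open>Hausdorff measure as a metric outer measure\<close>

definition hausdorff_covers :: "real \<Rightarrow> 'a::euclidean_space set \<Rightarrow> (nat \<Rightarrow> 'a set) set" where
  "hausdorff_covers \<delta> A = {U. A \<subseteq> (\<Union>i. U i) \<and> (\<forall>i. bounded (U i) \<and> diameter (U i) \<le> \<delta>)}"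

text \<open>The premeasure at a fixed scale; \<open>hausdorff_outer\<close> is its supremum over all
  scales. Subadditivity and additivity on separated sets are shown at one scale and then passed to
  the supremum.\<close>

definition hausdorff_pre :: "real \<Rightarrow> real \<Rightarrow> 'a::euclidean_space set \<Rightarrow> ennreal" where
  "hausdorff_pre d \<delta> A = (INF U\<in>hausdorff_covers \<delta> A. \<Sum>i. ennreal (hausdorff_weight d (U i)))"

lemma hausdorff_outer_eq_SUP: "hausdorff_outer d A = (SUP \<delta>\<in>{0<..}. hausdorff_pre d \<delta> A)"
  unfolding hausdorff_outer_def hausdorff_pre_def hausdorff_covers_def by simp

lemma hausdorff_weight_eq: "0 < d \<Longrightarrow> hausdorff_weight d U = diameter U powr d"
  by (simp add: hausdorff_weight_def)

lemma hausdorff_pre_mono: "A \<subseteq> B \<Longrightarrow> hausdorff_pre d \<delta> A \<le> hausdorff_pre d \<delta> B"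
  unfolding hausdorff_pre_def hausdorff_covers_def by (rule INF_superset_mono) auto

lemma hausdorff_pre_antimono: "\<delta> \<le> \<epsilon> \<Longrightarrow> hausdorff_pre d \<epsilon> A \<le> hausdorff_pre d \<delta> A"
  unfolding hausdorff_pre_def hausdorff_covers_def by (rule INF_superset_mono) (auto intro: order_trans)

lemma hausdorff_pre_le_outer: "0 < \<delta> \<Longrightarrow> hausdorff_pre d \<delta> A \<le> hausdorff_outer d A"
  unfolding hausdorff_outer_eq_SUP by (rule SUP_upper) auto

lemma hausdorff_pre_le:
  "U \<in> hausdorff_covers \<delta> A \<Longrightarrow> hausdorff_pre d \<delta> A \<le> (\<Sum>i. ennreal (hausdorff_weight d (U i)))"
  unfolding hausdorff_pre_def by (rule INF_lower)

lemma hausdorff_outer_mono: "A \<subseteq> B \<Longrightarrow> hausdorff_outer d A \<le> hausdorff_outer d B"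
  unfolding hausdorff_outer_eq_SUP by (rule SUP_mono) (use hausdorff_pre_mono in blast)

lemma hausdorff_outer_empty: "hausdorff_outer d {} = 0"
proof -
  have "hausdorff_pre d \<delta> {} = 0" if "0 < \<delta>" for \<delta> :: real
  proof -
    have "(\<lambda>_. {}) \<in> hausdorff_covers \<delta> {}" using that by (auto simp: hausdorff_covers_def diameter_def)
    from hausdorff_pre_le[OF this, of d] show ?thesis by (simp add: hausdorff_weight_def)
  qed
  then show ?thesis unfolding hausdorff_outer_eq_SUP by (intro antisym SUP_least) auto
qed

lemma hausdorff_pre_close:
  "hausdorff_pre d \<delta> A < e \<Longrightarrow> \<exists>U\<in>hausdorff_covers \<delta> A. (\<Sum>i. ennreal (hausdorff_weight d (U i))) < e"
  unfolding hausdorff_pre_def INF_less_iff by auto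

lemma hausdorff_pre_UN_le:
  fixes A :: "nat \<Rightarrow> 'a::euclidean_space set"
  shows "hausdorff_pre d \<delta> (\<Union>n. A n) \<le> (\<Sum>n. hausdorff_pre d \<delta> (A n))"
proof (rule ennreal_le_epsilon)
  fix e :: real assume e: "0 < e" "(\<Sum>n. hausdorff_pre d \<delta> (A n)) < top_class.top"
  then have *: "\<And>n. hausdorff_pre d \<delta> (A n) < hausdorff_pre d \<delta> (A n) + e * (1/2)^Suc n"
    by (auto simp add: less_top dest!: ennreal_suminf_lessD)
  obtain B where B: "\<And>n. B n \<in> hausdorff_covers \<delta> (A n)"
    and Ble: "\<And>n. (\<Sum>i. ennreal (hausdorff_weight d (B n i))) \<le> hausdorff_pre d \<delta> (A n) + e * (1/2)^(Suc n)"
    using hausdorff_pre_close[OF *] by (metis less_imp_le)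
  \<comment> \<open>The double sequence of covers is listed as one sequence through the pairing of
    naturals.\<close>
  define C where "C = case_prod B o prod_decode"
  have "C \<in> hausdorff_covers \<delta> (\<Union>n. A n)"
    unfolding hausdorff_covers_def
  proof safe
    fix n x assume "x \<in> A n"
    then obtain i where "x \<in> B n i" using B[of n] by (auto simp: hausdorff_covers_def)
    then have "x \<in> C (prod_encode (n, i))" by (simp add: C_def)
    then show "x \<in> (\<Union>i. C i)" by blast
  qed (use B in \<open>auto simp: hausdorff_covers_def C_def split_beta\<close>)
  then have "hausdorff_pre d \<delta> (\<Union>n. A n) \<le> (\<Sum>i. ennreal (hausdorff_weight d (C i)))"
    by (rule hausdorff_pre_le)
  also have "\<dots> = (\<Sum>n. \<Sum>i. ennreal (hausdorff_weight d (B n i)))"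
    using suminf_ennreal_2dimen[of "\<lambda>n. \<Sum>i. ennreal (hausdorff_weight d (B n i))"
        "\<lambda>(n, i). ennreal (hausdorff_weight d (B n i))"]
    by (simp add: C_def comp_def split_beta)
  also have "\<dots> \<le> (\<Sum>n. hausdorff_pre d \<delta> (A n) + e * (1/2) ^ Suc n)"
    by (intro suminf_le Ble) auto
  also have "\<dots> = (\<Sum>n. hausdorff_pre d \<delta> (A n)) + (\<Sum>n. ennreal e * ennreal ((1/2) ^ Suc n))"
    using \<open>0 < e\<close> by (subst suminf_add[symmetric])
                     (auto simp del: ennreal_suminf_cmult simp add: ennreal_mult[symmetric])
  also have "\<dots> = (\<Sum>n. hausdorff_pre d \<delta> (A n)) + e"
    unfolding ennreal_suminf_cmult
    by (subst suminf_ennreal_eq[OF zero_le_power power_half_series]) auto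
  finally show "hausdorff_pre d \<delta> (\<Union>n. A n) \<le> (\<Sum>n. hausdorff_pre d \<delta> (A n)) + e" .
qed

lemma hausdorff_outer_UN_le:
  fixes A :: "nat \<Rightarrow> 'a::euclidean_space set"
  shows "hausdorff_outer d (\<Union>n. A n) \<le> (\<Sum>n. hausdorff_outer d (A n))"
  unfolding hausdorff_outer_eq_SUP[of d "\<Union>n. A n"]
proof (rule SUP_least)
  fix \<delta> :: real assume "\<delta> \<in> {0<..}"
  then have "(\<Sum>n. hausdorff_pre d \<delta> (A n)) \<le> (\<Sum>n. hausdorff_outer d (A n))"
    by (intro suminf_le hausdorff_pre_le_outer) auto
  then show "hausdorff_pre d \<delta> (\<Union>n. A n) \<le> (\<Sum>n. hausdorff_outer d (A n))"
    by (rule order_trans[OF hausdorff_pre_UN_le])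
qed

lemma hausdorff_outer_measure_space:
  "outer_measure_space (Pow UNIV) (hausdorff_outer d :: 'a::euclidean_space set \<Rightarrow> ennreal)"
  unfolding outer_measure_space_def positive_def increasing_def countably_subadditive_def
  by (auto simp: hausdorff_outer_empty hausdorff_outer_mono hausdorff_outer_UN_le)

lemma hausdorff_outer_Un_le: "hausdorff_outer d (A \<union> B) \<le> hausdorff_outer d A + hausdorff_outer d B"
proof -
  interpret sigma_algebra UNIV "Pow UNIV" by (rule sigma_algebra_Pow)
  have "subadditive (Pow UNIV) (hausdorff_outer d :: 'a set \<Rightarrow> ennreal)"
    using hausdorff_outer_measure_space by (intro countably_subadditive_subadditive) (auto simp: outer_measure_space_def)
  moreover have "hausdorff_outer d (A \<union> B) = hausdorff_outer d (A \<union> (B - A))" by (simp add: Un_Diff_cancel)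
  ultimately have "hausdorff_outer d (A \<union> B) \<le> hausdorff_outer d A + hausdorff_outer d (B - A)"
    by (metis Diff_disjoint Pow_UNIV UNIV_I subadditive_def)
  also have "\<dots> \<le> hausdorff_outer d A + hausdorff_outer d B"
    by (intro add_left_mono hausdorff_outer_mono) auto
  finally show ?thesis .
qed

text \<open>A set of diameter at most \<open>\<delta>\<close> cannot meet both \<open>A\<close> and
  \<open>B\<close>, so every cover of the union splits into a cover of \<open>A\<close> and a cover
  of \<open>B\<close> that use no set twice.\<close>

lemma hausdorff_pre_separated:
  assumes d: "0 < d" and sep: "\<And>x y. x \<in> A \<Longrightarrow> y \<in> B \<Longrightarrow> \<delta> < dist x y"
  shows "hausdorff_pre d \<delta> A + hausdorff_pre d \<delta> B \<le> hausdorff_pre d \<delta> (A \<union> B)"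
  unfolding hausdorff_pre_def[of d \<delta> "A \<union> B"]
proof (rule INF_greatest)
  fix U assume U: "U \<in> hausdorff_covers \<delta> (A \<union> B)"
  \<comment> \<open>Sets that miss \<open>A\<close> are replaced by the empty set, whose weight is
    0, so the indexing by naturals is kept.\<close>
  define V where "V i = (if U i \<inter> A \<noteq> {} then U i else {})" for i
  define W where "W i = (if U i \<inter> B \<noteq> {} then U i else {})" for i
  \<comment> \<open>The empty sets in \<open>V\<close> and \<open>W\<close> are admissible only if
    \<open>\<delta>\<close> is nonnegative; the diameter of \<open>U 0\<close> shows that it
    is.\<close>
  have "0 \<le> \<delta>" using U order_trans[OF diameter_ge_0, of "U 0" \<delta>] by (auto simp: hausdorff_covers_def)
  moreover have "A \<subseteq> (\<Union>i. V i)" "B \<subseteq> (\<Union>i. W i)"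
    using U by (fastforce simp: hausdorff_covers_def V_def W_def)+
  ultimately have "V \<in> hausdorff_covers \<delta> A" "W \<in> hausdorff_covers \<delta> B"
    using U by (simp_all add: hausdorff_covers_def V_def W_def)
  then have "hausdorff_pre d \<delta> A + hausdorff_pre d \<delta> B
      \<le> (\<Sum>i. ennreal (hausdorff_weight d (V i))) + (\<Sum>i. ennreal (hausdorff_weight d (W i)))"
    by (intro add_mono hausdorff_pre_le)
  also have "\<dots> = (\<Sum>i. ennreal (hausdorff_weight d (V i)) + ennreal (hausdorff_weight d (W i)))"
    by (rule suminf_add) auto
  also have "\<dots> \<le> (\<Sum>i. ennreal (hausdorff_weight d (U i)))"
  proof (rule suminf_le)
    fix i
    have False if "x \<in> U i" "x \<in> A" "y \<in> U i" "y \<in> B" for x y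
    proof -
      note that
      moreover from this have "dist x y \<le> diameter (U i)"
        using U by (intro diameter_bounded_bound) (auto simp: hausdorff_covers_def)
      moreover have "diameter (U i) \<le> \<delta>" using U by (auto simp: hausdorff_covers_def)
      ultimately show False using sep[of x y] by auto
    qed
    then have "U i \<inter> A = {} \<or> U i \<inter> B = {}" by blast
    then show "ennreal (hausdorff_weight d (V i)) + ennreal (hausdorff_weight d (W i))
        \<le> ennreal (hausdorff_weight d (U i))"
      by (auto simp: V_def W_def hausdorff_weight_def)
  qed auto
  finally show "hausdorff_pre d \<delta> A + hausdorff_pre d \<delta> B \<le> (\<Sum>i. ennreal (hausdorff_weight d (U i)))" .
qed

lemma hausdorff_outer_separated:
  assumes d: "0 < d" and r: "0 < r" and sep: "\<And>x y. x \<in> A \<Longrightarrow> y \<in> B \<Longrightarrow> r \<le> dist x y"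
  shows "hausdorff_outer d A + hausdorff_outer d B \<le> hausdorff_outer d (A \<union> B)"
proof -
  have *: "hausdorff_pre d \<delta> A + hausdorff_pre d \<epsilon> B \<le> hausdorff_outer d (A \<union> B)"
    if "0 < \<delta>" "0 < \<epsilon>" for \<delta> \<epsilon>
  proof -
    \<comment> \<open>At scales below the gap \<open>r\<close> the premeasures add; halving
      \<open>r\<close> gives the strict inequality that \<open>hausdorff_pre_separated\<close> asks
      for.\<close>
    define m where "m = min (min \<delta> \<epsilon>) (r / 2)"
    have m: "0 < m" "m \<le> \<delta>" "m \<le> \<epsilon>" "m < r" using that r by (auto simp: m_def)
    have "hausdorff_pre d \<delta> A + hausdorff_pre d \<epsilon> B \<le> hausdorff_pre d m A + hausdorff_pre d m B"
      using m by (intro add_mono hausdorff_pre_antimono)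
    also have "\<dots> \<le> hausdorff_pre d m (A \<union> B)"
      using d sep m by (intro hausdorff_pre_separated) force+
    also have "\<dots> \<le> hausdorff_outer d (A \<union> B)" using m by (intro hausdorff_pre_le_outer)
    finally show ?thesis .
  qed
  have "hausdorff_outer d A + hausdorff_pre d \<epsilon> B \<le> hausdorff_outer d (A \<union> B)" if "0 < \<epsilon>" for \<epsilon>
    unfolding hausdorff_outer_eq_SUP[of d A] using *[OF _ that]
    by (subst ennreal_SUP_add_left[symmetric]) (auto intro!: SUP_least)
  then have "(SUP \<epsilon>\<in>{0<..}. hausdorff_outer d A + hausdorff_pre d \<epsilon> B) \<le> hausdorff_outer d (A \<union> B)"
    by (intro SUP_least) auto
  then show ?thesis unfolding hausdorff_outer_eq_SUP[of d B]
    by (simp add: ennreal_SUP_add_right)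
qed

text \<open>Caratheodory's criterion for metric outer measures: the shells on which the distance to
  \<open>C\<close> lies in \<open>[1/(k+2), 1/(k+1))\<close> are separated within each parity class, so their measures are
  summable and the tail of the shells does not count.\<close>

lemma hausdorff_outer_closed_split:
  fixes C :: "'a::euclidean_space set"
  assumes d: "0 < d" and C: "closed C"
  shows "hausdorff_outer d (A \<inter> C) + hausdorff_outer d (A - C) \<le> hausdorff_outer d A"
proof (cases "C = {} \<or> hausdorff_outer d A = top_class.top")
  case True
  then show ?thesis by (auto simp: hausdorff_outer_empty)
next
  case False
  then have ne: "C \<noteq> {}" and fin: "hausdorff_outer d A < top_class.top" by (auto simp: less_top)
  let ?H = "hausdorff_outer d"
  define B where "B k = {x \<in> A. 1 / real (Suc k) \<le> infdist x C}" for k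
  define R where "R k = {x \<in> A. 1 / real (Suc (Suc k)) \<le> infdist x C \<and> infdist x C < 1 / real (Suc k)}" for k
  have dist_ge: "infdist x C - infdist y C \<le> dist x y" for x y
    using infdist_triangle[of x C y] by simp
  have parity: "(\<Sum>i<n. ?H (R (2 * i + p))) \<le> ?H (\<Union>i<n. R (2 * i + p))" for n p
  proof (induction n)
    case (Suc n)
    show ?case
    proof (cases "n = 0")
      case True then show ?thesis by (simp add: lessThan_Suc)
    next
      case False
      \<comment> \<open>Between neighbouring shells of equal parity lies a whole shell of the other
        parity; \<open>r\<close> is its width. For \<open>n = 0\<close> there is no earlier shell
        and the first fraction could be 1/0.\<close>
      define r where "r = 1 / real (2 * n + p) - 1 / real (2 * n + p + 1)"
      have r: "0 < r" using False unfolding r_def by (simp add: divide_strict_left_mono)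
      have sep: "r \<le> dist x y" if x: "x \<in> (\<Union>i<n. R (2 * i + p))" and y: "y \<in> R (2 * n + p)" for x y
      proof -
        from x obtain i where i: "i < n" "x \<in> R (2 * i + p)" by auto
        have "1 / real (2 * n + p) \<le> 1 / real (Suc (Suc (2 * i + p)))"
          using i by (intro divide_left_mono) auto
        also have "\<dots> \<le> infdist x C" using i by (simp add: R_def)
        finally have "1 / real (2 * n + p) \<le> infdist x C" .
        moreover have "infdist y C < 1 / real (2 * n + p + 1)" using y by (simp add: R_def add.commute)
        ultimately show ?thesis using dist_ge[of x y] unfolding r_def by linarith
      qed
      have "(\<Sum>i<Suc n. ?H (R (2 * i + p))) \<le> ?H (\<Union>i<n. R (2 * i + p)) + ?H (R (2 * n + p))"
        using Suc.IH by (simp add: add_right_mono)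
      also have "\<dots> \<le> ?H ((\<Union>i<n. R (2 * i + p)) \<union> R (2 * n + p))"
        using hausdorff_outer_separated[OF d r sep] by blast
      also have "(\<Union>i<n. R (2 * i + p)) \<union> R (2 * n + p) = (\<Union>i<Suc n. R (2 * i + p))"
        by (auto simp: lessThan_Suc)
      finally show ?thesis .
    qed
  qed simp
  have RA: "?H (\<Union>i<n. R (2 * i + p)) \<le> ?H A" for n p
    by (rule hausdorff_outer_mono) (auto simp: R_def)
  have Rfin: "?H (R k) < top_class.top" for k
    using hausdorff_outer_mono[of "R k" A d] fin by (auto simp: R_def intro: le_less_trans)
  \<comment> \<open>All values are finite, so the tail argument can run with a convergent series of
    reals.\<close>
  define a where "a k = enn2real (?H (R k))" for k
  have aH: "?H (R k) = ennreal (a k)" for k using Rfin[of k] by (simp add: a_def)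
  have a0: "0 \<le> a k" for k by (simp add: a_def)
  have partial: "(\<Sum>i<n. a (2 * i + p)) \<le> enn2real (?H A)" for n p
  proof -
    have "ennreal (\<Sum>i<n. a (2 * i + p)) = (\<Sum>i<n. ?H (R (2 * i + p)))"
      by (simp add: aH a0)
    also have "\<dots> \<le> ?H A" by (rule order_trans[OF parity RA])
    finally have "enn2real (ennreal (\<Sum>i<n. a (2 * i + p))) \<le> enn2real (?H A)"
      using fin by (rule enn2real_mono)
    then show ?thesis using a0 by (simp add: sum_nonneg)
  qed
  have split: "(\<Sum>k<2 * n. a k) = (\<Sum>i<n. a (2 * i)) + (\<Sum>i<n. a (2 * i + 1))" for n
    by (induction n) auto
  have "summable a"
  proof (rule summableI_nonneg_bounded)
    fix n
    have "(\<Sum>k<n. a k) \<le> (\<Sum>k<2 * n. a k)" using a0 by (intro sum_mono2) auto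
    also have "\<dots> \<le> 2 * enn2real (?H A)"
      using partial[of 0 n] partial[of 1 n] unfolding split by simp
    finally show "(\<Sum>k<n. a k) \<le> 2 * enn2real (?H A)" .
  qed (rule a0)
  show ?thesis
  proof (rule ennreal_le_epsilon)
    fix e :: real assume e: "0 < e"
    from suminf_exist_split[OF e \<open>summable a\<close>] obtain k where "norm (\<Sum>i. a (i + k)) < e" by blast
    then have tail: "(\<Sum>i. a (i + k)) < e" by simp
    have "A - C \<subseteq> B k \<union> (\<Union>i. R (i + k))"
    proof
      fix x assume x: "x \<in> A - C"
      then have pos: "0 < infdist x C" using C ne infdist_pos_not_in_closed by blast
      show "x \<in> B k \<union> (\<Union>i. R (i + k))"
      proof (rule ccontr)
        assume contra: "x \<notin> B k \<union> (\<Union>i. R (i + k))"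
        \<comment> \<open>Outside \<open>B k\<close> and outside every shell, the distance is pushed
          below each bound in turn, one shell at a time, until it contradicts
          \<open>pos\<close>.\<close>
        have "infdist x C < 1 / real (Suc (i + k))" for i
        proof (induction i)
          case 0 then show ?case using contra x by (auto simp: B_def)
        next
          case (Suc i) then show ?case using contra x by (force simp: R_def)
        qed
        moreover obtain N where "inverse (real (Suc N)) < infdist x C" using reals_Archimedean[OF pos] by blast
        moreover have "1 / real (Suc (N + k)) \<le> inverse (real (Suc N))"
          by (simp add: field_simps)
        ultimately show False by (meson less_asym less_le_trans)
      qed
    qed
    then have "?H (A - C) \<le> ?H (B k \<union> (\<Union>i. R (i + k)))" by (rule hausdorff_outer_mono)
    also have "\<dots> \<le> ?H (B k) + ?H (\<Union>i. R (i + k))" by (rule hausdorff_outer_Un_le)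
    also have "\<dots> \<le> ?H (B k) + (\<Sum>i. ?H (R (i + k)))" by (intro add_left_mono hausdorff_outer_UN_le)
    also have "(\<Sum>i. ?H (R (i + k))) = ennreal (\<Sum>i. a (i + k))"
      unfolding aH using a0 \<open>summable a\<close> by (intro suminf_ennreal2) (auto simp: summable_iff_shift)
    finally have 1: "?H (A - C) \<le> ?H (B k) + ennreal e"
      using tail by (meson add_left_mono ennreal_leI less_imp_le order_trans)
    have "?H (A \<inter> C) + ?H (B k) \<le> ?H ((A \<inter> C) \<union> B k)"
    proof (rule hausdorff_outer_separated[OF d, of "1 / real (Suc k)"])
      fix x y assume "x \<in> A \<inter> C" "y \<in> B k"
      then show "1 / real (Suc k) \<le> dist x y"
        using dist_ge[of y x] by (auto simp: B_def dist_commute)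
    qed simp
    also have "\<dots> \<le> ?H A" by (rule hausdorff_outer_mono) (auto simp: B_def)
    finally have 2: "?H (A \<inter> C) + ?H (B k) \<le> ?H A" .
    have "?H (A \<inter> C) + ?H (A - C) \<le> ?H (A \<inter> C) + (?H (B k) + ennreal e)"
      using 1 by (rule add_left_mono)
    also have "\<dots> \<le> ?H A + ennreal e" using 2 by (simp add: add.assoc[symmetric] add_right_mono)
    finally show "?H (A \<inter> C) + ?H (A - C) \<le> ?H A + ennreal e" .
  qed
qed

text \<open>\<open>measure_of\<close> yields the zero measure if its set function is not a measure,
  so this is what gives \<open>hausdorff_measure\<close> its values. Closed sets lie in
  Caratheodory's sigma-algebra of the outer measure, hence so do all Borel sets.\<close>

lemma measure_space_hausdorff_outer:
  assumes "0 < d"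
  shows "measure_space UNIV (sets (borel :: 'a::euclidean_space measure)) (hausdorff_outer d)"
proof -
  interpret P: sigma_algebra UNIV "Pow UNIV :: 'a set set" by (rule sigma_algebra_Pow)
  let ?L = "lambda_system UNIV (Pow UNIV) (hausdorff_outer d :: 'a set \<Rightarrow> ennreal)"
  have L: "measure_space UNIV ?L (hausdorff_outer d)"
    by (rule P.caratheodory_lemma[OF hausdorff_outer_measure_space])
  interpret L: sigma_algebra UNIV ?L using L by (simp add: measure_space_def)
  have "C \<in> ?L" if "closed C" for C :: "'a set"
  proof -
    have "hausdorff_outer d (A \<inter> C) + hausdorff_outer d (A - C) = hausdorff_outer d A" for A
      using hausdorff_outer_closed_split[OF assms that, of A] hausdorff_outer_Un_le[of d "A \<inter> C" "A - C"]
      by (simp add: Int_Diff_Un antisym)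
    then show ?thesis unfolding P.lambda_system_eq by simp
  qed
  then have "sigma_sets UNIV (Collect closed) \<subseteq> ?L" by (intro L.sigma_sets_subset) auto
  then have "sets (borel :: 'a measure) \<subseteq> ?L" by (simp add: borel_eq_closed)
  with L show ?thesis
    using sets.sigma_algebra_axioms[of "borel :: 'a measure"] by (intro measure_down[OF L]) simp_all
qed

lemma sets_hausdorff_measure: "sets (hausdorff_measure d :: 'a::euclidean_space measure) = sets borel"
  unfolding hausdorff_measure_def by (metis sets.sets_measure_of_eq space_borel)

lemma space_hausdorff_measure: "space (hausdorff_measure d :: 'a::euclidean_space measure) = UNIV"
  unfolding hausdorff_measure_def by (rule space_measure_of) auto

lemma emeasure_hausdorff_measure:
  assumes "0 < d" "A \<in> sets borel"
  shows "emeasure (hausdorff_measure d) A = hausdorff_outer d A"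
  using measure_space_hausdorff_outer[OF assms(1)] assms(2)
  unfolding hausdorff_measure_def
  by (intro emeasure_measure_of_sigma) (auto simp: measure_space_def)

section \<open>Scaling of the Hausdorff measure, and dimension\<close>

lemma diameter_similarity_le:
  fixes s :: "'a::euclidean_space \<Rightarrow> 'a"
  assumes s: "\<And>x y. dist (s x) (s y) = r * dist x y" and r: "0 < r" and U: "bounded U"
  shows "diameter (s ` U) \<le> r * diameter U"
proof (rule diameter_le)
  show "s ` U \<noteq> {} \<or> 0 \<le> r * diameter U" using r U diameter_ge_0 by auto
  fix x y assume "x \<in> s ` U" "y \<in> s ` U"
  then obtain u v where uv: "x = s u" "y = s v" "u \<in> U" "v \<in> U" by auto
  then show "norm (x - y) \<le> r * diameter U"
    using s[of u v] r diameter_bounded_bound[OF U uv(3,4)] by (simp add: dist_norm)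
qed

lemma ennreal_divide_le_iff:
  assumes "0 < b"
  shows "x / ennreal b \<le> y \<longleftrightarrow> x \<le> ennreal b * y"
proof
  assume "x / ennreal b \<le> y"
  then have "ennreal b * (x / ennreal b) \<le> ennreal b * y" by (rule mult_left_mono) simp
  then show "x \<le> ennreal b * y"
    using assms by (simp add: ennreal_times_divide mult.commute[of "ennreal b"] ennreal_mult_divide_eq)
next
  assume "x \<le> ennreal b * y"
  then show "x / ennreal b \<le> y" using assms by (intro divide_le_posI_ennreal) (simp_all add: mult.commute)
qed

text \<open>The image of a cover of \<open>A\<close> at scale \<open>\<delta> / r\<close> covers the
  image of \<open>A\<close> at scale \<open>\<delta>\<close>, and each weight gains at most the
  factor r^d.\<close>

lemma hausdorff_outer_similarity_le:
  fixes s :: "'a::euclidean_space \<Rightarrow> 'a"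
  assumes s: "\<And>x y. dist (s x) (s y) = r * dist x y" and r: "0 < r" and d: "0 < d"
  shows "hausdorff_outer d (s ` A) \<le> ennreal (r powr d) * hausdorff_outer d A"
  unfolding hausdorff_outer_eq_SUP[of d "s ` A"]
proof (rule SUP_least)
  fix \<delta> :: real assume \<delta>: "\<delta> \<in> {0<..}"
  \<comment> \<open>The factor is divided out on the left so that the infimum over covers stands
    alone on the right.\<close>
  have "hausdorff_pre d \<delta> (s ` A) / ennreal (r powr d) \<le> hausdorff_pre d (\<delta> / r) A"
    unfolding hausdorff_pre_def[of d "\<delta> / r"]
  proof (rule INF_greatest)
    fix U assume U: "U \<in> hausdorff_covers (\<delta> / r) A"
    have bs: "bounded (s ` V)" if "bounded V" for V
    proof -
      from that obtain e where "\<forall>x\<in>V. \<forall>y\<in>V. dist x y \<le> e" by (auto simp: bounded_two_points)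
      then have "\<forall>x\<in>s ` V. \<forall>y\<in>s ` V. dist x y \<le> r * e" using s r by auto
      then show ?thesis unfolding bounded_two_points by blast
    qed
    have dU: "diameter (s ` U i) \<le> r * diameter (U i)" for i
      using U by (intro diameter_similarity_le s r) (auto simp: hausdorff_covers_def)
    have "(\<lambda>i. s ` U i) \<in> hausdorff_covers \<delta> (s ` A)"
      unfolding hausdorff_covers_def
    proof safe
      fix i
      have "r * diameter (U i) \<le> \<delta>" using U r by (auto simp: hausdorff_covers_def field_simps)
      then show "diameter (s ` U i) \<le> \<delta>" using dU[of i] by simp
    next
      fix x assume "x \<in> A"
      then obtain i where "x \<in> U i" using U by (auto simp: hausdorff_covers_def)
      then show "s x \<in> (\<Union>i. s ` U i)" by blast
    qed (use U bs in \<open>auto simp: hausdorff_covers_def\<close>)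
    then have "hausdorff_pre d \<delta> (s ` A) \<le> (\<Sum>i. ennreal (hausdorff_weight d (s ` U i)))"
      by (rule hausdorff_pre_le)
    also have "\<dots> \<le> (\<Sum>i. ennreal (r powr d) * ennreal (hausdorff_weight d (U i)))"
    proof (rule suminf_le)
      fix i
      have "diameter (s ` U i) powr d \<le> (r * diameter (U i)) powr d"
        using dU[of i] U bs d by (intro powr_mono2 diameter_ge_0) (auto simp: hausdorff_covers_def)
      also have "\<dots> = r powr d * diameter (U i) powr d"
        by (rule powr_mult)
      finally show "ennreal (hausdorff_weight d (s ` U i)) \<le> ennreal (r powr d) * ennreal (hausdorff_weight d (U i))"
        unfolding hausdorff_weight_eq[OF d] by (simp add: ennreal_mult[symmetric])
    qed auto
    also have "\<dots> = ennreal (r powr d) * (\<Sum>i. ennreal (hausdorff_weight d (U i)))" by simp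
    finally show "hausdorff_pre d \<delta> (s ` A) / ennreal (r powr d) \<le> (\<Sum>i. ennreal (hausdorff_weight d (U i)))"
      using r by (simp add: ennreal_divide_le_iff)
  qed
  also have "\<dots> \<le> hausdorff_outer d A" using \<delta> r by (intro hausdorff_pre_le_outer) auto
  finally show "hausdorff_pre d \<delta> (s ` A) \<le> ennreal (r powr d) * hausdorff_outer d A"
    using r by (simp add: ennreal_divide_le_iff)
qed

text \<open>Subtracting \<open>s 0\<close> and dividing by \<open>r\<close> leaves an isometry that
  fixes 0. Such a map is linear and orthogonal, hence onto in finite dimension.\<close>

lemma surj_similarity:
  fixes s :: "'a::euclidean_space \<Rightarrow> 'a"
  assumes s: "\<And>x y. dist (s x) (s y) = r * dist x y" and r: "0 < r"
  shows "surj s"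
proof -
  define f where "f x = (1 / r) *\<^sub>R (s x - s 0)" for x
  have "dist (f x) (f y) = dist x y" for x y
  proof -
    have "dist (f x) (f y) = (1 / r) * dist (s x) (s y)"
      using r by (simp add: f_def dist_norm flip: scaleR_diff_right)
    then show ?thesis using s r by simp
  qed
  then have "orthogonal_transformation f"
    unfolding orthogonal_transformation_isometry by (simp add: f_def)
  then have f: "surj f" by (rule orthogonal_transformation_surj)
  show ?thesis unfolding surj_def
  proof
    fix y
    obtain x where "(1 / r) *\<^sub>R (y - s 0) = f x" using f by (metis surjD)
    then have "y = s x" using r by (simp add: f_def)
    then show "\<exists>x. y = s x" ..
  qed
qed

lemma inj_similarity:
  fixes s :: "'a::euclidean_space \<Rightarrow> 'a"
  assumes "\<And>x y. dist (s x) (s y) = r * dist x y" "0 < r"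
  shows "inj s"
  by (rule injI) (metis assms dist_eq_0_iff less_irrefl mult_eq_0_iff)

text \<open>The reverse inequality is the same estimate for the inverse map, which by surjectivity
  of \<open>s\<close> is a similarity of ratio \<open>1 / r\<close> on the whole space.\<close>

lemma hausdorff_outer_similarity:
  fixes s :: "'a::euclidean_space \<Rightarrow> 'a"
  assumes s: "\<And>x y. dist (s x) (s y) = r * dist x y" and r: "0 < r" and d: "0 < d"
  shows "hausdorff_outer d (s ` A) = ennreal (r powr d) * hausdorff_outer d A"
proof (rule antisym)
  show "hausdorff_outer d (s ` A) \<le> ennreal (r powr d) * hausdorff_outer d A"
    by (rule hausdorff_outer_similarity_le[OF assms])
  note inj = inj_similarity[OF s r]
  have inv: "dist (inv_into UNIV s x) (inv_into UNIV s y) = (1 / r) * dist x y" for x y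
    using s[of "inv_into UNIV s x" "inv_into UNIV s y"] r surj_f_inv_f[OF surj_similarity[OF s r]] by simp
  have "hausdorff_outer d (inv_into UNIV s ` (s ` A)) \<le> ennreal ((1 / r) powr d) * hausdorff_outer d (s ` A)"
    using r d by (intro hausdorff_outer_similarity_le inv) auto
  then have "ennreal (r powr d) * hausdorff_outer d A
      \<le> ennreal (r powr d) * (ennreal ((1 / r) powr d) * hausdorff_outer d (s ` A))"
    using inj by (intro mult_left_mono) (simp_all add: image_image)
  also have "ennreal (r powr d) * (ennreal ((1 / r) powr d) * hausdorff_outer d (s ` A)) = hausdorff_outer d (s ` A)"
    using r by (simp add: mult.assoc[symmetric] ennreal_mult[symmetric] powr_mult[symmetric])
  finally show "ennreal (r powr d) * hausdorff_outer d A \<le> hausdorff_outer d (s ` A)" .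
qed

section \<open>The Hausdorff dimension as the critical exponent\<close>

lemma hausdorff_outer_0_eq_0:
  assumes "hausdorff_outer 0 A = 0"
  shows "A = {}"
proof -
  have "hausdorff_pre 0 1 A < 1" using hausdorff_pre_le_outer[of 1 0 A] assms by (simp add: order.strict_trans1)
  then obtain U where U: "U \<in> hausdorff_covers 1 A" "(\<Sum>i. ennreal (hausdorff_weight 0 (U i))) < 1"
    using hausdorff_pre_close by blast
  have "U i = {}" for i
  proof (rule ccontr)
    assume "U i \<noteq> {}"
    then have "1 \<le> (\<Sum>i\<in>{i}. ennreal (hausdorff_weight 0 (U i)))" by (simp add: hausdorff_weight_def)
    also have "\<dots> \<le> (\<Sum>i. ennreal (hausdorff_weight 0 (U i)))" by (intro sum_le_suminf) auto
    finally show False using U(2) by simp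
  qed
  then show ?thesis using U(1) by (auto simp: hausdorff_covers_def)
qed

text \<open>For sets of diameter at most \<delta>, the weight diam^e is at most \<delta>^(e - d)
  times diam^d, and \<delta>^(e - d) tends to 0 with \<delta>.\<close>

lemma hausdorff_outer_zero_above:
  assumes fin: "hausdorff_outer d A < top_class.top" and d: "0 < d" "d < e"
  shows "hausdorff_outer e A = 0"
proof -
  obtain K where K: "hausdorff_outer d A = ennreal K" "0 \<le> K"
    using fin by (cases "hausdorff_outer d A") auto
  have bound: "hausdorff_pre e \<delta> A \<le> ennreal (\<delta> powr (e - d) * K)" if \<delta>: "0 < \<delta>" for \<delta>
  proof (rule ennreal_le_epsilon)
    fix \<epsilon> :: real assume \<epsilon>: "0 < \<epsilon>"
    \<comment> \<open>Chosen so that \<open>\<eta>\<close> times \<delta>^(e - d) is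
      \<open>\<epsilon>\<close>.\<close>
    define \<eta> where "\<eta> = \<epsilon> / \<delta> powr (e - d)"
    have \<eta>: "0 < \<eta>" using \<epsilon> \<delta> by (simp add: \<eta>_def)
    have "hausdorff_pre d \<delta> A \<le> ennreal K" using hausdorff_pre_le_outer[OF \<delta>, of d A] K by simp
    also have "ennreal K < ennreal (K + \<eta>)" using \<eta> K by (simp add: ennreal_lessI)
    finally obtain U where U: "U \<in> hausdorff_covers \<delta> A"
        "(\<Sum>i. ennreal (hausdorff_weight d (U i))) < ennreal (K + \<eta>)"
      using hausdorff_pre_close by blast
    have "hausdorff_pre e \<delta> A \<le> (\<Sum>i. ennreal (hausdorff_weight e (U i)))" using U(1) by (rule hausdorff_pre_le)
    also have "\<dots> \<le> (\<Sum>i. ennreal (\<delta> powr (e - d)) * ennreal (hausdorff_weight d (U i)))"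
    proof (rule suminf_le)
      fix i
      have D: "0 \<le> diameter (U i)" "diameter (U i) \<le> \<delta>"
        using U(1) by (auto simp: hausdorff_covers_def intro: diameter_ge_0)
      have "diameter (U i) powr e = diameter (U i) powr (e - d) * diameter (U i) powr d"
        by (simp flip: powr_add)
      also have "\<dots> \<le> \<delta> powr (e - d) * diameter (U i) powr d"
        using D d by (intro mult_right_mono powr_mono2) auto
      finally show "ennreal (hausdorff_weight e (U i)) \<le> ennreal (\<delta> powr (e - d)) * ennreal (hausdorff_weight d (U i))"
        using d by (simp add: hausdorff_weight_eq ennreal_mult[symmetric])
    qed auto
    also have "\<dots> = ennreal (\<delta> powr (e - d)) * (\<Sum>i. ennreal (hausdorff_weight d (U i)))" by simp
    also have "\<dots> \<le> ennreal (\<delta> powr (e - d)) * ennreal (K + \<eta>)" using U(2) by (intro mult_left_mono) auto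
    also have "\<dots> = ennreal (\<delta> powr (e - d) * K) + ennreal \<epsilon>"
      using K \<eta> \<epsilon> \<delta> by (simp add: ennreal_mult[symmetric] \<eta>_def distrib_left flip: ennreal_plus)
    finally show "hausdorff_pre e \<delta> A \<le> ennreal (\<delta> powr (e - d) * K) + ennreal \<epsilon>" .
  qed
  have "hausdorff_pre e \<delta> A \<le> 0" if \<delta>: "0 < \<delta>" for \<delta>
  proof (rule ennreal_le_epsilon)
    fix \<epsilon> :: real assume \<epsilon>: "0 < \<epsilon>"
    \<comment> \<open>A scale at which \<open>bound\<close> gives at most \<open>\<epsilon>\<close>;
      \<open>K + 1\<close> avoids a division by zero. Passing from \<open>\<delta>\<close> to the
      smaller \<open>\<theta>\<close> can only enlarge the premeasure.\<close>
    define \<theta> where "\<theta> = min \<delta> ((\<epsilon> / (K + 1)) powr (1 / (e - d)))"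
    have \<theta>: "0 < \<theta>" "\<theta> \<le> \<delta>" using \<delta> \<epsilon> K by (auto simp: \<theta>_def)
    have "\<theta> powr (e - d) \<le> ((\<epsilon> / (K + 1)) powr (1 / (e - d))) powr (e - d)"
      using \<theta> d by (intro powr_mono2) (auto simp: \<theta>_def)
    also have "\<dots> = \<epsilon> / (K + 1)" using d \<epsilon> K by (simp add: powr_powr)
    finally have "\<theta> powr (e - d) * K \<le> \<epsilon> / (K + 1) * K" using K by (intro mult_right_mono)
    also have "\<dots> \<le> \<epsilon>" using \<epsilon> K by (simp add: field_simps)
    finally have "ennreal (\<theta> powr (e - d) * K) \<le> ennreal \<epsilon>" by (rule ennreal_leI)
    then show "hausdorff_pre e \<delta> A \<le> 0 + ennreal \<epsilon>"
      using hausdorff_pre_antimono[OF \<theta>(2), of e A] bound[OF \<theta>(1)] by simp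
  qed
  then have "hausdorff_outer e A \<le> 0" unfolding hausdorff_outer_eq_SUP by (intro SUP_least) auto
  then show ?thesis by simp
qed

text \<open>Above \<open>D\<close> the measure vanishes because it is finite at \<open>D\<close>; if
  it vanished at a smaller exponent, it would vanish at \<open>D\<close> as well.\<close>

lemma hausdorff_dim_eqI:
  assumes D: "0 < D" and pos: "0 < hausdorff_outer D A" and fin: "hausdorff_outer D A < top_class.top"
  shows "hausdorff_dim A = D"
proof -
  define S where "S = {e. 0 \<le> e \<and> hausdorff_outer e A = 0}"
  have mem: "e \<in> S" if "D < e" for e
    using hausdorff_outer_zero_above[OF fin D that] D that by (simp add: S_def)
  have lower: "D \<le> e" if "e \<in> S" for e
  proof (rule ccontr)
    assume "\<not> D \<le> e"
    then have "hausdorff_outer D A = 0"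
      using that hausdorff_outer_zero_above[of e A D] hausdorff_outer_0_eq_0[of A] hausdorff_outer_empty[of D]
      by (cases "e = 0") (simp_all add: S_def)
    with pos show False by simp
  qed
  have "Inf S \<le> D + \<epsilon>" if "0 < \<epsilon>" for \<epsilon>
    using mem[of "D + \<epsilon>"] bdd_belowI[of S D, OF lower] that by (simp add: cInf_lower)
  then have "Inf S \<le> D" by (rule field_le_epsilon)
  moreover have "D \<le> Inf S"
  proof (rule cInf_greatest)
    show "S \<noteq> {}" using mem[of "D + 1"] by force
  qed (rule lower)
  ultimately show ?thesis unfolding hausdorff_dim_def S_def[symmetric] by (rule antisym)
qed

section \<open>Self-similar sets under the open set condition\<close>

lemma sum_prod_list_words:
  fixes p :: "nat \<Rightarrow> 'b::comm_semiring_1"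
  assumes "finite S"
  shows "(\<Sum>w | set w \<subseteq> S \<and> length w = l. prod_list (map p w)) = (\<Sum>m\<in>S. p m) ^ l"
proof (induction l)
  case 0
  have "{w. set w \<subseteq> S \<and> length w = 0} = {[]}" by auto
  then show ?case by simp
next
  case (Suc l)
  let ?W = "\<lambda>l. {w. set w \<subseteq> S \<and> length w = l}"
  have eq: "?W (Suc l) = (\<lambda>(m, w). m # w) ` (S \<times> ?W l)"
    by (auto simp: image_iff length_Suc_conv)
  have "(\<Sum>w\<in>?W (Suc l). prod_list (map p w)) = (\<Sum>(m, w)\<in>S \<times> ?W l. p m * prod_list (map p w))"
    unfolding eq by (subst sum.reindex) (auto simp: inj_on_def split_beta)
  also have "\<dots> = (\<Sum>m\<in>S. p m) * (\<Sum>w\<in>?W l. prod_list (map p w))"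
    by (simp add: sum_product sum.cartesian_product)
  finally show ?case by (simp add: Suc.IH)
qed

lemma powr_prod_list: "prod_list xs powr a = prod_list (map (\<lambda>x. x powr a) xs)" for xs :: "real list"
  by (induction xs) (simp_all add: powr_mult)

text \<open>The point map behind \<open>ifs_piece\<close>, which is folded over sets. As a
  composition of similarities it is a similarity, so the scaling of the Hausdorff measure applies to
  pieces.\<close>

definition word_map :: "(nat \<Rightarrow> 'a \<Rightarrow> 'a) \<Rightarrow> nat list \<Rightarrow> 'a \<Rightarrow> 'a" where
  "word_map s w = foldr (\<lambda>m f. s m \<circ> f) w id"

lemma word_map_Nil [simp]: "word_map s [] = id"
  by (simp add: word_map_def)

lemma word_map_Cons [simp]: "word_map s (m # w) = s m \<circ> word_map s w"
  by (simp add: word_map_def)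

lemma word_map_append: "word_map s (u @ v) = word_map s u \<circ> word_map s v"
  by (induction u) auto

lemma ifs_piece_eq: "ifs_piece s \<Gamma> w = word_map s w ` \<Gamma>"
  by (induction w) (auto simp: ifs_piece_def image_comp)

locale ifs_system =
  fixes M :: nat and s :: "nat \<Rightarrow> 'a::euclidean_space \<Rightarrow> 'a" and \<rho> :: "nat \<Rightarrow> real" and \<Gamma> :: "'a set"
  assumes ifs: "ifs M s \<rho>" and attractor: "ifs_attractor M s \<Gamma>"
begin

definition ratio :: "nat list \<Rightarrow> real" where
  "ratio w = prod_list (map \<rho> w)"

abbreviation piece :: "nat list \<Rightarrow> 'a set" where
  "piece w \<equiv> ifs_piece s \<Gamma> w"

definition words :: "nat \<Rightarrow> nat list set" where
  "words l = {w. set w \<subseteq> {1..M} \<and> length w = l}"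

lemma M_ge: "2 \<le> M"
  using ifs by (simp add: ifs_def)

lemma rho: "m \<in> {1..M} \<Longrightarrow> 0 < \<rho> m \<and> \<rho> m < 1"
  using ifs by (simp add: ifs_def)

lemma dist_s: "m \<in> {1..M} \<Longrightarrow> dist (s m x) (s m y) = \<rho> m * dist x y"
  using ifs by (simp add: ifs_def dist_norm)

lemma attr_ne: "\<Gamma> \<noteq> {}" and compact_attr: "compact \<Gamma>" and attr_eq: "(\<Union>m\<in>{1..M}. s m ` \<Gamma>) = \<Gamma>"
  using attractor by (auto simp: ifs_attractor_def)

lemma ratio_Nil [simp]: "ratio [] = 1"
  and ratio_Cons [simp]: "ratio (m # w) = \<rho> m * ratio w"
  and ratio_append: "ratio (u @ v) = ratio u * ratio v"
  by (simp_all add: ratio_def)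

lemma ratio_bounds: "set w \<subseteq> {1..M} \<Longrightarrow> 0 < ratio w \<and> ratio w \<le> 1"
proof (induction w)
  case (Cons m w)
  then have "0 < \<rho> m" "\<rho> m < 1" "0 < ratio w" "ratio w \<le> 1" using rho[of m] by auto
  then show ?case by (simp add: mult_le_one)
qed simp

lemma dist_word_map:
  "set w \<subseteq> {1..M} \<Longrightarrow> dist (word_map s w x) (word_map s w y) = ratio w * dist x y"
  by (induction w) (auto simp: dist_s)

lemma inj_word_map: "set w \<subseteq> {1..M} \<Longrightarrow> inj (word_map s w)"
  using inj_similarity dist_word_map ratio_bounds by metis

section \<open>Words of a fixed length and their pieces\<close>

lemma finite_words: "finite (words l)"
  unfolding words_def by (rule finite_lists_length_eq) simp

lemma piece_append: "piece (u @ v) = word_map s u ` piece v"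
  by (simp add: ifs_piece_eq word_map_append image_comp)

lemma piece_subset_attr: "set w \<subseteq> {1..M} \<Longrightarrow> piece w \<subseteq> \<Gamma>"
proof (induction w)
  case (Cons m w)
  then have "s m ` piece w \<subseteq> s m ` \<Gamma>" "m \<in> {1..M}" by auto
  moreover from this(2) have "s m ` \<Gamma> \<subseteq> \<Gamma>" using attr_eq by blast
  ultimately show ?case by (auto simp: ifs_piece_def)
qed (simp add: ifs_piece_def)

lemma piece_mono:
  assumes "prefix u w" "set w \<subseteq> {1..M}"
  shows "piece w \<subseteq> piece u"
proof -
  obtain v where v: "w = u @ v" using assms by (auto simp: prefix_def)
  then have "piece v \<subseteq> \<Gamma>" using assms by (intro piece_subset_attr) auto
  then show ?thesis unfolding v piece_append by (auto simp: ifs_piece_eq)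
qed

lemma compact_word_map_image:
  assumes "set w \<subseteq> {1..M}" "compact A"
  shows "compact (word_map s w ` A)"
proof -
  have "continuous_on A (word_map s w)"
    by (rule lipschitz_on_continuous_on[of "ratio w"], rule lipschitz_onI)
       (use assms ratio_bounds in \<open>auto simp: dist_word_map less_imp_le\<close>)
  then show ?thesis using assms(2) by (rule compact_continuous_image)
qed

lemma compact_piece: "set w \<subseteq> {1..M} \<Longrightarrow> compact (piece w)"
  unfolding ifs_piece_eq by (rule compact_word_map_image[OF _ compact_attr])

lemma attr_eq_Union_words: "(\<Union>w\<in>words l. piece w) = \<Gamma>"
proof (induction l)
  case 0
  have "words 0 = {[]}" by (auto simp: words_def)
  then show ?case by (simp add: ifs_piece_def)
next
  case (Suc l)
  show ?case
  proof
    show "(\<Union>w\<in>words (Suc l). piece w) \<subseteq> \<Gamma>" using piece_subset_attr by (auto simp: words_def)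
    show "\<Gamma> \<subseteq> (\<Union>w\<in>words (Suc l). piece w)"
    proof
      fix x assume "x \<in> \<Gamma>"
      then obtain m y where m: "m \<in> {1..M}" "y \<in> \<Gamma>" "x = s m y" using attr_eq by blast
      then obtain w where w: "w \<in> words l" "y \<in> piece w" using Suc.IH by blast
      then have "m # w \<in> words (Suc l)" "x \<in> piece (m # w)"
        using m by (auto simp: words_def ifs_piece_def)
      then show "x \<in> (\<Union>w\<in>words (Suc l). piece w)" by blast
    qed
  qed
qed

lemma sum_ratio_words:
  assumes "(\<Sum>m\<in>{1..M}. \<rho> m powr D) = 1"
  shows "(\<Sum>w\<in>words l. ratio w powr D) = 1"
proof -
  have "(\<Sum>w\<in>words l. ratio w powr D) = (\<Sum>w\<in>words l. prod_list (map (\<lambda>m. \<rho> m powr D) w))"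
    unfolding ratio_def powr_prod_list by (simp add: comp_def)
  also have "\<dots> = 1" unfolding words_def using assms by (subst sum_prod_list_words) simp_all
  finally show ?thesis .
qed

text \<open>Intermediate value theorem for the sum as a function of the exponent: it equals
  \<open>M\<close> at 0, which exceeds 1, and is at most 1 at a large exponent because the largest
  ratio \<open>r\<close> is below 1.\<close>

lemma ex_moran_exponent: "\<exists>D>0. (\<Sum>m\<in>{1..M}. \<rho> m powr D) = 1"
proof -
  define f where "f D = (\<Sum>m\<in>{1..M}. \<rho> m powr D)" for D
  define r where "r = Max (\<rho> ` {1..M})"
  have ne: "{1..M} \<noteq> {}" using M_ge by auto
  then have "r \<in> \<rho> ` {1..M}" unfolding r_def by (intro Max_in) auto
  then have r: "0 < r" "r < 1" using rho by auto
  have f0: "f 0 = real M" unfolding f_def using rho by (subst sum.cong[OF refl, of _ _ "\<lambda>_. 1"]) fastforce+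
  obtain n where n: "r ^ n < 1 / real M" using real_arch_pow_inv[of "1 / real M" r] r M_ge by auto
  have "f (real n) \<le> (\<Sum>m\<in>{1..M}. r ^ n)"
    unfolding f_def
  proof (rule sum_mono)
    fix m assume m: "m \<in> {1..M}"
    then have "\<rho> m \<le> r" unfolding r_def by simp
    then show "\<rho> m powr real n \<le> r ^ n" using rho[OF m] by (simp add: powr_realpow power_mono)
  qed
  also have "\<dots> \<le> 1" using n M_ge by (simp add: field_simps)
  finally have fn: "f (real n) \<le> 1" .
  have "\<exists>D\<ge>0. D \<le> real n \<and> f D = 1"
  proof (rule IVT2')
    show "continuous_on {0..real n} f" unfolding f_def using rho
      by (intro continuous_intros) force
  qed (use fn f0 M_ge in auto)
  then obtain D where D: "0 \<le> D" "f D = 1" by blast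
  moreover have "D \<noteq> 0" using D f0 M_ge by auto
  ultimately show ?thesis unfolding f_def by (intro exI[of _ D]) auto
qed

lemma ex_long_words:
  assumes "0 < e"
  shows "\<exists>l. \<forall>w\<in>words l. ratio w \<le> e"
proof -
  define r where "r = Max (\<rho> ` {1..M})"
  have "{1..M} \<noteq> {}" using M_ge by auto
  then have "r \<in> \<rho> ` {1..M}" unfolding r_def by (intro Max_in) auto
  then have r: "0 < r" "r < 1" using rho by auto
  have "set w \<subseteq> {1..M} \<Longrightarrow> ratio w \<le> r ^ length w" for w
  proof (induction w)
    case (Cons m w)
    then have "\<rho> m \<le> r" "0 < \<rho> m" "0 < ratio w" using rho[of m] ratio_bounds[of w] by (auto simp: r_def)
    with Cons show ?case by (simp add: mult_mono)
  qed simp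
  moreover obtain l where "r ^ l < e" using real_arch_pow_inv[OF assms r(2)] by auto
  ultimately show ?thesis by (intro exI[of _ l]) (force simp: words_def)
qed

text \<open>The pieces of one level form a cover of total weight at most diam^D, because the D-th
  powers of the ratios of its words sum to 1. Long words make the cover as fine as desired.\<close>

lemma hausdorff_outer_attr_finite:
  assumes D: "0 < D" and sum1: "(\<Sum>m\<in>{1..M}. \<rho> m powr D) = 1"
  shows "hausdorff_outer D \<Gamma> < top_class.top"
proof -
  define K where "K = diameter \<Gamma>"
  have K: "0 \<le> K" unfolding K_def using compact_attr by (intro diameter_ge_0 compact_imp_bounded)
  have "hausdorff_pre D \<delta> \<Gamma> \<le> ennreal (K powr D)" if \<delta>: "0 < \<delta>" for \<delta>
  proof -
    \<comment> \<open>\<open>K + 1\<close> in place of \<open>K\<close> avoids a division by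
      zero.\<close>
    obtain l where l: "\<And>w. w \<in> words l \<Longrightarrow> ratio w \<le> \<delta> / (K + 1)" using ex_long_words[of "\<delta> / (K + 1)"] \<delta> K by auto
    obtain e where e: "bij_betw e {..<card (words l)} (words l)"
      using finite_words ex_bij_betw_nat_finite[of "words l"] by (auto simp: atLeast0LessThan)
    define U where "U i = (if i < card (words l) then piece (e i) else {})" for i
    have eW: "e i \<in> words l" if "i < card (words l)" for i using e that by (auto simp: bij_betw_def)
    have dU: "bounded (U i) \<and> diameter (U i) \<le> ratio (e i) * K" if "i < card (words l)" for i
    proof -
      have w: "set (e i) \<subseteq> {1..M}" using eW[OF that] by (simp add: words_def)
      then show ?thesis unfolding U_def K_def using that compact_attr ratio_bounds[OF w]
        by (auto simp: ifs_piece_eq intro!: diameter_similarity_le dist_word_map compact_imp_bounded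
            compact_piece[unfolded ifs_piece_eq])
    qed
    have "ratio (e i) * K \<le> \<delta>" if "i < card (words l)" for i
    proof -
      have "ratio (e i) * K \<le> \<delta> / (K + 1) * K" using l[OF eW[OF that]] K by (rule mult_right_mono)
      also have "\<dots> \<le> \<delta>" using \<delta> K by (simp add: field_simps)
      finally show ?thesis .
    qed
    then have dU': "bounded (U i) \<and> diameter (U i) \<le> \<delta>" for i
    proof (cases "i < card (words l)")
      case True
      with dU[OF this] \<open>\<And>i. i < card (words l) \<Longrightarrow> ratio (e i) * K \<le> \<delta>\<close>[OF this] show ?thesis by simp
    qed (use \<delta> in \<open>simp add: U_def diameter_def\<close>)
    have "\<Gamma> \<subseteq> (\<Union>i. U i)"
    proof
      fix x assume "x \<in> \<Gamma>"
      then obtain w where w: "w \<in> words l" "x \<in> piece w" using attr_eq_Union_words by blast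
      then obtain i where "i < card (words l)" "w = e i" using e by (auto simp: bij_betw_def)
      then have "x \<in> U i" using w by (simp add: U_def)
      then show "x \<in> (\<Union>i. U i)" by blast
    qed
    with dU' have "hausdorff_pre D \<delta> \<Gamma> \<le> (\<Sum>i. ennreal (hausdorff_weight D (U i)))"
      by (intro hausdorff_pre_le) (simp add: hausdorff_covers_def)
    also have "\<dots> = (\<Sum>i<card (words l). ennreal (hausdorff_weight D (U i)))"
      by (rule suminf_finite) (auto simp: U_def hausdorff_weight_def)
    also have "\<dots> \<le> (\<Sum>i<card (words l). ennreal (ratio (e i) powr D * K powr D))"
    proof (rule sum_mono)
      fix i assume i: "i \<in> {..<card (words l)}"
      then have "diameter (U i) powr D \<le> (ratio (e i) * K) powr D"
        using dU[of i] D by (intro powr_mono2 diameter_ge_0) auto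
      then show "ennreal (hausdorff_weight D (U i)) \<le> ennreal (ratio (e i) powr D * K powr D)"
        using D by (simp add: hausdorff_weight_eq powr_mult ennreal_leI)
    qed
    also have "\<dots> = ennreal ((\<Sum>i<card (words l). ratio (e i) powr D) * K powr D)"
      by (simp add: sum_distrib_right)
    also have "(\<Sum>i<card (words l). ratio (e i) powr D) = (\<Sum>w\<in>words l. ratio w powr D)"
      using e by (rule sum.reindex_bij_betw)
    finally show ?thesis using sum_ratio_words[OF sum1] by simp
  qed
  then have "hausdorff_outer D \<Gamma> \<le> ennreal (K powr D)"
    unfolding hausdorff_outer_eq_SUP by (intro SUP_least) auto
  then show ?thesis using ennreal_less_top order.strict_trans1 by blast
qed

text \<open>Words cut off where the ratio first falls to \<open>r\<close> or below. For
  \<open>r < 1\<close> their ratios are all comparable to \<open>r\<close>, unlike those of the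
  words of a fixed length, and a packing argument needs this.\<close>

definition stop_words :: "real \<Rightarrow> nat list set" where
  "stop_words r = {v. set v \<subseteq> {1..M} \<and> v \<noteq> [] \<and> ratio v \<le> r \<and> r < ratio (butlast v)}"

lemma ex_stop_prefix:
  assumes w: "set w \<subseteq> {1..M}" and r: "ratio w \<le> r" "r < 1"
  shows "\<exists>v\<in>stop_words r. prefix v w"
proof -
  define k where "k = (LEAST k. ratio (take k w) \<le> r)"
  have k: "ratio (take k w) \<le> r"
    unfolding k_def by (rule LeastI[of _ "length w"]) (use r in simp)
  \<comment> \<open>The empty word has ratio 1, which exceeds \<open>r\<close>.\<close>
  have k0: "k \<noteq> 0" using k r by (intro notI) simp
  have kl: "k \<le> length w" unfolding k_def by (rule Least_le) (use r in simp)
  have "r < ratio (take (k - 1) w)"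
    using not_less_Least[of "k - 1" "\<lambda>k. ratio (take k w) \<le> r"] k0 unfolding k_def[symmetric] by simp
  moreover have "butlast (take k w) = take (k - 1) w" using kl by (simp add: butlast_take)
  ultimately have "take k w \<in> stop_words r"
    using k k0 kl w set_take_subset[of k w] r by (auto simp: stop_words_def)
  then show ?thesis using take_is_prefix by blast
qed

text \<open>If \<open>v\<close> were a proper prefix of \<open>w\<close>, then
  \<open>butlast w\<close> would still extend \<open>v\<close> and have ratio at most
  \<open>r\<close>, against the stopping rule.\<close>

lemma stop_words_parallel:
  assumes v: "v \<in> stop_words r" and w: "w \<in> stop_words r" and "v \<noteq> w"
  shows "v \<parallel> w"
proof -
  have "\<not> prefix v w" if v: "v \<in> stop_words r" and w: "w \<in> stop_words r" and ne: "v \<noteq> w" for v w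
  proof
    assume "prefix v w"
    then obtain u where u: "w = v @ u" by (auto simp: prefix_def)
    with ne have "u \<noteq> []" by auto
    then have bl: "butlast w = v @ butlast u" using u by (simp add: butlast_append)
    have "set (butlast u) \<subseteq> {1..M}" using w u in_set_butlastD by (fastforce simp: stop_words_def)
    then have "ratio (butlast w) \<le> ratio v"
      using ratio_bounds[of "butlast u"] ratio_bounds[of v] v
      by (simp add: bl ratio_append stop_words_def mult_left_le)
    then show False using v w by (simp add: stop_words_def)
  qed
  with assms show ?thesis by blast
qed

text \<open>Before the last letter the ratio still exceeds \<open>r\<close>, and one letter
  multiplies it by no less than the smallest contraction factor.\<close>

lemma ratio_stop_words:
  assumes v: "v \<in> stop_words r"
  shows "r * Min (\<rho> ` {1..M}) \<le> ratio v"
proof -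
  from v have split: "v = butlast v @ [last v]" and S: "set v \<subseteq> {1..M}" "v \<noteq> []" by (simp_all add: stop_words_def)
  then have "last v \<in> {1..M}" by (meson last_in_set subsetD)
  then have "Min (\<rho> ` {1..M}) \<le> \<rho> (last v)" "0 < \<rho> (last v)" using rho by auto
  moreover have "0 < Min (\<rho> ` {1..M})" using rho M_ge by (subst Min_gr_iff) auto
  moreover have "r < ratio (butlast v)" using v by (simp add: stop_words_def)
  moreover have "0 \<le> ratio (butlast v)" using ratio_bounds[of "butlast v"] S in_set_butlastD by (metis less_imp_le subset_code(1))
  ultimately have "r * Min (\<rho> ` {1..M}) \<le> ratio (butlast v) * \<rho> (last v)"
    by (intro mult_mono) auto
  also have "\<dots> = ratio v" by (subst (3) split) (simp add: ratio_append)
  finally show ?thesis .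
qed

text \<open>Behind the common prefix the images lie in those of \<open>U\<close> under
  \<open>s b\<close> and \<open>s c\<close>, which are disjoint; the map of the prefix is injective
  and keeps them so.\<close>

lemma parallel_images_disjoint:
  assumes osc: "(\<Union>m\<in>{1..M}. s m ` U) \<subseteq> U"
      "\<And>m m'. m \<in> {1..M} \<Longrightarrow> m' \<in> {1..M} \<Longrightarrow> m \<noteq> m' \<Longrightarrow> s m ` U \<inter> s m' ` U = {}"
    and v: "set v \<subseteq> {1..M}" and w: "set w \<subseteq> {1..M}" and "v \<parallel> w"
  shows "word_map s v ` U \<inter> word_map s w ` U = {}"
proof -
  obtain u b bs c cs where uv: "b \<noteq> c" "v = u @ b # bs" "w = u @ c # cs"
    using parallel_decomp[OF \<open>v \<parallel> w\<close>] by blast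
  have sub: "word_map s x ` U \<subseteq> U" if "set x \<subseteq> {1..M}" for x
    using that
  proof (induction x)
    case (Cons m x)
    then have "word_map s x ` U \<subseteq> U" "m \<in> {1..M}" by auto
    moreover from this(2) have "s m ` U \<subseteq> U" using osc(1) by blast
    ultimately show ?case by auto
  qed simp
  have "word_map s bs ` U \<subseteq> U" "word_map s cs ` U \<subseteq> U" using v w uv by (intro sub; simp)+
  then have "word_map s (b # bs) ` U \<inter> word_map s (c # cs) ` U \<subseteq> s b ` U \<inter> s c ` U" by auto
  also have "\<dots> = {}" using v w uv by (intro osc(2)) auto
  finally have e: "word_map s (b # bs) ` U \<inter> word_map s (c # cs) ` U = {}" by blast
  have "inj (word_map s u)" using v uv by (intro inj_word_map) auto
  then have "word_map s v ` U \<inter> word_map s w ` U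
      = word_map s u ` (word_map s (b # bs) ` U \<inter> word_map s (c # cs) ` U)"
    unfolding uv word_map_append by (simp only: image_comp[symmetric] image_Int)
  then show ?thesis by (simp only: e image_empty)
qed

text \<open>The usual counting consequence of the open set condition, with \<open>q\<close> uniform
  in the scale. Finiteness is stated apart because \<open>card\<close> of an infinite set is
  0.\<close>

definition stop_bound :: "nat \<Rightarrow> bool" where
  "stop_bound q \<longleftrightarrow> (\<forall>r V. 0 < r \<and> r < 1 \<and> (\<forall>x\<in>V. \<forall>y\<in>V. dist x y \<le> r) \<longrightarrow>
     finite {v \<in> stop_words r. piece v \<inter> V \<noteq> {}} \<and>
     card {v \<in> stop_words r. piece v \<inter> V \<noteq> {}} \<le> q)"

text \<open>A packing of points in place of volumes. The images of one point \<open>x0\<close> of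
  the open set under distinct stopped words are at least \<open>r * \<epsilon>\<close> apart, since
  a ball around \<open>x0\<close> has disjoint images. Those that belong to pieces meeting
  \<open>V\<close> lie within r (L + 1) of a point of \<open>V\<close>. Rescaled by 1/r, they are
  \<open>\<epsilon>\<close>-separated in a fixed ball, which bounds their number.\<close>

lemma stop_words_card_bound:
  assumes osc: "open_set_condition M s"
  obtains q where "stop_bound q"
proof -
  from osc obtain U where "U \<noteq> {}" "open U" and sU: "(\<Union>m\<in>{1..M}. s m ` U) \<subseteq> U"
    and disj: "\<And>m m'. m \<in> {1..M} \<Longrightarrow> m' \<in> {1..M} \<Longrightarrow> m \<noteq> m' \<Longrightarrow> s m ` U \<inter> s m' ` U = {}"
    unfolding open_set_condition_def by metis
  then obtain x0 a where a: "0 < a" "ball x0 a \<subseteq> U" by (metis ex_in_conv open_contains_ball_eq)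
  obtain L where L: "\<And>x. x \<in> \<Gamma> \<Longrightarrow> dist x0 x \<le> L"
    using compact_imp_bounded[OF compact_attr] unfolding bounded_any_center[where a = x0] by blast
  \<comment> \<open>The image of the ball of radius \<open>a\<close> under a word stopped at scale
    \<open>r\<close> has radius at least \<open>r * \<epsilon>\<close>.\<close>
  define \<epsilon> where "\<epsilon> = Min (\<rho> ` {1..M}) * a"
  have \<epsilon>: "0 < \<epsilon>" using a rho M_ge unfolding \<epsilon>_def by (intro mult_pos_pos) (auto simp: Min_gr_iff)
  have "compact (cball (0::'a) (L + 1))" by simp
  \<comment> \<open>A net that depends neither on \<open>r\<close> nor on \<open>V\<close>; its
    cardinality serves as \<open>q\<close>.\<close>
  then obtain K where K: "finite K" "cball (0::'a) (L + 1) \<subseteq> (\<Union>k\<in>K. ball k (\<epsilon> / 2))"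
    unfolding compact_eq_totally_bounded using \<epsilon> by (meson half_gt_zero)
  show ?thesis
  proof (rule that, unfold stop_bound_def, intro allI impI, elim conjE)
    fix r :: real and V :: "'a set"
    assume r: "0 < r" "r < 1" and "\<forall>x\<in>V. \<forall>y\<in>V. dist x y \<le> r"
    then have V: "\<And>x y. x \<in> V \<Longrightarrow> y \<in> V \<Longrightarrow> dist x y \<le> r" by blast
    define Q where "Q = {v \<in> stop_words r. piece v \<inter> V \<noteq> {}}"
    define p where "p v = word_map s v x0" for v
    have sep: "r * \<epsilon> \<le> dist (p v) (p w)" if v: "v \<in> stop_words r" and w: "w \<in> stop_words r" and ne: "v \<noteq> w" for v w
    proof (rule ccontr)
      assume "\<not> r * \<epsilon> \<le> dist (p v) (p w)"
      moreover have "r * \<epsilon> \<le> ratio v * a"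
        using ratio_stop_words[OF v] a unfolding \<epsilon>_def by (simp add: mult.assoc[symmetric] mult_right_mono)
      ultimately have lt: "dist (p v) (p w) < ratio v * a" by linarith
      have S: "set v \<subseteq> {1..M}" "set w \<subseteq> {1..M}" using v w by (auto simp: stop_words_def)
      have rv: "0 < ratio v" using ratio_bounds[OF S(1)] by simp
      \<comment> \<open>The preimage of \<open>p w\<close> under the map of \<open>v\<close> falls
        into the ball around \<open>x0\<close>, so the images of \<open>U\<close> under both words
        contain \<open>p w\<close>.\<close>
      obtain z where z: "p w = word_map s v z"
        using surj_similarity[OF dist_word_map[OF S(1)] rv] by (metis surjD)
      have "ratio v * dist x0 z < ratio v * a"
        using lt dist_word_map[OF S(1), of x0 z] by (simp add: z[symmetric] p_def)
      then have "z \<in> U" using a rv by auto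
      then have "p w \<in> word_map s v ` U" using z by simp
      moreover have "p w \<in> word_map s w ` U" unfolding p_def using a by (intro imageI) auto
      ultimately show False
        using parallel_images_disjoint[OF sU disj S stop_words_parallel[OF v w ne]] by blast
    qed
    have "finite Q \<and> card Q \<le> card K"
    proof (cases "Q = {}")
      case False
      then obtain y where y: "y \<in> V" unfolding Q_def by blast
      have "\<exists>k\<in>K. (1 / r) *\<^sub>R (p v - y) \<in> ball k (\<epsilon> / 2)" if v: "v \<in> Q" for v
      proof -
        from v have vS: "set v \<subseteq> {1..M}" "ratio v \<le> r" by (auto simp: Q_def stop_words_def)
        from v obtain g where g: "g \<in> \<Gamma>" "word_map s v g \<in> V" by (auto simp: Q_def ifs_piece_eq)
        have "dist (p v) y \<le> dist (p v) (word_map s v g) + dist (word_map s v g) y" by (rule dist_triangle)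
        also have "\<dots> \<le> ratio v * dist x0 g + r"
          using V[OF g(2) y] by (simp add: p_def dist_word_map[OF vS(1)])
        also have "\<dots> \<le> r * L + r"
          using vS L[OF g(1)] r by (intro add_mono mult_mono) auto
        finally have "norm (p v - y) \<le> r * (L + 1)" by (simp add: dist_norm algebra_simps)
        then have "norm (p v - y) / r \<le> L + 1" using r by (simp add: pos_divide_le_eq mult.commute)
        then have "norm ((1 / r) *\<^sub>R (p v - y)) \<le> L + 1" using r by (simp only: norm_scaleR) simp
        then have "(1 / r) *\<^sub>R (p v - y) \<in> cball 0 (L + 1)" by (simp only: mem_cball_0)
        then show ?thesis using K(2) by blast
      qed
      then obtain k where k: "\<And>v. v \<in> Q \<Longrightarrow> k v \<in> K \<and> (1 / r) *\<^sub>R (p v - y) \<in> ball (k v) (\<epsilon> / 2)" by metis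
      \<comment> \<open>Two points in one ball of the net are less than \<open>\<epsilon>\<close>
        apart, so each ball serves only one word.\<close>
      have "inj_on k Q"
      proof (rule inj_onI, rule ccontr)
        fix v w assume vw: "v \<in> Q" "w \<in> Q" "k v = k w" "v \<noteq> w"
        have "dist ((1 / r) *\<^sub>R (p v - y)) ((1 / r) *\<^sub>R (p w - y)) < \<epsilon> / 2 + \<epsilon> / 2"
          using k[OF vw(1)] k[OF vw(2)] vw(3) by (intro dist_triangle_less_add[of _ "k v"]) (auto simp: dist_commute)
        moreover have "dist ((1 / r) *\<^sub>R (p v - y)) ((1 / r) *\<^sub>R (p w - y)) = (1 / r) * dist (p v) (p w)"
          using r by (simp add: dist_norm flip: scaleR_diff_right)
        ultimately have "dist (p v) (p w) / r < \<epsilon>" by simp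
        then have "dist (p v) (p w) < r * \<epsilon>" using r by (simp add: pos_divide_less_eq mult.commute)
        then show False using sep[of v w] vw by (simp add: Q_def)
      qed
      then show ?thesis using k K(1) by (meson card_inj_on_le image_subsetI inj_on_finite)
    qed simp
    then show "finite {v \<in> stop_words r. piece v \<inter> V \<noteq> {}} \<and>
       card {v \<in> stop_words r. piece v \<inter> V \<noteq> {}} \<le> card K" unfolding Q_def .
  qed
qed

text \<open>\<open>ratio w powr D\<close> is the mass that the natural self-similar measure gives to
  the word \<open>w\<close>. The extensions of \<open>v\<close> to length \<open>l\<close> share the
  mass of \<open>v\<close>; if \<open>l\<close> is too short there are none.\<close>

lemma sum_ratio_extensions_le:
  assumes sum1: "(\<Sum>m\<in>{1..M}. \<rho> m powr D) = 1" and v: "set v \<subseteq> {1..M}"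
  shows "(\<Sum>w | w \<in> words l \<and> prefix v w. ratio w powr D) \<le> ratio v powr D"
proof (cases "length v \<le> l")
  case True
  have eq: "{w \<in> words l. prefix v w} = (@) v ` words (l - length v)"
  proof
    show "{w \<in> words l. prefix v w} \<subseteq> (@) v ` words (l - length v)"
      by (auto simp: words_def prefix_def)
    show "(@) v ` words (l - length v) \<subseteq> {w \<in> words l. prefix v w}"
    proof
      fix w assume "w \<in> (@) v ` words (l - length v)"
      then obtain u where "w = v @ u" "set u \<subseteq> {1..M}" "length u = l - length v" unfolding words_def by blast
      then show "w \<in> {w \<in> words l. prefix v w}" using True v by (simp add: words_def)
    qed
  qed
  have "(\<Sum>w | w \<in> words l \<and> prefix v w. ratio w powr D) = (\<Sum>u\<in>words (l - length v). ratio v powr D * ratio u powr D)"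
    unfolding eq by (subst sum.reindex) (auto simp: inj_on_def ratio_append powr_mult)
  also have "\<dots> = ratio v powr D" using sum_ratio_words[OF sum1] by (simp flip: sum_distrib_left)
  finally show ?thesis by simp
next
  case False
  then have "{w \<in> words l. prefix v w} = {}" by (auto simp: words_def dest: prefix_length_le)
  then show ?thesis by (simp only: sum.empty) simp
qed

text \<open>A mass distribution principle on words, without a measure on \<open>\<Gamma>\<close>.
  The words of a long level carry total mass 1. Each extends a stopped word whose piece meets some
  \<open>V i\<close>, and the at most \<open>q\<close> stopped words at \<open>V i\<close> carry
  mass at most \<open>r i powr D\<close> each.\<close>

lemma cover_weight_ge:
  assumes sum1: "(\<Sum>m\<in>{1..M}. \<rho> m powr D) = 1" and D: "0 < D"
    and q: "stop_bound q"
    and F: "finite F" "\<And>i. i \<in> F \<Longrightarrow> 0 < r i \<and> r i < 1"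
    and V: "\<And>i x y. i \<in> F \<Longrightarrow> x \<in> V i \<Longrightarrow> y \<in> V i \<Longrightarrow> dist x y \<le> r i"
    and cover: "\<Gamma> \<subseteq> (\<Union>i\<in>F. V i)"
  shows "1 \<le> real q * (\<Sum>i\<in>F. r i powr D)"
proof -
  define Q where "Q i = {v \<in> stop_words (r i). piece v \<inter> V i \<noteq> {}}" for i
  have Q: "finite (Q i)" "card (Q i) \<le> q" if "i \<in> F" for i
    using q F(2)[OF that] V[OF that] unfolding Q_def stop_bound_def by simp_all
  have "F \<noteq> {}" using cover attr_ne by auto
  then have "0 < Min (r ` F)" using F by (subst Min_gr_iff) auto
  \<comment> \<open>Long enough for every word of length \<open>l\<close> to have passed the
    stopping ratio of each \<open>V i\<close>.\<close>
  then obtain l where "\<And>w. w \<in> words l \<Longrightarrow> ratio w \<le> Min (r ` F)" using ex_long_words by blast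
  then have l: "ratio w \<le> r i" if "w \<in> words l" "i \<in> F" for w i
    using that F(1) by (meson Min_le finite_imageI image_eqI order_trans)
  have in_some: "\<exists>i\<in>F. \<exists>v\<in>Q i. prefix v w" if w: "w \<in> words l" for w
  proof -
    have wS: "set w \<subseteq> {1..M}" using w by (simp add: words_def)
    obtain x where x: "x \<in> piece w" using attr_ne by (auto simp: ifs_piece_eq)
    then obtain i where i: "i \<in> F" "x \<in> V i" using piece_subset_attr[OF wS] cover by blast
    obtain v where v: "v \<in> stop_words (r i)" "prefix v w"
      using ex_stop_prefix[OF wS l[OF w i(1)]] F(2)[OF i(1)] by blast
    have "x \<in> piece v" using x piece_mono[OF v(2) wS] by blast
    then have "v \<in> Q i" using v i by (auto simp: Q_def)
    with i v show ?thesis by blast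
  qed
  have "1 = (\<Sum>w\<in>words l. ratio w powr D)" using sum_ratio_words[OF sum1] by simp
  also have "\<dots> \<le> (\<Sum>w\<in>words l. \<Sum>i\<in>F. \<Sum>v\<in>Q i. if prefix v w then ratio w powr D else 0)"
  proof (rule sum_mono)
    fix w assume "w \<in> words l"
    then obtain i v where iv: "i \<in> F" "v \<in> Q i" "prefix v w" using in_some by blast
    have "ratio w powr D = (if prefix v w then ratio w powr D else 0)" using iv by simp
    also have "\<dots> \<le> (\<Sum>v\<in>Q i. if prefix v w then ratio w powr D else 0)"
      using iv Q by (intro member_le_sum) auto
    also have "\<dots> \<le> (\<Sum>i\<in>F. \<Sum>v\<in>Q i. if prefix v w then ratio w powr D else 0)"
      using iv F(1) by (intro member_le_sum[of i F "\<lambda>i. \<Sum>v\<in>Q i. if prefix v w then ratio w powr D else 0"])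
        (auto intro!: sum_nonneg)
    finally show "ratio w powr D \<le> (\<Sum>i\<in>F. \<Sum>v\<in>Q i. if prefix v w then ratio w powr D else 0)" .
  qed
  \<comment> \<open>The sums are exchanged until the innermost one is the mass of all extensions of
    a single stopped word.\<close>
  also have "\<dots> = (\<Sum>i\<in>F. \<Sum>w\<in>words l. \<Sum>v\<in>Q i. if prefix v w then ratio w powr D else 0)"
    by (rule sum.swap)
  also have "\<dots> = (\<Sum>i\<in>F. \<Sum>v\<in>Q i. \<Sum>w\<in>words l. if prefix v w then ratio w powr D else 0)"
    by (intro sum.cong refl sum.swap)
  also have "\<dots> \<le> (\<Sum>i\<in>F. real q * r i powr D)"
  proof (rule sum_mono)
    fix i assume i: "i \<in> F"
    have "(\<Sum>w\<in>words l. if prefix v w then ratio w powr D else 0) \<le> r i powr D" if "v \<in> Q i" for v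
    proof -
      have v: "set v \<subseteq> {1..M}" "ratio v \<le> r i" using that by (auto simp: Q_def stop_words_def)
      have "(\<Sum>w\<in>words l. if prefix v w then ratio w powr D else 0) = (\<Sum>w | w \<in> words l \<and> prefix v w. ratio w powr D)"
        using finite_words by (intro sum.mono_neutral_cong_right) auto
      also have "\<dots> \<le> ratio v powr D" by (rule sum_ratio_extensions_le[OF sum1 v(1)])
      also have "\<dots> \<le> r i powr D" using v D ratio_bounds[OF v(1)] by (intro powr_mono2) auto
      finally show ?thesis .
    qed
    then have "(\<Sum>v\<in>Q i. \<Sum>w\<in>words l. if prefix v w then ratio w powr D else 0) \<le> real (card (Q i)) * r i powr D"
      by (rule sum_bounded_above)
    also have "\<dots> \<le> real q * r i powr D" using Q(2)[OF i] by (intro mult_right_mono) auto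
    finally show "(\<Sum>v\<in>Q i. \<Sum>w\<in>words l. if prefix v w then ratio w powr D else 0) \<le> real q * r i powr D" .
  qed
  finally show ?thesis by (simp add: sum_distrib_left)
qed

text \<open>Right continuity of the power function at \<open>c\<close>, also for
  \<open>c = 0\<close>. It prices the enlargement of a covering set to an open one.\<close>

lemma ex_enlarged_diameter:
  fixes c :: real
  assumes "0 \<le> c" "0 < D" "0 < e"
  shows "\<exists>\<eta>>0. \<eta> < 1 / 4 \<and> (c + 2 * \<eta>) powr D < c powr D + e"
proof -
  have "((\<lambda>\<eta>. (c + 2 * \<eta>) powr D) \<longlongrightarrow> (c + 2 * 0) powr D) (at_right 0)"
    using assms by (intro tendsto_powr' tendsto_intros) (auto simp: eventually_at_right_less intro!: eventually_at_rightI[of 0 1])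
  then have "eventually (\<lambda>\<eta>. (c + 2 * \<eta>) powr D < c powr D + e) (at_right 0)"
    using assms by (intro order_tendstoD(2)[of _ "c powr D"]) auto
  moreover have "eventually (\<lambda>\<eta>. \<eta> \<in> {0<..<1/4}) (at_right (0::real))"
    by (rule eventually_at_right_real) simp
  ultimately have "eventually (\<lambda>\<eta>. (c + 2 * \<eta>) powr D < c powr D + e \<and> \<eta> \<in> {0<..<1/4}) (at_right 0)"
    by (rule eventually_conj)
  then show ?thesis using eventually_happens'[of "at_right (0::real)"] by (auto simp: trivial_limit_at_right_real)
qed

text \<open>Measure zero would give covers of tiny total weight. Enlarged to open sets, such a cover
  has a finite subcover by compactness, which contradicts \<open>cover_weight_ge\<close>. Diameters
  of at most 1/4 and enlargements below 1/4 keep every \<open>r i\<close> below 1.\<close>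

lemma hausdorff_outer_attr_pos:
  assumes osc: "open_set_condition M s" and D: "0 < D" and sum1: "(\<Sum>m\<in>{1..M}. \<rho> m powr D) = 1"
  shows "0 < hausdorff_outer D \<Gamma>"
proof (rule ccontr)
  assume "\<not> 0 < hausdorff_outer D \<Gamma>"
  then have "hausdorff_pre D (1/4) \<Gamma> \<le> 0" using hausdorff_pre_le_outer[of "1/4" D \<Gamma>] by simp
  obtain q where q: "stop_bound q" using stop_words_card_bound[OF osc] .
  \<comment> \<open>The cover and its enlargement cost at most \<open>e\<close> each, and
    \<open>q * (2 * e)\<close> is below 1.\<close>
  define e where "e = 1 / (2 * (real q + 1))"
  have e: "0 < e" by (simp add: e_def)
  have "hausdorff_pre D (1/4) \<Gamma> < ennreal e" using \<open>hausdorff_pre D (1/4) \<Gamma> \<le> 0\<close> e by (simp add: order.strict_trans1)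
  then obtain U where U: "U \<in> hausdorff_covers (1/4) \<Gamma>" "(\<Sum>i. ennreal (hausdorff_weight D (U i))) < ennreal e"
    using hausdorff_pre_close by blast
  have dU: "0 \<le> diameter (U i)" "diameter (U i) \<le> 1/4" "bounded (U i)" for i
    using U(1) by (auto simp: hausdorff_covers_def intro: diameter_ge_0)
  have "\<exists>\<eta>>0. \<eta> < 1 / 4 \<and> (diameter (U i) + 2 * \<eta>) powr D < diameter (U i) powr D + e * (1/2)^Suc i" for i
    using dU e D by (intro ex_enlarged_diameter) auto
  then obtain \<eta> where \<eta>: "\<And>i. 0 < \<eta> i" "\<And>i. \<eta> i < 1 / 4"
      "\<And>i. (diameter (U i) + 2 * \<eta> i) powr D < diameter (U i) powr D + e * (1/2)^Suc i" by metis
  define V where "V i = (\<Union>x\<in>U i. ball x (\<eta> i))" for i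
  define r where "r i = diameter (U i) + 2 * \<eta> i" for i
  have r: "0 < r i \<and> r i < 1" for i using dU[of i] \<eta>(1,2)[of i] by (simp add: r_def)
  have V: "dist x y \<le> r i" if xy: "x \<in> V i" "y \<in> V i" for i x y
  proof -
    obtain u v where uv: "u \<in> U i" "v \<in> U i" "dist u x < \<eta> i" "dist v y < \<eta> i" using xy by (auto simp: V_def)
    have "dist x y \<le> dist u x + dist u v + dist v y"
      using dist_triangle[of x y u] dist_triangle[of u y v] by (simp add: dist_commute)
    then show ?thesis using uv diameter_bounded_bound[OF dU(3) uv(1,2)] by (simp add: r_def)
  qed
  have "\<Gamma> \<subseteq> (\<Union>i. V i)"
  proof
    fix x assume "x \<in> \<Gamma>"
    then obtain i where "x \<in> U i" using U(1) by (auto simp: hausdorff_covers_def)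
    then have "x \<in> V i" using \<eta>(1)[of i] unfolding V_def by (intro UN_I[of x]) auto
    then show "x \<in> (\<Union>i. V i)" by blast
  qed
  moreover have "open (V i)" for i unfolding V_def by auto
  ultimately obtain F where F: "finite F" "\<Gamma> \<subseteq> (\<Union>i\<in>F. V i)"
    using compactE_image[OF compact_attr, of UNIV V] by auto
  have "1 \<le> real q * (\<Sum>i\<in>F. r i powr D)"
    by (rule cover_weight_ge[OF sum1 D q F(1) r V F(2)])
  also have "\<dots> \<le> real q * (2 * e)"
  proof (rule mult_left_mono)
    have "ennreal (\<Sum>i\<in>F. diameter (U i) powr D) = (\<Sum>i\<in>F. ennreal (hausdorff_weight D (U i)))"
      using D by (simp add: hausdorff_weight_eq)
    also have "\<dots> \<le> (\<Sum>i. ennreal (hausdorff_weight D (U i)))" using F(1) by (intro sum_le_suminf) auto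
    finally have "ennreal (\<Sum>i\<in>F. diameter (U i) powr D) \<le> ennreal e" using U(2) by simp
    then have 1: "(\<Sum>i\<in>F. diameter (U i) powr D) \<le> e" using e by (simp add: ennreal_le_iff)
    have sm: "summable (\<lambda>i. (1/2::real) ^ Suc i)" using power_half_series by (rule sums_summable)
    have "(\<Sum>i\<in>F. (1/2::real) ^ Suc i) \<le> (\<Sum>i. (1/2) ^ Suc i)" by (rule sum_le_suminf[OF sm F(1)]) simp
    also have "\<dots> = 1" using power_half_series by (rule sums_unique[symmetric])
    finally have "e * (\<Sum>i\<in>F. (1/2) ^ Suc i) \<le> e" using e by (intro mult_left_le) auto
    then have 2: "(\<Sum>i\<in>F. e * (1/2) ^ Suc i) \<le> e" by (simp only: sum_distrib_left)
    have "(\<Sum>i\<in>F. r i powr D) \<le> (\<Sum>i\<in>F. diameter (U i) powr D + e * (1/2) ^ Suc i)"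
      unfolding r_def using \<eta>(3) by (intro sum_mono less_imp_le)
    then show "(\<Sum>i\<in>F. r i powr D) \<le> 2 * e" using 1 2 by (simp add: sum.distrib)
  qed simp
  also have "\<dots> < 1" by (simp add: e_def field_simps)
  finally show False by simp
qed

text \<open>The root \<open>D\<close> of Moran's equation has positive finite measure, so it is the
  critical exponent and thus equal to \<open>d\<close>, which is given only as an infimum.\<close>

lemma moran_dimension:
  assumes osc: "open_set_condition M s" and d: "d = hausdorff_dim \<Gamma>"
  shows "0 < d" "(\<Sum>m\<in>{1..M}. \<rho> m powr d) = 1" "0 < hausdorff_outer d \<Gamma>" "hausdorff_outer d \<Gamma> < top_class.top"
proof -
  obtain D where D: "0 < D" "(\<Sum>m\<in>{1..M}. \<rho> m powr D) = 1" using ex_moran_exponent by blast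
  note pos = hausdorff_outer_attr_pos[OF osc D] and fin = hausdorff_outer_attr_finite[OF D]
  have "d = D" unfolding d by (rule hausdorff_dim_eqI[OF D(1) pos fin])
  with D pos fin show "0 < d" "(\<Sum>m\<in>{1..M}. \<rho> m powr d) = 1"
    "0 < hausdorff_outer d \<Gamma>" "hausdorff_outer d \<Gamma> < top_class.top" by simp_all
qed

section \<open>Null overlaps between pieces\<close>

lemma emeasure_word_map_image:
  assumes "0 < d" "set w \<subseteq> {1..M}" "compact A"
  shows "emeasure (hausdorff_measure d) (word_map s w ` A) = ennreal (ratio w powr d) * emeasure (hausdorff_measure d) A"
  using assms compact_word_map_image[OF assms(2,3)] ratio_bounds[OF assms(2)]
  by (simp add: emeasure_hausdorff_measure borel_compact hausdorff_outer_similarity[OF dist_word_map])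

text \<open>The pieces of the first level have total measure equal to that of their union \<open>\<Gamma>\<close>, which
  leaves no room for overlaps.\<close>

lemma first_level_overlap_null:
  assumes d: "0 < d" and sum1: "(\<Sum>m\<in>{1..M}. \<rho> m powr d) = 1"
    and fin: "hausdorff_outer d \<Gamma> < top_class.top" and m: "m \<in> {1..M}" "m' \<in> {1..M}" "m \<noteq> m'"
  shows "emeasure (hausdorff_measure d) (s m ` \<Gamma> \<inter> s m' ` \<Gamma>) = 0"
proof -
  let ?e = "emeasure (hausdorff_measure d :: 'a measure)"
  define A where "A j = s j ` \<Gamma>" for j
  have cA: "compact (A j)" if "j \<in> {1..M}" for j
    using compact_piece[of "[j]"] that by (simp add: ifs_piece_eq A_def)
  have [measurable]: "A j \<in> sets (hausdorff_measure d)" if "j \<in> {1..M}" for j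
    using cA[OF that] by (simp add: sets_hausdorff_measure borel_compact)
  have eA: "?e (A j) = ennreal (\<rho> j powr d) * ?e \<Gamma>" if "j \<in> {1..M}" for j
    using emeasure_word_map_image[OF d, of "[j]" \<Gamma>] that compact_attr by (simp add: A_def)
  have e\<Gamma>: "?e \<Gamma> = hausdorff_outer d \<Gamma>" using compact_attr d by (simp add: emeasure_hausdorff_measure borel_compact)
  define R where "R = {1..M} - {m, m'}"
  have split: "{1..M} = insert m (insert m' R)" using m by (auto simp: R_def)
  have fR: "finite R" "m \<notin> R" "m' \<notin> R" by (auto simp: R_def)
  have sumA: "(\<Sum>j\<in>{1..M}. ?e (A j)) = ?e \<Gamma>"
  proof -
    have "(\<Sum>j\<in>{1..M}. ?e (A j)) = (\<Sum>j\<in>{1..M}. ennreal (\<rho> j powr d)) * ?e \<Gamma>"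
      unfolding sum_distrib_right using eA by (intro sum.cong) auto
    also have "(\<Sum>j\<in>{1..M}. ennreal (\<rho> j powr d)) = 1"
      using sum1 by (subst sum_ennreal) auto
    finally show ?thesis by simp
  qed
  have "?e \<Gamma> = ?e ((A m \<union> A m') \<union> (\<Union>j\<in>R. A j))"
    using attr_eq unfolding split A_def by (simp add: Un_assoc)
  also have "\<dots> \<le> ?e (A m \<union> A m') + ?e (\<Union>j\<in>R. A j)"
    using m fR by (intro emeasure_subadditive sets.Un sets.finite_UN) (auto simp: R_def)
  also have "\<dots> \<le> ?e (A m \<union> A m') + (\<Sum>j\<in>R. ?e (A j))"
    using fR by (intro add_left_mono emeasure_subadditive_finite) (auto simp: R_def)
  \<comment> \<open>The overlap is added to both sides, so that inclusion-exclusion needs no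
    subtraction of extended reals. The cancellation at the end uses that \<open>\<Gamma>\<close> has
    finite measure.\<close>
  finally have "?e \<Gamma> + ?e (A m \<inter> A m') \<le> (?e (A m \<union> A m') + ?e (A m \<inter> A m')) + (\<Sum>j\<in>R. ?e (A j))"
    by (simp add: add_right_mono ac_simps)
  also have "?e (A m \<union> A m') + ?e (A m \<inter> A m') = ?e (A m) + ?e (A m')"
    using m by (intro emeasure_Un_Int[symmetric]) auto
  also have "?e (A m) + ?e (A m') + (\<Sum>j\<in>R. ?e (A j)) = ?e \<Gamma>"
    using sumA m fR unfolding split by (simp add: add.assoc)
  finally have "?e \<Gamma> + ?e (A m \<inter> A m') \<le> ?e \<Gamma> + 0" by simp
  then have "?e (A m \<inter> A m') \<le> 0"
    using fin unfolding e\<Gamma> by (subst (asm) ennreal_add_left_cancel_le) auto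
  then show ?thesis by (simp add: A_def)
qed

text \<open>The overlap sits in the image, under the map of the common prefix, of the overlap of two
  different first-level pieces; similarities preserve null sets.\<close>

lemma parallel_overlap_null:
  assumes d: "0 < d" and sum1: "(\<Sum>m\<in>{1..M}. \<rho> m powr d) = 1"
    and fin: "hausdorff_outer d \<Gamma> < top_class.top"
    and v: "set v \<subseteq> {1..M}" and w: "set w \<subseteq> {1..M}" and "v \<parallel> w"
  shows "emeasure (hausdorff_measure d) (piece v \<inter> piece w) = 0"
proof -
  obtain u b bs c cs where uv: "b \<noteq> c" "v = u @ b # bs" "w = u @ c # cs"
    using parallel_decomp[OF \<open>v \<parallel> w\<close>] by blast
  have bc: "b \<in> {1..M}" "c \<in> {1..M}" "set u \<subseteq> {1..M}" using v w uv by auto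
  define B where "B = s b ` \<Gamma> \<inter> s c ` \<Gamma>"
  have cB: "compact B"
    using compact_piece[of "[b]"] compact_piece[of "[c]"] bc by (auto simp: B_def ifs_piece_eq)
  have "prefix (u @ [b]) v" "prefix (u @ [c]) w" using uv by auto
  then have "piece v \<inter> piece w \<subseteq> piece (u @ [b]) \<inter> piece (u @ [c])"
    using piece_mono v w by blast
  also have "\<dots> = word_map s u ` B"
    unfolding piece_append B_def using inj_word_map[OF bc(3)] by (simp add: image_Int ifs_piece_eq)
  finally have sub: "piece v \<inter> piece w \<subseteq> word_map s u ` B" .
  have "emeasure (hausdorff_measure d) (word_map s u ` B) = 0"
    unfolding emeasure_word_map_image[OF d bc(3) cB]
    using first_level_overlap_null[OF d sum1 fin bc(1,2) uv(1)] by (simp add: B_def)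
  moreover have "word_map s u ` B \<in> sets (hausdorff_measure d)"
    using compact_word_map_image[OF bc(3) cB] by (simp add: sets_hausdorff_measure borel_compact)
  ultimately show ?thesis using sub by (metis emeasure_mono le_zero_eq)
qed

section \<open>Index words of the approximation spaces\<close>

lemma L_index_words: "w \<in> L_index M s \<Gamma> h \<Longrightarrow> set w \<subseteq> {1..M}"
  by (auto simp: L_index_def split: if_splits)

text \<open>As for stopped words, with diameters in place of ratios: if \<open>v\<close> is a proper
  prefix of \<open>w\<close>, its piece contains that of \<open>butlast w\<close>, whose diameter
  exceeds \<open>h\<close>. If \<open>h\<close> is the diameter of \<open>\<Gamma>\<close>, only the
  empty word occurs.\<close>

lemma L_index_parallel:
  assumes "v \<in> L_index M s \<Gamma> h" "w \<in> L_index M s \<Gamma> h" "v \<noteq> w"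
  shows "v \<parallel> w"
proof -
  have "\<not> prefix v w" if v: "v \<in> L_index M s \<Gamma> h" and w: "w \<in> L_index M s \<Gamma> h" and ne: "v \<noteq> w" for v w
  proof
    assume "prefix v w"
    then obtain u where u: "w = v @ u" by (auto simp: prefix_def)
    have h: "h \<noteq> diameter \<Gamma>" using v w ne by (auto simp: L_index_def)
    have "u \<noteq> []" using u ne by auto
    then have "prefix v (butlast w)" using u by (simp add: butlast_append)
    moreover have wS: "set (butlast w) \<subseteq> {1..M}" using L_index_words[OF w] in_set_butlastD by fast
    ultimately have "piece (butlast w) \<subseteq> piece v" by (rule piece_mono)
    then have "diameter (piece (butlast w)) \<le> diameter (piece v)"
      using compact_piece[OF L_index_words[OF v]] by (intro diameter_subset compact_imp_bounded)
    then show False using v w h by (simp add: L_index_def)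
  qed
  with assms show ?thesis by blast
qed

end

locale osc_system = ifs_system M s \<rho> \<Gamma> for M and s :: "nat \<Rightarrow> 'a::euclidean_space \<Rightarrow> 'a" and \<rho> \<Gamma> +
  fixes d :: real and \<mu> :: "'a measure"
  assumes osc: "open_set_condition M s" and dim: "d = hausdorff_dim \<Gamma>"
  defines "\<mu> \<equiv> hausdorff_on d \<Gamma>"
begin

lemmas d_pos = moran_dimension(1)[OF osc dim]
  and moran_eq = moran_dimension(2)[OF osc dim]
  and outer_pos = moran_dimension(3)[OF osc dim]
  and outer_finite = moran_dimension(4)[OF osc dim]

lemma space_mu: "space \<mu> = \<Gamma>"
  by (simp add: \<mu>_def hausdorff_on_def space_restrict_space space_hausdorff_measure)

lemma attr_sets: "\<Gamma> \<in> sets (hausdorff_measure d)"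
  using compact_attr by (simp add: sets_hausdorff_measure borel_compact)

lemma sets_mu: "A \<in> sets \<mu> \<longleftrightarrow> A \<subseteq> \<Gamma> \<and> A \<in> sets borel"
  using sets_restrict_space_iff[of \<Gamma> "hausdorff_measure d" A] attr_sets
  by (auto simp: \<mu>_def hausdorff_on_def space_hausdorff_measure sets_hausdorff_measure)

lemma emeasure_mu:
  assumes "A \<subseteq> \<Gamma>"
  shows "emeasure \<mu> A = emeasure (hausdorff_measure d) A"
  unfolding \<mu>_def hausdorff_on_def
  using assms attr_sets by (intro emeasure_restrict_space) (simp_all add: space_hausdorff_measure)

lemma finite_measure_mu: "finite_measure \<mu>"
proof
  show "emeasure \<mu> (space \<mu>) \<noteq> \<infinity>"
    using outer_finite compact_attr d_pos
    by (simp add: space_mu emeasure_mu emeasure_hausdorff_measure borel_compact less_top[symmetric])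
qed

lemma measurable_mu: "f \<in> borel_measurable borel \<Longrightarrow> f \<in> borel_measurable \<mu>"
  unfolding \<mu>_def hausdorff_on_def
  by (rule measurable_restrict_space1) (simp cong: measurable_cong_sets add: sets_hausdorff_measure)

lemma piece_mu:
  assumes "set w \<subseteq> {1..M}"
  shows "piece w \<in> sets \<mu>" "emeasure (hausdorff_measure d) (piece w) = emeasure \<mu> (piece w)"
  using piece_subset_attr[OF assms] compact_piece[OF assms]
  by (simp_all add: sets_mu borel_compact emeasure_mu)

text \<open>The normalisation of \<open>chi\<close> rests on this: \<open>0 powr (-1/2)\<close> is
  0, so a null piece would give the zero function.\<close>

lemma measure_piece_pos:
  assumes "set w \<subseteq> {1..M}"
  shows "0 < measure \<mu> (piece w)"
proof -
  interpret finite_measure \<mu> by (rule finite_measure_mu)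
  have "emeasure \<mu> (piece w) = ennreal (ratio w powr d) * hausdorff_outer d \<Gamma>"
    unfolding piece_mu(2)[OF assms, symmetric] unfolding ifs_piece_eq
    using emeasure_word_map_image[OF d_pos assms compact_attr] compact_attr d_pos
    by (simp add: emeasure_hausdorff_measure borel_compact)
  then have "emeasure \<mu> (piece w) \<noteq> 0"
    using outer_pos ratio_bounds[OF assms] by auto
  then show ?thesis by (simp add: emeasure_eq_measure zero_less_measure_iff)
qed

lemma chi_eq:
  assumes "set w \<subseteq> {1..M}"
  shows "chi d s \<Gamma> w x = complex_of_real (measure \<mu> (piece w) powr (-1/2)) * indicator (piece w) x"
  using piece_mu(2)[OF assms] by (simp add: chi_def measure_def indicator_def)

lemma chi_L2:
  assumes "set w \<subseteq> {1..M}"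
  shows "chi d s \<Gamma> w \<in> L2 \<mu>"
proof -
  interpret finite_measure \<mu> by (rule finite_measure_mu)
  note [measurable] = piece_mu(1)[OF assms]
  have "indicator (piece w) \<in> L2 \<mu>" unfolding L2_def
  proof (intro CollectI conjI)
    have "(\<lambda>x. (cmod (indicator (piece w) x))\<^sup>2) = indicator (piece w)"
      by (auto simp: indicator_def)
    then show "integrable \<mu> (\<lambda>x. (cmod (indicator (piece w) x))\<^sup>2)"
      by (simp add: integrable_indicator_iff emeasure_eq_measure)
  qed measurable
  from L2_cmult[OF this] show ?thesis
    unfolding chi_eq[OF assms, abs_def] .
qed

lemma chi_orthonormal:
  assumes v: "v \<in> L_index M s \<Gamma> h" and w: "w \<in> L_index M s \<Gamma> h"
  shows "L2_inner \<mu> (chi d s \<Gamma> v) (chi d s \<Gamma> w) = (if v = w then 1 else 0)"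
proof -
  interpret finite_measure \<mu> by (rule finite_measure_mu)
  note vS = L_index_words[OF v] and wS = L_index_words[OF w]
    note [measurable] = piece_mu(1)[OF vS] piece_mu(1)[OF wS]
  define a where "a u = measure \<mu> (piece u) powr (-1/2)" for u
  have "L2_inner \<mu> (chi d s \<Gamma> v) (chi d s \<Gamma> w)
      = (\<integral>x. complex_of_real (a v * a w) * complex_of_real (indicator (piece v \<inter> piece w) x) \<partial>\<mu>)"
    unfolding L2_inner_def chi_eq[OF vS] chi_eq[OF wS] a_def
    by (rule Bochner_Integration.integral_cong) (auto simp: indicator_def)
  also have "\<dots> = complex_of_real (a v * a w * measure \<mu> (piece v \<inter> piece w))"
    by (simp add: emeasure_eq_measure)
  also have "\<dots> = (if v = w then 1 else 0)"
  proof (cases "v = w")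
    case True
    have "a v * a v = measure \<mu> (piece v) powr (-1)" unfolding a_def powr_add[symmetric] by simp
    then have "a v * a v * measure \<mu> (piece v) = 1"
      using measure_piece_pos[OF vS] by (simp add: powr_minus)
    then show ?thesis using True by simp
  next
    case False
    have "emeasure (hausdorff_measure d) (piece v \<inter> piece w) = 0"
      by (rule parallel_overlap_null[OF d_pos moran_eq outer_finite vS wS L_index_parallel[OF v w False]])
    then have "measure \<mu> (piece v \<inter> piece w) = 0"
      using emeasure_mu[OF le_infI1[OF piece_subset_attr[OF vS]], of "piece w"] by (simp add: measure_def)
    then show ?thesis using False by simp
  qed
  finally show ?thesis .
qed

lemma basis_ordering_orthonormal:
  assumes "basis_ordering d M s \<Gamma> h N f" "i < N"
  shows "f i \<in> L2 \<mu>" and "j < N \<Longrightarrow> L2_inner \<mu> (f i) (f j) = (if i = j then 1 else 0)"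
proof -
  obtain w where w: "bij_betw w {..<N} (L_index M s \<Gamma> h)" "\<And>i. i < N \<Longrightarrow> f i = chi d s \<Gamma> (w i)"
    using assms(1) by (auto simp: basis_ordering_def)
  have wL: "w i \<in> L_index M s \<Gamma> h" if "i < N" for i using w(1) that by (auto simp: bij_betw_def)
  show "f i \<in> L2 \<mu>" unfolding w(2)[OF assms(2)] by (rule chi_L2[OF L_index_words[OF wL[OF assms(2)]]])
  assume j: "j < N"
  have inj: "inj_on w {..<N}" using w(1) by (simp add: bij_betw_def)
  show "L2_inner \<mu> (f i) (f j) = (if i = j then 1 else 0)"
    unfolding w(2)[OF assms(2)] w(2)[OF j] chi_orthonormal[OF wL[OF assms(2)] wL[OF j]]
    using assms(2) j by (simp add: inj_on_eq_iff[OF inj])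
qed

end

section \<open>Uniqueness of Fourier transforms of distributions\<close>

text \<open>The flat function exp(-1/x) times a polynomial in 1/x, extended by 0. The family is
  closed under differentiation, so smoothness becomes an induction.\<close>

definition flat_exp :: "real poly \<Rightarrow> real \<Rightarrow> real" where
  "flat_exp p x = (if 0 < x then poly p (1 / x) * exp (- (1 / x)) else 0)"

lemma poly_times_exp_minus_tendsto_0: "((\<lambda>y. poly p y * exp (- y)) \<longlongrightarrow> 0) at_top" for p :: "real poly"
proof -
  have "((\<lambda>y. \<Sum>i\<le>degree p. coeff p i * (y ^ i / exp y)) \<longlongrightarrow> (\<Sum>i\<le>degree p. coeff p i * 0)) at_top"
    by (intro tendsto_intros tendsto_power_div_exp_0)
  moreover have "(\<Sum>i\<le>degree p. coeff p i * (y ^ i / exp y)) = poly p y * exp (- y)" for y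
    by (simp add: poly_altdef sum_distrib_right exp_minus divide_inverse mult.assoc)
  ultimately show ?thesis by simp
qed

text \<open>With y = 1/x, the derivative belongs to the polynomial y^2 (p - p'). At 0 the right
  difference quotient is y p(y) exp(-y) with y tending to infinity, again a polynomial times
  exp(-y).\<close>

lemma flat_exp_has_derivative:
  "(flat_exp p has_real_derivative flat_exp ([:0, 0, 1:] * (p - pderiv p)) x) (at x)"
proof -
  consider "0 < x" | "x < 0" | "x = 0" by linarith
  then show ?thesis
  proof cases
    case 1
    have deriv: "((\<lambda>x. poly p (1 / x) * exp (- (1 / x))) has_real_derivative
        poly (pderiv p) (1 / x) * (- 1 / x\<^sup>2) * exp (- (1 / x)) + (exp (- (1 / x)) * (1 / x\<^sup>2)) * poly p (1 / x)) (at x)"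
      using 1 by (auto intro!: derivative_eq_intros DERIV_chain'[OF _ poly_DERIV] simp: power2_eq_square)
    have eq: "poly (pderiv p) (1 / x) * (- 1 / x\<^sup>2) * exp (- (1 / x)) + (exp (- (1 / x)) * (1 / x\<^sup>2)) * poly p (1 / x)
        = flat_exp ([:0, 0, 1:] * (p - pderiv p)) x"
      using 1 by (simp add: flat_exp_def field_simps power2_eq_square)
    have "eventually (\<lambda>y. y \<in> {0<..}) (nhds x)"
      using 1 by (intro eventually_nhds_in_open) auto
    then have "eventually (\<lambda>y. poly p (1 / y) * exp (- (1 / y)) = flat_exp p y) (nhds x)"
      by eventually_elim (simp add: flat_exp_def)
    from DERIV_cong_ev[OF refl this eq] deriv show ?thesis by blast
  next
    case 2
    have deriv: "((\<lambda>x. 0) has_real_derivative 0) (at x)" by simp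
    have "eventually (\<lambda>y. y \<in> {..<0}) (nhds x)"
      using 2 by (intro eventually_nhds_in_open) auto
    then have ev: "eventually (\<lambda>y. 0 = flat_exp p y) (nhds x)"
      by eventually_elim (simp add: flat_exp_def)
    have "0 = flat_exp ([:0, 0, 1:] * (p - pderiv p)) x" using 2 by (simp add: flat_exp_def)
    from DERIV_cong_ev[OF refl ev this] deriv show ?thesis by blast
  next
    case 3
    have "((\<lambda>h. flat_exp p h / h) \<longlongrightarrow> 0) (at_right 0)"
    proof -
      have "((\<lambda>h. poly ([:0, 1:] * p) (inverse h) * exp (- inverse h)) \<longlongrightarrow> 0) (at_right (0::real))"
        by (rule filterlim_compose[OF poly_times_exp_minus_tendsto_0 filterlim_inverse_at_top_right])
      moreover have "eventually (\<lambda>h. poly ([:0, 1:] * p) (inverse h) * exp (- inverse h) = flat_exp p h / h) (at_right (0::real))"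
        using eventually_at_right_less[of "0::real"]
        by eventually_elim (simp add: flat_exp_def field_simps)
      ultimately show ?thesis by (rule Lim_transform_eventually)
    qed
    moreover have "((\<lambda>h. flat_exp p h / h) \<longlongrightarrow> 0) (at_left 0)"
    proof (rule tendsto_eventually)
      have "eventually (\<lambda>h. h < 0) (at_left (0::real))" by (simp add: eventually_at_filter)
      then show "eventually (\<lambda>h. flat_exp p h / h = 0) (at_left 0)"
        by eventually_elim (simp add: flat_exp_def)
    qed
    ultimately have "((\<lambda>h. flat_exp p h / h) \<longlongrightarrow> 0) (at 0)" by (simp add: filterlim_split_at)
    then show ?thesis using 3 by (simp add: DERIV_def flat_exp_def)
  qed
qed

text \<open>An algebra that contains its own directional derivatives. \<open>smooth_fun\<close> asks
  about all iterated derivatives, and membership in such an algebra is an invariant that survives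
  each of them.\<close>

inductive bump_alg :: "('a::euclidean_space \<Rightarrow> complex) \<Rightarrow> bool" where
  bump_alg_base: "bump_alg (\<lambda>x. complex_of_real (flat_exp p (\<alpha> + inner x v)))"
| bump_alg_const: "bump_alg (\<lambda>x. c)"
| bump_alg_add: "bump_alg f \<Longrightarrow> bump_alg g \<Longrightarrow> bump_alg (\<lambda>x. f x + g x)"
| bump_alg_mult: "bump_alg f \<Longrightarrow> bump_alg g \<Longrightarrow> bump_alg (\<lambda>x. f x * g x)"

lemma bump_alg_prod: "finite I \<Longrightarrow> (\<And>i. i \<in> I \<Longrightarrow> bump_alg (f i)) \<Longrightarrow> bump_alg (\<lambda>x. \<Prod>i\<in>I. f i x)"
  by (induction I rule: finite_induct) (auto intro: bump_alg.intros)

lemma bump_alg_derivative: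
  "bump_alg f \<Longrightarrow> \<exists>f'. (\<forall>x. (f has_derivative f' x) (at x)) \<and> (\<forall>h. bump_alg (\<lambda>x. f' x h))"
proof (induction rule: bump_alg.induct)
  case (bump_alg_base p \<alpha> v)
  define q where "q = [:0, 0, 1:] * (p - pderiv p)"
  define f' where "f' x h = complex_of_real (inner h v) * complex_of_real (flat_exp q (\<alpha> + inner x v))" for x h :: 'a
  have "((\<lambda>x. complex_of_real (flat_exp p (\<alpha> + inner x v))) has_derivative f' x) (at x)" for x
  proof -
    have "((\<lambda>x. \<alpha> + inner x v) has_derivative (\<lambda>h. inner h v)) (at x)" by (auto intro!: derivative_eq_intros)
    from has_derivative_compose[OF this flat_exp_has_derivative[of p "\<alpha> + inner x v", unfolded has_field_derivative_def]]
    have "((\<lambda>x. flat_exp p (\<alpha> + inner x v)) has_derivative (\<lambda>h. flat_exp q (\<alpha> + inner x v) * inner h v)) (at x)"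
      by (simp add: q_def)
    then have "((\<lambda>x. complex_of_real (flat_exp p (\<alpha> + inner x v))) has_derivative
        (\<lambda>h. complex_of_real (flat_exp q (\<alpha> + inner x v) * inner h v))) (at x)"
      by (rule has_derivative_of_real)
    then show ?thesis by (simp add: f'_def[abs_def] mult.commute)
  qed
  moreover have "bump_alg (\<lambda>x. f' x h)" for h unfolding f'_def by (intro bump_alg.intros)
  ultimately show ?case by blast
next
  case (bump_alg_const c)
  show ?case by (intro exI[of _ "\<lambda>x h. 0"]) (auto intro: bump_alg.intros)
next
  case (bump_alg_add f g)
  then obtain f' g' where "\<And>x. (f has_derivative f' x) (at x)" "\<And>x. (g has_derivative g' x) (at x)"
      "\<And>h. bump_alg (\<lambda>x. f' x h)" "\<And>h. bump_alg (\<lambda>x. g' x h)" by blast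
  then show ?case
    by (intro exI[of _ "\<lambda>x h. f' x h + g' x h"]) (auto intro: bump_alg.intros has_derivative_add)
next
  case (bump_alg_mult f g)
  then obtain f' g' where "\<And>x. (f has_derivative f' x) (at x)" "\<And>x. (g has_derivative g' x) (at x)"
      "\<And>h. bump_alg (\<lambda>x. f' x h)" "\<And>h. bump_alg (\<lambda>x. g' x h)" by blast
  with bump_alg_mult.hyps show ?case
    by (intro exI[of _ "\<lambda>x h. f x * g' x h + f' x h * g x"] conjI allI has_derivative_mult
        bump_alg.bump_alg_add bump_alg.bump_alg_mult)
qed

lemma bump_alg_iter_pderiv: "bump_alg f \<Longrightarrow> bump_alg (iter_pderiv bs f)"
proof (induction bs)
  case (Cons b bs)
  then obtain f' where f': "\<And>x. (iter_pderiv bs f has_derivative f' x) (at x)" "bump_alg (\<lambda>x. f' x b)"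
    using bump_alg_derivative by blast
  then have "iter_pderiv (b # bs) f = (\<lambda>x. f' x b)"
    using frechet_derivative_at[OF f'(1)] by (auto simp: fun_eq_iff)
  then show ?case using f' by simp
qed simp

lemma bump_alg_smooth: "bump_alg f \<Longrightarrow> smooth_fun f"
  unfolding smooth_fun_def differentiable_on_def differentiable_def
  using bump_alg_derivative[OF bump_alg_iter_pderiv] by blast

text \<open>The complement of the support is open, so the function vanishes near the point and its
  derivatives vanish with it.\<close>

lemma iter_pderiv_zero_outside:
  assumes "x \<notin> fun_support f"
  shows "iter_pderiv bs f x = 0"
  using assms
proof (induction bs arbitrary: x)
  case Nil
  then show ?case using closure_subset by (force simp: fun_support_def)
next
  case (Cons b bs)
  have "open (- fun_support f)" by (simp add: fun_support_def open_Compl)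
  then have "eventually (\<lambda>y. y \<in> - fun_support f) (nhds x)" using Cons.prems by (intro eventually_nhds_in_open) auto
  then have ev: "eventually (\<lambda>y. iter_pderiv bs f y = 0) (nhds x)"
    by eventually_elim (use Cons.IH in auto)
  have "((\<lambda>y. 0 :: complex) has_derivative (\<lambda>h. 0)) (at x)" by simp
  then have "(iter_pderiv bs f has_derivative (\<lambda>h. 0)) (at x)"
  proof (rule has_derivative_transform_eventually)
    show "eventually (\<lambda>y. 0 = iter_pderiv bs f y) (at x within UNIV)"
      using ev by (auto simp: eventually_at_filter elim: eventually_mono)
    show "0 = iter_pderiv bs f x" using eventually_nhds_x_imp_x[OF ev] by simp
  qed simp
  from frechet_derivative_at[OF this] show ?case by (simp add: fun_eq_iff)
qed

section \<open>Test functions that fill out boxes\<close>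

lemma test_functions_schwartz:
  assumes "f \<in> test_functions \<Omega>"
  shows "f \<in> schwartz"
  unfolding schwartz_def
proof (intro CollectI conjI ballI allI)
  show sm: "smooth_fun f" using assms by (simp add: test_functions_def)
  fix bs :: "'a list" and N :: nat assume bs: "bs \<in> lists Basis"
  let ?g = "\<lambda>x. (1 + norm x) ^ N * cmod (iter_pderiv bs f x)"
  have "continuous_on (fun_support f) (iter_pderiv bs f)"
    using sm bs unfolding smooth_fun_def
    by (intro continuous_on_subset[OF differentiable_imp_continuous_on subset_UNIV]) auto
  then have "continuous_on (fun_support f) ?g" by (intro continuous_intros)
  moreover have "compact (fun_support f)" using assms by (simp add: test_functions_def)
  ultimately have "bounded (?g ` fun_support f)" by (intro compact_imp_bounded compact_continuous_image)
  then obtain C where C: "\<And>x. x \<in> fun_support f \<Longrightarrow> norm (?g x) \<le> C" by (auto simp: bounded_iff)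
  have "?g x \<le> max C 0" for x
    using C[of x] iter_pderiv_zero_outside[of x f bs] by (cases "x \<in> fun_support f") auto
  then show "\<exists>C. \<forall>x. ?g x \<le> C" by blast
qed

text \<open>As \<open>k\<close> grows, each factor exp(-1 / (k t)) with t > 0 increases to 1. The
  bumps thus converge to the indicator of the box and never exceed it, as dominated convergence
  requires.\<close>

definition box_bump :: "'a::euclidean_space \<Rightarrow> 'a \<Rightarrow> real \<Rightarrow> 'a \<Rightarrow> real" where
  "box_bump a b k x = (\<Prod>i\<in>Basis. flat_exp 1 (k * (inner x i - inner a i)) * flat_exp 1 (k * (inner b i - inner x i)))"

lemma flat_exp_1_bounds: "0 \<le> flat_exp 1 x" "flat_exp 1 x \<le> 1"
  by (auto simp: flat_exp_def)

lemma box_bump_bounds: "0 \<le> box_bump a b k x" "box_bump a b k x \<le> 1"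
  unfolding box_bump_def by (auto intro!: prod_nonneg prod_le_1 mult_le_one mult_nonneg_nonneg flat_exp_1_bounds)

lemma box_bump_outside:
  assumes "0 < k" "x \<notin> box a b"
  shows "box_bump a b k x = 0"
proof -
  from assms obtain i where i: "i \<in> Basis" "\<not> (inner a i < inner x i \<and> inner x i < inner b i)" by (auto simp: mem_box)
  have "flat_exp 1 (k * (inner x i - inner a i)) * flat_exp 1 (k * (inner b i - inner x i)) = 0"
    using i assms by (auto simp: flat_exp_def zero_less_mult_iff)
  then show ?thesis unfolding box_bump_def using i(1) by (intro prod_zero) auto
qed

lemma box_bump_pos: "0 < k \<Longrightarrow> x \<in> box a b \<Longrightarrow> 0 < box_bump a b k x"
  unfolding box_bump_def by (intro prod_pos) (auto simp: mem_box flat_exp_def)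

lemma box_bump_tendsto: "(\<lambda>n. box_bump a b (real (Suc n)) x) \<longlonglongrightarrow> indicator (box a b) x"
proof (cases "x \<in> box a b")
  case True
  have lim: "(\<lambda>n. flat_exp 1 (real (Suc n) * t)) \<longlonglongrightarrow> 1" if "0 < t" for t
  proof -
    have "(\<lambda>n. exp (- (1 / t * (1 / real (Suc n))))) \<longlonglongrightarrow> exp (- (1 / t * 0))"
      by (intro tendsto_intros LIMSEQ_Suc[OF lim_1_over_n])
    then show ?thesis using that by (simp add: flat_exp_def mult.commute)
  qed
  have "(\<lambda>n. box_bump a b (real (Suc n)) x) \<longlonglongrightarrow> (\<Prod>i\<in>(Basis::'a set). 1 * 1)"
    unfolding box_bump_def using True by (intro tendsto_prod tendsto_mult lim) (auto simp: mem_box)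
  then show ?thesis using True by simp
next
  case False
  then show ?thesis by (simp add: box_bump_outside del: of_nat_Suc)
qed

lemma bump_alg_box_bump: "bump_alg (\<lambda>x. complex_of_real (box_bump a b k x))"
proof -
  have eq: "(\<lambda>x. complex_of_real (box_bump a b k x)) = (\<lambda>x. \<Prod>i\<in>Basis.
      complex_of_real (flat_exp 1 (- k * inner a i + inner x (k *\<^sub>R i))) *
      complex_of_real (flat_exp 1 (k * inner b i + inner x (- k *\<^sub>R i))))"
    unfolding box_bump_def by (simp add: algebra_simps)
  show ?thesis unfolding eq by (intro bump_alg_prod bump_alg.intros finite_Basis)
qed

lemma box_bump_test_function:
  assumes "0 < k"
  shows "(\<lambda>x. complex_of_real (box_bump a b k x)) \<in> test_functions UNIV"
proof -
  have "fun_support (\<lambda>x. complex_of_real (box_bump a b k x)) \<subseteq> closure (box a b)"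
    unfolding fun_support_def using box_bump_outside[OF assms] by (intro closure_mono) force
  then have "bounded (fun_support (\<lambda>x. complex_of_real (box_bump a b k x)))"
    by (meson bounded_box bounded_closure bounded_subset)
  then show ?thesis unfolding test_functions_def
    by (simp add: bump_alg_smooth[OF bump_alg_box_bump] compact_eq_bounded_closed) (simp add: fun_support_def)
qed

text \<open>The positive and the negative part of \<open>r\<close> are densities of measures that
  agree on boxes. Boxes are stable under intersection and generate the Borel sets, so the measures
  agree, and with them the densities almost everywhere.\<close>

lemma AE_zero_if_box_integrals_zero:
  fixes r :: "'a::euclidean_space \<Rightarrow> real"
  assumes meas [measurable]: "r \<in> borel_measurable borel"
    and int: "\<And>a b. integrable lborel (\<lambda>x. indicator (box a b) x * r x)"
    and zero: "\<And>a b. integral\<^sup>L lborel (\<lambda>x. indicator (box a b) x * r x) = 0"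
  shows "AE x in lborel. r x = 0"
proof -
  define f where "f x = ennreal (max 0 (r x))" for x
  define g where "g x = ennreal (max 0 (- r x))" for x
  have [measurable]: "f \<in> borel_measurable borel" "g \<in> borel_measurable borel" unfolding f_def g_def by measurable
  \<comment> \<open>The parameter \<open>c\<close> is later set to 1 and -1, so both parts of
    \<open>r\<close> are treated at once.\<close>
  have box_part: "integrable lborel (\<lambda>x. max 0 (c * (indicator (box a b) x * r x)))" for a b and c :: real
    using int[of a b] by (intro integrable_max) auto
  have part_box: "emeasure (density lborel (\<lambda>x. ennreal (max 0 (c * r x)))) (box a b)
      = ennreal (integral\<^sup>L lborel (\<lambda>x. max 0 (c * (indicator (box a b) x * r x))))" for a b and c :: real
  proof -
    have "emeasure (density lborel (\<lambda>x. ennreal (max 0 (c * r x)))) (box a b)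
        = (\<integral>\<^sup>+x. ennreal (max 0 (c * (indicator (box a b) x * r x))) \<partial>lborel)"
      by (subst emeasure_density) (auto simp: indicator_def intro!: nn_integral_cong)
    also have "\<dots> = ennreal (integral\<^sup>L lborel (\<lambda>x. max 0 (c * (indicator (box a b) x * r x))))"
      by (rule nn_integral_eq_integral[OF box_part]) simp
    finally show ?thesis .
  qed
  have f_box: "emeasure (density lborel f) (box a b) = ennreal (integral\<^sup>L lborel (\<lambda>x. max 0 (1 * (indicator (box a b) x * r x))))"
    and g_box: "emeasure (density lborel g) (box a b) = ennreal (integral\<^sup>L lborel (\<lambda>x. max 0 (-1 * (indicator (box a b) x * r x))))" for a b
    using part_box[of 1] part_box[of "-1"] by (simp_all add: f_def[abs_def] g_def[abs_def])
  have parts: "integral\<^sup>L lborel (\<lambda>x. max 0 (1 * (indicator (box a b) x * r x)))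
      = integral\<^sup>L lborel (\<lambda>x. max 0 (-1 * (indicator (box a b) x * r x)))" for a b
  proof -
    have "integral\<^sup>L lborel (\<lambda>x. max 0 (1 * (indicator (box a b) x * r x)))
        - integral\<^sup>L lborel (\<lambda>x. max 0 (-1 * (indicator (box a b) x * r x)))
        = integral\<^sup>L lborel (\<lambda>x. max 0 (1 * (indicator (box a b) x * r x)) - max 0 (-1 * (indicator (box a b) x * r x)))"
      by (rule Bochner_Integration.integral_diff[symmetric]; rule box_part)
    also have "\<dots> = integral\<^sup>L lborel (\<lambda>x. indicator (box a b) x * r x)"
      by (rule Bochner_Integration.integral_cong) auto
    finally show ?thesis using zero[of a b] by simp
  qed
  have "density lborel f = density lborel g"
  proof (rule measure_eqI_generator_eq[where \<Omega> = UNIV and E = "range (\<lambda>(a, b). box a b)"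
        and A = "\<lambda>n::nat. box (- (real n *\<^sub>R One)) (real n *\<^sub>R One) :: 'a set"])
    show "Int_stable (range (\<lambda>(a, b). box a b :: 'a set))" by (auto simp: Int_stable_def box_Int_box)
    show "emeasure (density lborel f) X = emeasure (density lborel g) X" if "X \<in> range (\<lambda>(a, b). box a b)" for X
      using that f_box g_box parts by auto
    show "sets (density lborel f) = sigma_sets UNIV (range (\<lambda>(a, b). box a b))"
      "sets (density lborel g) = sigma_sets UNIV (range (\<lambda>(a, b). box a b))"
      by (simp_all add: borel_eq_box)
    show "(\<Union>n. box (- (real n *\<^sub>R One)) (real n *\<^sub>R One) :: 'a set) = UNIV" by (rule UN_box_eq_UNIV)
    show "emeasure (density lborel f) (box (- (real n *\<^sub>R One)) (real n *\<^sub>R One)) \<noteq> \<infinity>" for n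
      unfolding f_box by simp
  qed auto
  then have "AE x in lborel. f x = g x" 
    by (simp add: sigma_finite_measure.density_unique_iff[OF lborel.sigma_finite_measure_axioms])
  then show ?thesis by eventually_elim (auto simp: f_def g_def max_def split: if_splits)
qed

lemma smooth_fun_continuous: "smooth_fun f \<Longrightarrow> continuous_on UNIV f"
proof -
  assume "smooth_fun f"
  then have "iter_pderiv [] f differentiable_on UNIV" unfolding smooth_fun_def by (rule bspec) simp
  then show ?thesis by (simp add: differentiable_imp_continuous_on)
qed

lemma smooth_fun_measurable: "smooth_fun f \<Longrightarrow> f \<in> borel_measurable borel"
  by (intro borel_measurable_continuous_onI smooth_fun_continuous)

lemma schwartz_smooth: "\<phi> \<in> schwartz \<Longrightarrow> smooth_fun \<phi>"
  by (simp add: schwartz_def)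

text \<open>\<open>h\<close> is only known to be integrable against Schwartz functions.
  Integrability over a box comes from a bump on a larger box, which stays above a positive constant
  on the closure of the smaller one. Bumps converging to the indicator then show that the integrals
  over boxes vanish.\<close>

lemma schwartz_separates:
  fixes h :: "'a::euclidean_space \<Rightarrow> complex"
  assumes meas: "h \<in> borel_measurable borel"
    and int: "\<And>\<phi>. \<phi> \<in> schwartz \<Longrightarrow> integrable lborel (\<lambda>x. h x * \<phi> x)"
    and zero: "\<And>\<phi>. \<phi> \<in> schwartz \<Longrightarrow> integral\<^sup>L lborel (\<lambda>x. h x * \<phi> x) = 0"
  shows "AE x in lborel. h x = 0"
proof -
  note [measurable] = meas
  define B where "B a b k x = complex_of_real (box_bump a b k x)" for a b :: 'a and k x
  have BS: "B a b k \<in> schwartz" if "0 < k" for a b k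
    unfolding B_def using box_bump_test_function[OF that] by (rule test_functions_schwartz)
  have Bmeas [measurable]: "B a b k \<in> borel_measurable borel" if "0 < k" for a b k
    using smooth_fun_measurable[OF schwartz_smooth[OF BS[OF that]]] .
  have box_int: "integrable lborel (\<lambda>x. complex_of_real (indicator (box a b) x) * h x)" for a b
  proof (cases "box a b = {}")
    case False
    let ?b = "box_bump (a - One) (b + One) 1"
    have sub: "cbox a b \<subseteq> box (a - One) (b + One)"
      by (auto simp: mem_box inner_diff_left inner_add_left) (smt (verit) inner_sum_left_Basis)+
    have ne: "cbox a b \<noteq> {}" using False box_subset_cbox by blast
    have "continuous_on UNIV (B (a - One) (b + One) 1)"
      by (intro smooth_fun_continuous schwartz_smooth BS) simp
    then have "continuous_on (cbox a b) (\<lambda>x. cmod (B (a - One) (b + One) 1 x))"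
      by (intro continuous_intros) (rule continuous_on_subset, auto)
    then have "continuous_on (cbox a b) ?b" by (simp add: B_def box_bump_bounds)
    then obtain x0 where x0: "x0 \<in> cbox a b" "\<And>x. x \<in> cbox a b \<Longrightarrow> ?b x0 \<le> ?b x"
      using continuous_attains_inf[OF compact_cbox ne] by blast
    define c where "c = ?b x0"
    have c: "0 < c" unfolding c_def using x0(1) sub by (intro box_bump_pos) auto
    show ?thesis
    proof (rule Bochner_Integration.integrable_bound)
      show "integrable lborel (\<lambda>x. complex_of_real (1 / c) * (h x * B (a - One) (b + One) 1 x))"
        by (intro integrable_mult_right int BS) simp
      have "norm (complex_of_real (indicator (box a b) x) * h x)
          \<le> norm (complex_of_real (1 / c) * (h x * B (a - One) (b + One) 1 x))" for x
      proof (cases "x \<in> box a b")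
        case True
        then have "c \<le> ?b x" unfolding c_def using box_subset_cbox by (intro x0(2)) blast
        then have "cmod (h x) * c \<le> cmod (h x) * ?b x" by (rule mult_left_mono) simp
        then show ?thesis using True c
          by (simp add: norm_mult B_def box_bump_bounds norm_divide field_simps)
      qed simp
      then show "AE x in lborel. norm (complex_of_real (indicator (box a b) x) * h x)
          \<le> norm (complex_of_real (1 / c) * (h x * B (a - One) (b + One) 1 x))" by simp
    qed measurable
  qed simp
  have box_zero: "integral\<^sup>L lborel (\<lambda>x. complex_of_real (indicator (box a b) x) * h x) = 0" for a b
  proof -
    have "(\<lambda>n. integral\<^sup>L lborel (\<lambda>x. B a b (real (Suc n)) x * h x))
        \<longlonglongrightarrow> integral\<^sup>L lborel (\<lambda>x. complex_of_real (indicator (box a b) x) * h x)"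
    proof (rule integral_dominated_convergence)
      show "integrable lborel (\<lambda>x. norm (complex_of_real (indicator (box a b) x) * h x))"
        using box_int by (rule integrable_norm)
      show "AE x in lborel. (\<lambda>n. B a b (real (Suc n)) x * h x) \<longlonglongrightarrow> complex_of_real (indicator (box a b) x) * h x"
        unfolding B_def by (intro AE_I2 tendsto_mult tendsto_const tendsto_of_real box_bump_tendsto)
      have "norm (B a b (real (Suc n)) x * h x) \<le> norm (complex_of_real (indicator (box a b) x) * h x)" for n x
        using box_bump_bounds[of a b "real (Suc n)" x] box_bump_outside[of "real (Suc n)" x a b]
        by (cases "x \<in> box a b") (auto simp: B_def norm_mult mult_left_le_one_le)
      then show "AE x in lborel. norm (B a b (real (Suc n)) x * h x)
          \<le> norm (complex_of_real (indicator (box a b) x) * h x)" for n by simp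
    qed measurable
    moreover have "integral\<^sup>L lborel (\<lambda>x. B a b (real (Suc n)) x * h x) = 0" for n
      using zero[OF BS[of "real (Suc n)" a b]] by (simp add: mult.commute del: of_nat_Suc)
    ultimately have "(\<lambda>n::nat. 0 :: complex) \<longlonglongrightarrow> integral\<^sup>L lborel (\<lambda>x. complex_of_real (indicator (box a b) x) * h x)"
      by (simp only:)
    then show ?thesis by (simp only: LIMSEQ_const_iff)
  qed
  have "AE x in lborel. Re (h x) = 0"
  proof (rule AE_zero_if_box_integrals_zero)
    fix a b
    have eq: "(\<lambda>x. indicator (box a b) x * Re (h x)) = (\<lambda>x. Re (complex_of_real (indicator (box a b) x) * h x))" by auto
    show "integrable lborel (\<lambda>x. indicator (box a b) x * Re (h x))" unfolding eq by (rule integrable_Re[OF box_int])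
    show "integral\<^sup>L lborel (\<lambda>x. indicator (box a b) x * Re (h x)) = 0"
      unfolding eq integral_Re[OF box_int] box_zero by simp
  qed measurable
  moreover have "AE x in lborel. Im (h x) = 0"
  proof (rule AE_zero_if_box_integrals_zero)
    fix a b
    have eq: "(\<lambda>x. indicator (box a b) x * Im (h x)) = (\<lambda>x. Im (complex_of_real (indicator (box a b) x) * h x))" by auto
    show "integrable lborel (\<lambda>x. indicator (box a b) x * Im (h x))" unfolding eq by (rule integrable_Im[OF box_int])
    show "integral\<^sup>L lborel (\<lambda>x. indicator (box a b) x * Im (h x)) = 0"
      unfolding eq integral_Im[OF box_int] box_zero by simp
  qed measurable
  ultimately show ?thesis by eventually_elim (simp add: complex_eq_iff)
qed

text \<open>\<open>dist_fourier\<close> is a choice among functions that represent the same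
  transform; this makes every integral formed from it independent of the choice.\<close>

lemma has_fourier_unique:
  assumes f: "has_fourier u f" and g: "has_fourier u g"
  shows "AE x in lborel. f x = g x"
proof -
  have [measurable]: "f \<in> borel_measurable borel" "g \<in> borel_measurable borel"
    using f g by (auto simp: has_fourier_def)
  have "AE x in lborel. f x - g x = 0"
  proof (rule schwartz_separates)
    fix \<phi> :: "'a \<Rightarrow> complex" assume \<phi>: "\<phi> \<in> schwartz"
    have "integrable lborel (\<lambda>x. f x * \<phi> x)" "u (fourier \<phi>) = integral\<^sup>L lborel (\<lambda>x. f x * \<phi> x)"
      using f \<phi> by (simp_all add: has_fourier_def)
    moreover have "integrable lborel (\<lambda>x. g x * \<phi> x)" "u (fourier \<phi>) = integral\<^sup>L lborel (\<lambda>x. g x * \<phi> x)"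
      using g \<phi> by (simp_all add: has_fourier_def)
    ultimately show "integrable lborel (\<lambda>x. (f x - g x) * \<phi> x)" "integral\<^sup>L lborel (\<lambda>x. (f x - g x) * \<phi> x) = 0"
      by (simp_all add: left_diff_distrib)
  qed measurable
  then show ?thesis by simp
qed

section \<open>Sobolev spaces\<close>

text \<open>With the weight to the power \<open>r / 2\<close> inside, the Sobolev norm is a plain L2
  norm over \<open>lborel\<close>, and the L2 estimates carry over.\<close>

definition weighted_fourier :: "real \<Rightarrow> 'a::euclidean_space dist \<Rightarrow> 'a \<Rightarrow> complex" where
  "weighted_fourier r u \<xi> = complex_of_real ((1 + (norm \<xi>)\<^sup>2) powr (r / 2)) * dist_fourier u \<xi>"

lemma bessel_weight_sq:
  "(cmod (complex_of_real ((1 + (norm \<xi>)\<^sup>2) powr (r / 2)) * z))\<^sup>2 = (1 + (norm \<xi>)\<^sup>2) powr r * (cmod z)\<^sup>2"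
proof -
  have "((1 + (norm \<xi>)\<^sup>2) powr (r / 2))\<^sup>2 = (1 + (norm \<xi>)\<^sup>2) powr r"
    by (simp add: power2_eq_square flip: powr_add)
  then show ?thesis by (simp add: norm_mult power_mult_distrib)
qed

lemma sobolev_norm_eq: "sobolev_norm r u = L2_norm lborel (weighted_fourier r u)"
  by (simp add: sobolev_norm_def L2_norm_def weighted_fourier_def bessel_weight_sq)

lemma has_fourier_dist_fourier: "has_fourier u g \<Longrightarrow> has_fourier u (dist_fourier u)"
  unfolding dist_fourier_def by (rule someI[of "has_fourier u"])

lemma has_fourier_AE: "has_fourier u g \<Longrightarrow> AE \<xi> in lborel. dist_fourier u \<xi> = g \<xi>"
  using has_fourier_unique has_fourier_dist_fourier by blast

lemma has_fourier_measurable: "has_fourier u g \<Longrightarrow> g \<in> borel_measurable borel"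
  by (simp add: has_fourier_def)

lemma sobolev_iff:
  "u \<in> sobolev r \<longleftrightarrow> u \<in> tempered \<and> has_fourier u (dist_fourier u) \<and> weighted_fourier r u \<in> L2 lborel"
proof
  assume u: "u \<in> sobolev r"
  then obtain g where g: "has_fourier u g" "integrable lborel (\<lambda>\<xi>. (1 + (norm \<xi>)\<^sup>2) powr r * (cmod (g \<xi>))\<^sup>2)"
    by (auto simp: sobolev_def)
  have D: "has_fourier u (dist_fourier u)" using g(1) by (rule has_fourier_dist_fourier)
  note [measurable] = has_fourier_measurable[OF g(1)] has_fourier_measurable[OF D]
  have "integrable lborel (\<lambda>\<xi>. (1 + (norm \<xi>)\<^sup>2) powr r * (cmod (dist_fourier u \<xi>))\<^sup>2)"
    using g(2) has_fourier_AE[OF g(1)] by (subst integrable_cong_AE[OF _ _ AE_mp]) auto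
  then have "weighted_fourier r u \<in> L2 lborel"
    unfolding L2_def weighted_fourier_def by (simp add: bessel_weight_sq)
  then show "u \<in> tempered \<and> has_fourier u (dist_fourier u) \<and> weighted_fourier r u \<in> L2 lborel"
    using u D by (simp add: sobolev_def)
next
  assume "u \<in> tempered \<and> has_fourier u (dist_fourier u) \<and> weighted_fourier r u \<in> L2 lborel"
  then show "u \<in> sobolev r"
    unfolding sobolev_def L2_def weighted_fourier_def by (auto simp: bessel_weight_sq)
qed

abbreviation dist_lincomb :: "complex \<Rightarrow> 'a dist \<Rightarrow> complex \<Rightarrow> 'a dist \<Rightarrow> 'a dist" where
  "dist_lincomb a u b v \<equiv> (\<lambda>\<phi>. a * u \<phi> + b * v \<phi>)"

lemma dist_diff_eq: "dist_diff u v = dist_lincomb 1 u (-1) v"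
  by (simp add: dist_diff_def)

definition schwartz_bound :: "nat \<Rightarrow> ('a::euclidean_space \<Rightarrow> complex) \<Rightarrow> real \<Rightarrow> bool" where
  "schwartz_bound N \<phi> B \<longleftrightarrow>
     (\<forall>bs\<in>lists Basis. length bs \<le> N \<longrightarrow> (\<forall>x. (1 + norm x) ^ N * cmod (iter_pderiv bs \<phi> x) \<le> B))"

lemma tempered_iff:
  "u \<in> tempered \<longleftrightarrow> (\<forall>\<phi>. \<phi> \<notin> schwartz \<longrightarrow> u \<phi> = 0) \<and>
     (\<forall>\<phi>\<in>schwartz. \<forall>\<psi>\<in>schwartz. \<forall>a b. u (\<lambda>x. a * \<phi> x + b * \<psi> x) = a * u \<phi> + b * u \<psi>) \<and>
     (\<exists>C N. \<forall>\<phi>\<in>schwartz. \<forall>B. schwartz_bound N \<phi> B \<longrightarrow> cmod (u \<phi>) \<le> C * B)"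
  unfolding tempered_def schwartz_bound_def by simp

lemma schwartz_bound_mono:
  assumes "schwartz_bound N \<phi> B" "n \<le> N"
  shows "schwartz_bound n \<phi> B"
  unfolding schwartz_bound_def
proof (intro ballI impI allI)
  fix bs x assume bs: "bs \<in> lists (Basis :: 'a set)" "length bs \<le> n"
  have "(1 + norm x) ^ n * cmod (iter_pderiv bs \<phi> x) \<le> (1 + norm x) ^ N * cmod (iter_pderiv bs \<phi> x)"
    using assms by (intro mult_right_mono power_increasing) auto
  also have "\<dots> \<le> B" using bspec[OF assms(1)[unfolded schwartz_bound_def] bs(1)] bs(2) assms(2) by simp
  finally show "(1 + norm x) ^ n * cmod (iter_pderiv bs \<phi> x) \<le> B" .
qed

lemma tempered_lincomb:
  assumes "u \<in> tempered" "v \<in> tempered"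
  shows "dist_lincomb a u b v \<in> tempered"
proof -
  obtain C N where C: "\<And>\<phi> B. \<phi> \<in> schwartz \<Longrightarrow> schwartz_bound N \<phi> B \<Longrightarrow> cmod (u \<phi>) \<le> C * B"
    using assms(1) unfolding tempered_iff by metis
  obtain C' N' where C': "\<And>\<phi> B. \<phi> \<in> schwartz \<Longrightarrow> schwartz_bound N' \<phi> B \<Longrightarrow> cmod (v \<phi>) \<le> C' * B"
    using assms(2) unfolding tempered_iff by metis
  have bound: "cmod (dist_lincomb a u b v \<phi>) \<le> (cmod a * C + cmod b * C') * B"
    if \<phi>: "\<phi> \<in> schwartz" and B: "schwartz_bound (max N N') \<phi> B" for \<phi> B
  proof -
    have "cmod (u \<phi>) \<le> C * B" "cmod (v \<phi>) \<le> C' * B"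
      using schwartz_bound_mono[OF B] by (auto intro!: C C' \<phi>)
    then have "cmod a * cmod (u \<phi>) + cmod b * cmod (v \<phi>) \<le> cmod a * (C * B) + cmod b * (C' * B)"
      by (intro add_mono mult_left_mono) auto
    moreover have "cmod (dist_lincomb a u b v \<phi>) \<le> cmod a * cmod (u \<phi>) + cmod b * cmod (v \<phi>)"
      using norm_triangle_ineq[of "a * u \<phi>" "b * v \<phi>"] by (simp add: norm_mult)
    ultimately show ?thesis by (simp add: algebra_simps)
  qed
  have "\<exists>C N. \<forall>\<phi>\<in>schwartz. \<forall>B. schwartz_bound N \<phi> B \<longrightarrow> cmod (dist_lincomb a u b v \<phi>) \<le> C * B"
    using bound by blast
  with assms show ?thesis unfolding tempered_iff by (simp add: algebra_simps)
qed

lemma has_fourier_lincomb: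
  assumes f: "has_fourier u f" and g: "has_fourier v g"
  shows "has_fourier (dist_lincomb a u b v) (\<lambda>\<xi>. a * f \<xi> + b * g \<xi>)"
  unfolding has_fourier_def
proof (intro conjI ballI)
  note [measurable] = has_fourier_measurable[OF f] has_fourier_measurable[OF g]
  show "(\<lambda>\<xi>. a * f \<xi> + b * g \<xi>) \<in> borel_measurable lborel" by measurable
  fix \<phi> :: "'a \<Rightarrow> complex" assume \<phi>: "\<phi> \<in> schwartz"
  have I: "integrable lborel (\<lambda>\<xi>. f \<xi> * \<phi> \<xi>)" "integrable lborel (\<lambda>\<xi>. g \<xi> * \<phi> \<xi>)"
    "u (fourier \<phi>) = integral\<^sup>L lborel (\<lambda>\<xi>. f \<xi> * \<phi> \<xi>)" "v (fourier \<phi>) = integral\<^sup>L lborel (\<lambda>\<xi>. g \<xi> * \<phi> \<xi>)"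
    using f g \<phi> by (simp_all add: has_fourier_def)
  have eq: "(\<lambda>\<xi>. (a * f \<xi> + b * g \<xi>) * \<phi> \<xi>) = (\<lambda>\<xi>. a * (f \<xi> * \<phi> \<xi>) + b * (g \<xi> * \<phi> \<xi>))"
    by (simp add: algebra_simps)
  show "integrable lborel (\<lambda>\<xi>. (a * f \<xi> + b * g \<xi>) * \<phi> \<xi>)" unfolding eq using I(1,2) by simp
  show "dist_lincomb a u b v (fourier \<phi>) = integral\<^sup>L lborel (\<lambda>\<xi>. (a * f \<xi> + b * g \<xi>) * \<phi> \<xi>)"
    unfolding eq using I by simp
qed

text \<open>Equality holds almost everywhere only: the transform of the combination is chosen
  independently of those of \<open>u\<close> and \<open>v\<close>.\<close>

lemma weighted_fourier_lincomb_AE: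
  assumes "has_fourier u f" "has_fourier v g"
  shows "AE \<xi> in lborel. weighted_fourier r (dist_lincomb a u b v) \<xi>
           = a * weighted_fourier r u \<xi> + b * weighted_fourier r v \<xi>"
  using has_fourier_AE[OF has_fourier_lincomb[OF assms, of a b]] has_fourier_AE[OF assms(1)] has_fourier_AE[OF assms(2)]
  by eventually_elim (simp add: weighted_fourier_def algebra_simps)

lemma L2_cong_AE:
  assumes "f \<in> borel_measurable \<mu>" "g \<in> L2 \<mu>" "AE x in \<mu>. f x = g x"
  shows "f \<in> L2 \<mu>" "L2_norm \<mu> f = L2_norm \<mu> g"
proof -
  note [measurable] = assms(1) L2_measurable[OF assms(2)]
  have ae: "AE x in \<mu>. (cmod (f x))\<^sup>2 = (cmod (g x))\<^sup>2" using assms(3) by eventually_elim simp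
  have "integrable \<mu> (\<lambda>x. (cmod (f x))\<^sup>2) \<longleftrightarrow> integrable \<mu> (\<lambda>x. (cmod (g x))\<^sup>2)"
    using ae by (intro integrable_cong_AE) auto
  then show "f \<in> L2 \<mu>" using assms by (simp add: L2_def)
  show "L2_norm \<mu> f = L2_norm \<mu> g" unfolding L2_norm_def
    using ae by (intro arg_cong[where f = sqrt] integral_cong_AE) auto
qed

lemma weighted_fourier_measurable:
  "has_fourier u g \<Longrightarrow> weighted_fourier r u \<in> borel_measurable lborel"
  using has_fourier_measurable[OF has_fourier_dist_fourier] unfolding weighted_fourier_def[abs_def] by measurable

lemma sobolev_lincomb:
  assumes "u \<in> sobolev r" "v \<in> sobolev r"
  shows "dist_lincomb a u b v \<in> sobolev r"
proof -
  have h: "has_fourier u (dist_fourier u)" "has_fourier v (dist_fourier v)"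
    and L: "weighted_fourier r u \<in> L2 lborel" "weighted_fourier r v \<in> L2 lborel"
    and T: "u \<in> tempered" "v \<in> tempered" using assms by (simp_all add: sobolev_iff)
  note H = has_fourier_lincomb[OF h, of a b]
  show ?thesis unfolding sobolev_iff
    using tempered_lincomb[OF T] has_fourier_dist_fourier[OF H]
      L2_cong_AE(1)[OF weighted_fourier_measurable[OF H] L2_lincomb[OF L] weighted_fourier_lincomb_AE[OF h]]
    by blast
qed

lemma sobolev_norm_lincomb:
  assumes "u \<in> sobolev r" "v \<in> sobolev r"
  shows "sobolev_norm r (dist_lincomb a u b v)
      = L2_norm lborel (\<lambda>\<xi>. a * weighted_fourier r u \<xi> + b * weighted_fourier r v \<xi>)"
proof -
  have h: "has_fourier u (dist_fourier u)" "has_fourier v (dist_fourier v)"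
    and L: "weighted_fourier r u \<in> L2 lborel" "weighted_fourier r v \<in> L2 lborel"
    using assms by (simp_all add: sobolev_iff)
  show ?thesis unfolding sobolev_norm_eq
    by (rule L2_cong_AE(2)[OF weighted_fourier_measurable[OF has_fourier_lincomb[OF h, of a b]] L2_lincomb[OF L]
          weighted_fourier_lincomb_AE[OF h]])
qed

lemma sobolev_norm_lincomb_sq_le:
  assumes "u \<in> sobolev r" "v \<in> sobolev r"
  shows "(sobolev_norm r (dist_lincomb a u b v))\<^sup>2
      \<le> 2 * (cmod a)\<^sup>2 * (sobolev_norm r u)\<^sup>2 + 2 * (cmod b)\<^sup>2 * (sobolev_norm r v)\<^sup>2"
  unfolding sobolev_norm_lincomb[OF assms] unfolding sobolev_norm_eq
  using assms by (intro L2_norm_lincomb_sq_le) (simp_all add: sobolev_iff)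

lemma sobolev_cmult: "u \<in> sobolev r \<Longrightarrow> (\<lambda>\<phi>. c * u \<phi>) \<in> sobolev r"
  using sobolev_lincomb[of u r u c 0] by simp

lemma sobolev_norm_cmult: "u \<in> sobolev r \<Longrightarrow> sobolev_norm r (\<lambda>\<phi>. c * u \<phi>) = cmod c * sobolev_norm r u"
  using sobolev_norm_lincomb[of u r u c 0] by (simp add: L2_norm_cmult sobolev_norm_eq)

lemma sobolev_norm_nonneg: "0 \<le> sobolev_norm r u"
  by (simp add: sobolev_norm_eq L2_norm_nonneg)

section \<open>Test functions as tempered distributions\<close>

lemma iter_pderiv_lincomb:
  assumes f: "smooth_fun f" and g: "smooth_fun g" and "bs \<in> lists Basis"
  shows "iter_pderiv bs (\<lambda>x. a * f x + b * g x) = (\<lambda>x. a * iter_pderiv bs f x + b * iter_pderiv bs g x)"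
  using assms(3)
proof (induction bs)
  case (Cons c bs)
  have bs: "bs \<in> lists Basis" using Cons.hyps by simp
  have D: "(iter_pderiv bs f has_derivative frechet_derivative (iter_pderiv bs f) (at x)) (at x)"
    "(iter_pderiv bs g has_derivative frechet_derivative (iter_pderiv bs g) (at x)) (at x)" for x
    using f g bs unfolding smooth_fun_def differentiable_on_def frechet_derivative_works[symmetric] by simp_all
  have H: "((\<lambda>x. a * iter_pderiv bs f x + b * iter_pderiv bs g x) has_derivative
      (\<lambda>h. a * frechet_derivative (iter_pderiv bs f) (at x) h + b * frechet_derivative (iter_pderiv bs g) (at x) h)) (at x)" for x
    by (intro has_derivative_add has_derivative_mult_right D)
  show ?case unfolding iter_pderiv.simps Cons.IH by (simp add: frechet_derivative_at[OF H, symmetric])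
qed simp

lemma smooth_fun_lincomb:
  assumes f: "smooth_fun f" and g: "smooth_fun g"
  shows "smooth_fun (\<lambda>x. a * f x + b * g x)"
  unfolding smooth_fun_def
proof
  fix bs :: "'a list" assume bs: "bs \<in> lists Basis"
  then have "iter_pderiv bs f differentiable_on UNIV" "iter_pderiv bs g differentiable_on UNIV"
    using f g by (simp_all add: smooth_fun_def)
  then show "iter_pderiv bs (\<lambda>x. a * f x + b * g x) differentiable_on UNIV"
    unfolding iter_pderiv_lincomb[OF f g bs] by (intro differentiable_on_add differentiable_on_mult) auto
qed

lemma test_functions_lincomb:
  assumes f: "f \<in> test_functions UNIV" and g: "g \<in> test_functions UNIV"
  shows "(\<lambda>x. a * f x + b * g x) \<in> test_functions UNIV"
proof -
  have "fun_support (\<lambda>x. a * f x + b * g x) \<subseteq> closure ({x. f x \<noteq> 0} \<union> {x. g x \<noteq> 0})"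
    unfolding fun_support_def by (intro closure_mono) auto
  also have "\<dots> = fun_support f \<union> fun_support g" by (simp add: fun_support_def)
  finally have "fun_support (\<lambda>x. a * f x + b * g x) \<subseteq> fun_support f \<union> fun_support g" .
  moreover have "compact (fun_support f \<union> fun_support g)" using f g by (auto simp: test_functions_def)
  moreover have "closed (fun_support (\<lambda>x. a * f x + b * g x))" by (simp add: fun_support_def)
  ultimately have "compact (fun_support (\<lambda>x. a * f x + b * g x))" by (metis Int_absorb1 compact_Int_closed)
  then show ?thesis using f g smooth_fun_lincomb by (auto simp: test_functions_def)
qed

lemma test_function_mult_integrable:
  assumes f: "f \<in> test_functions \<Omega>" and g: "continuous_on UNIV g"
  shows "integrable lborel (\<lambda>x. f x * g x)"
proof -
  have "continuous_on UNIV f" using f by (intro smooth_fun_continuous) (simp add: test_functions_def)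
  then have "continuous_on (fun_support f) (\<lambda>x. f x * g x)"
    using g by (intro continuous_intros) (auto intro: continuous_on_subset)
  then have "integrable lborel (\<lambda>x. indicator (fun_support f) x *\<^sub>R (f x * g x))"
    using f by (intro borel_integrable_compact) (auto simp: test_functions_def)
  moreover have "indicator (fun_support f) x *\<^sub>R (f x * g x) = f x * g x" for x
    using iter_pderiv_zero_outside[of x f "[]"] by (auto simp: indicator_def)
  ultimately show ?thesis by simp
qed

lemma schwartz_lincomb:
  assumes f: "f \<in> schwartz" and g: "g \<in> schwartz"
  shows "(\<lambda>x. a * f x + b * g x) \<in> schwartz"
  unfolding schwartz_def
proof (intro CollectI conjI ballI allI)
  show "smooth_fun (\<lambda>x. a * f x + b * g x)" using f g by (intro smooth_fun_lincomb schwartz_smooth)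
  fix bs :: "'a list" and N :: nat assume bs: "bs \<in> lists Basis"
  obtain C C' where C: "\<And>x. (1 + norm x) ^ N * cmod (iter_pderiv bs f x) \<le> C"
    "\<And>x. (1 + norm x) ^ N * cmod (iter_pderiv bs g x) \<le> C'"
    using f g bs unfolding schwartz_def by blast
  have "(1 + norm x) ^ N * cmod (iter_pderiv bs (\<lambda>x. a * f x + b * g x) x) \<le> cmod a * C + cmod b * C'" for x
  proof -
    have "cmod (a * iter_pderiv bs f x + b * iter_pderiv bs g x)
        \<le> cmod a * cmod (iter_pderiv bs f x) + cmod b * cmod (iter_pderiv bs g x)"
      using norm_triangle_ineq[of "a * iter_pderiv bs f x" "b * iter_pderiv bs g x"] by (simp add: norm_mult)
    then have "(1 + norm x) ^ N * cmod (a * iter_pderiv bs f x + b * iter_pderiv bs g x)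
        \<le> (1 + norm x) ^ N * (cmod a * cmod (iter_pderiv bs f x) + cmod b * cmod (iter_pderiv bs g x))"
      by (rule mult_left_mono) simp
    also have "\<dots> = cmod a * ((1 + norm x) ^ N * cmod (iter_pderiv bs f x)) + cmod b * ((1 + norm x) ^ N * cmod (iter_pderiv bs g x))"
      by (simp add: algebra_simps)
    also have "\<dots> \<le> cmod a * C + cmod b * C'" using C by (intro add_mono mult_left_mono) auto
    finally show ?thesis using iter_pderiv_lincomb[of f g bs a b] f g bs by (simp add: schwartz_def)
  qed
  then show "\<exists>C. \<forall>x. (1 + norm x) ^ N * cmod (iter_pderiv bs (\<lambda>x. a * f x + b * g x) x) \<le> C" by blast
qed

lemma dist_of_fun_lincomb:
  assumes f: "f \<in> test_functions UNIV" and g: "g \<in> test_functions UNIV"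
  shows "dist_of_fun (\<lambda>x. a * f x + b * g x) = dist_lincomb a (dist_of_fun f) b (dist_of_fun g)"
proof
  fix \<phi> :: "'a \<Rightarrow> complex"
  show "dist_of_fun (\<lambda>x. a * f x + b * g x) \<phi> = dist_lincomb a (dist_of_fun f) b (dist_of_fun g) \<phi>"
  proof (cases "\<phi> \<in> schwartz")
    case True
    then have "continuous_on UNIV \<phi>" by (intro smooth_fun_continuous schwartz_smooth)
    then have I: "integrable lborel (\<lambda>x. f x * \<phi> x)" "integrable lborel (\<lambda>x. g x * \<phi> x)"
      using f g by (auto intro: test_function_mult_integrable)
    have "integral\<^sup>L lborel (\<lambda>x. (a * f x + b * g x) * \<phi> x) = integral\<^sup>L lborel (\<lambda>x. a * (f x * \<phi> x) + b * (g x * \<phi> x))"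
      by (simp add: algebra_simps)
    also have "\<dots> = a * integral\<^sup>L lborel (\<lambda>x. f x * \<phi> x) + b * integral\<^sup>L lborel (\<lambda>x. g x * \<phi> x)"
      using I by simp
    finally show ?thesis using True by (simp add: dist_of_fun_def)
  qed (simp add: dist_of_fun_def)
qed

text \<open>The L1 norm of \<open>f\<close> bounds the functional by the supremum of
  \<open>\<phi>\<close>, a seminorm of order 0. Once temperedness is settled, only a missing Fourier
  transform or a divergent integral can keep such a distribution out of
  \<open>sobolev r\<close>.\<close>

lemma dist_of_fun_tempered:
  assumes f: "f \<in> test_functions UNIV"
  shows "dist_of_fun f \<in> tempered"
proof -
  have cont: "continuous_on UNIV \<phi>" if "\<phi> \<in> schwartz" for \<phi> :: "'a \<Rightarrow> complex"
    using that by (intro smooth_fun_continuous schwartz_smooth)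
  have I: "integrable lborel (\<lambda>x. f x * \<phi> x)" if "\<phi> \<in> schwartz" for \<phi>
    using f cont[OF that] by (rule test_function_mult_integrable)
  have I1: "integrable lborel f" using test_function_mult_integrable[OF f, of "\<lambda>_. 1"] by simp
  have lin: "dist_of_fun f (\<lambda>x. a * \<phi> x + b * \<psi> x) = a * dist_of_fun f \<phi> + b * dist_of_fun f \<psi>"
    if "\<phi> \<in> schwartz" "\<psi> \<in> schwartz" for \<phi> \<psi> a b
  proof -
    have "integral\<^sup>L lborel (\<lambda>x. f x * (a * \<phi> x + b * \<psi> x)) = integral\<^sup>L lborel (\<lambda>x. a * (f x * \<phi> x) + b * (f x * \<psi> x))"
      by (simp add: algebra_simps)
    also have "\<dots> = a * integral\<^sup>L lborel (\<lambda>x. f x * \<phi> x) + b * integral\<^sup>L lborel (\<lambda>x. f x * \<psi> x)"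
      using I that by simp
    finally show ?thesis using that by (simp add: dist_of_fun_def schwartz_lincomb)
  qed
  have bound: "cmod (dist_of_fun f \<phi>) \<le> integral\<^sup>L lborel (\<lambda>x. cmod (f x)) * B"
    if \<phi>: "\<phi> \<in> schwartz" and B: "schwartz_bound 0 \<phi> B" for \<phi> B
  proof -
    have B': "cmod (\<phi> x) \<le> B" for x using bspec[OF B[unfolded schwartz_bound_def], of "[]"] by simp
    have "cmod (dist_of_fun f \<phi>) \<le> integral\<^sup>L lborel (\<lambda>x. cmod (f x * \<phi> x))"
      using \<phi> by (simp add: dist_of_fun_def)
    also have "\<dots> \<le> integral\<^sup>L lborel (\<lambda>x. cmod (f x) * B)"
    proof (rule integral_mono)
      show "integrable lborel (\<lambda>x. cmod (f x * \<phi> x))" using I[OF \<phi>] by (rule integrable_norm)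
      show "integrable lborel (\<lambda>x. cmod (f x) * B)" using I1 by simp
      show "cmod (f x * \<phi> x) \<le> cmod (f x) * B" for x using B'[of x] by (simp add: norm_mult mult_left_mono)
    qed
    finally show ?thesis by simp
  qed
  have "\<exists>C N. \<forall>\<phi>\<in>schwartz. \<forall>B. schwartz_bound N \<phi> B \<longrightarrow> cmod (dist_of_fun f \<phi>) \<le> C * B"
    using bound by blast
  moreover have "\<forall>\<phi>. \<phi> \<notin> schwartz \<longrightarrow> dist_of_fun f \<phi> = 0" by (simp add: dist_of_fun_def)
  ultimately show ?thesis unfolding tempered_iff using lin by simp
qed

section \<open>Traces\<close>

text \<open>The supremum of an unbounded set of reals is one fixed default value, and so is that of
  the empty set. Neither keeps up with \<open>c * a\<close> as \<open>c\<close> grows.\<close>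

lemma Sup_linear_growth_imp_bdd:
  fixes X :: "real set"
  assumes a: "0 < a" and K: "0 \<le> K" and growth: "\<And>c. 0 < c \<Longrightarrow> c * a \<le> K * Sup ((*) c ` X)"
  shows "bdd_above X" "0 < Sup X" "X \<noteq> {}"
proof -
  have bounded_const: False if const: "\<And>c. 0 < c \<Longrightarrow> Sup ((*) c ` X) = \<sigma>" for \<sigma>
  proof -
    define c where "c = (\<bar>K * \<sigma>\<bar> + 1) / a"
    have "0 < c" using a by (simp add: c_def)
    from growth[OF this] const[OF this] have "c * a \<le> K * \<sigma>" by simp
    moreover have "c * a = \<bar>K * \<sigma>\<bar> + 1" using a by (simp add: c_def)
    ultimately show False by linarith
  qed
  show "bdd_above X"
  proof (rule ccontr)
    assume nb: "\<not> bdd_above X"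
    \<comment> \<open>No number bounds the scaled set, so the predicate under \<open>LEAST\<close>
      is constantly false, whatever \<open>c\<close> is.\<close>
    have "Sup ((*) c ` X) = (LEAST z::real. False)" if c: "0 < c" for c
    proof -
      have "\<not> (\<forall>x\<in>(*) c ` X. x \<le> z)" for z
      proof
        assume "\<forall>x\<in>(*) c ` X. x \<le> z"
        then have "\<forall>x\<in>X. x \<le> z / c" using c by (simp add: field_simps)
        with nb show False by (auto simp: bdd_above_def)
      qed
      then have "(\<lambda>z. \<forall>x\<in>(*) c ` X. x \<le> z) = (\<lambda>z. False)" by (intro ext) blast
      then show ?thesis unfolding Sup_real_def by (simp only:)
    qed
    with bounded_const show False by blast
  qed
  show "X \<noteq> {}" using bounded_const[of "Sup {}"] by auto
  have "a \<le> K * Sup X" using growth[of 1] by simp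
  with a K show "0 < Sup X" using mult_nonneg_nonpos[of K "Sup X"] by linarith
qed

lemma L2_norm_eq_0_inner:
  assumes f: "f \<in> L2 \<mu>" and g: "g \<in> L2 \<mu>" and 0: "L2_norm \<mu> g = 0"
  shows "L2_inner \<mu> f g = 0"
proof -
  have "(\<integral>x. (cmod (g x))\<^sup>2 \<partial>\<mu>) = 0" using 0 L2_norm_sq[of \<mu> g] by simp
  then have "AE x in \<mu>. (cmod (g x))\<^sup>2 = 0"
    by (subst integral_nonneg_eq_0_iff_AE[symmetric]) (auto simp: L2_integrable_sq[OF g])
  then have "AE x in \<mu>. f x * cnj (g x) = 0" by eventually_elim simp
  then show ?thesis unfolding L2_inner_def by (rule integral_eq_zero_AE)
qed

locale trace_setting =
  fixes t d r :: real and \<Gamma> :: "'a::euclidean_space set" and \<mu> :: "'a measure"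
  assumes r: "lift_exp t d \<Gamma> = r" and \<mu>: "hausdorff_on d \<Gamma> = \<mu>"
    and test_L2: "\<And>\<phi>. \<phi> \<in> test_functions UNIV \<Longrightarrow> \<phi> \<in> L2 \<mu>"
begin

text \<open>The premise in the definition of a trace. For a \<open>u\<close> without approximating
  sequences that definition is vacuous and every L2 function is a trace of \<open>u\<close>, a case
  that has to be excluded.\<close>

definition approximates :: "(nat \<Rightarrow> 'a \<Rightarrow> complex) \<Rightarrow> 'a dist \<Rightarrow> bool" where
  "approximates \<phi> u \<longleftrightarrow> (\<forall>j. \<phi> j \<in> test_functions UNIV) \<and>
     (\<lambda>j. sobolev_norm r (dist_diff (dist_of_fun (\<phi> j)) u)) \<longlonglongrightarrow> 0"

lemma is_trace_iff:
  "is_trace r d \<Gamma> u g \<longleftrightarrow> g \<in> L2 \<mu> \<and> (\<forall>\<phi>. approximates \<phi> u \<longrightarrow> (\<lambda>j. L2_norm \<mu> (\<lambda>x. \<phi> j x - g x)) \<longlonglongrightarrow> 0)"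
  by (simp add: is_trace_def approximates_def \<mu>)

lemma HH_iff: "g \<in> HH t d \<Gamma> \<longleftrightarrow> (\<exists>u\<in>sobolev r. is_trace r d \<Gamma> u g)"
  by (simp add: HH_def r)

lemma HH_L2: "g \<in> HH t d \<Gamma> \<Longrightarrow> g \<in> L2 \<mu>"
  by (auto simp: HH_iff is_trace_iff)

lemma HH_norm_le: "u \<in> sobolev r \<Longrightarrow> is_trace r d \<Gamma> u g \<Longrightarrow> HH_norm t d \<Gamma> g \<le> sobolev_norm r u"
  unfolding HH_norm_def r by (rule cInf_lower) (auto intro!: bdd_belowI[of _ 0] sobolev_norm_nonneg)

lemma HH_norm_nonneg: "g \<in> HH t d \<Gamma> \<Longrightarrow> 0 \<le> HH_norm t d \<Gamma> g"
  unfolding HH_norm_def r HH_iff by (rule cInf_greatest) (auto intro: sobolev_norm_nonneg)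

text \<open>A priori the norm in the definition of a trace could be a junk value, from a divergent integral or
  from a test function without a Fourier transform.  Such a value does not depend on the distribution
  that is approximated; if it were 0, all traces would vanish.\<close>

lemma approximates_eventually_sobolev:
  assumes nontriv: "g0 \<in> HH t d \<Gamma>" "L2_norm \<mu> g0 \<noteq> 0"
    and u: "u \<in> sobolev r" and \<phi>: "approximates \<phi> u"
  shows "eventually (\<lambda>j. dist_of_fun (\<phi> j) \<in> sobolev r) sequentially"
proof (rule ccontr)
  assume "\<not> ?thesis"
  then have freq: "frequently (\<lambda>j. dist_of_fun (\<phi> j) \<notin> sobolev r) sequentially"
    by (simp add: frequently_def)
  let ?\<F> = "\<lambda>u::'a dist. \<exists>g. has_fourier u g"
  \<comment> \<open>The Sobolev norm of any distribution without a Fourier transform: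
    \<open>dist_fourier\<close> is then a fixed arbitrary function.\<close>
  define \<kappa> where "\<kappa> = sqrt (integral\<^sup>L lborel (\<lambda>\<xi>::'a. (1 + (norm \<xi>)\<^sup>2) powr r * (cmod ((SOME g::'a \<Rightarrow> complex. False) \<xi>))\<^sup>2))"
  have \<kappa>: "0 \<le> \<kappa>" by (simp add: \<kappa>_def)
  \<comment> \<open>Subtracting a member of \<open>sobolev r\<close> affects neither the existence
    of a Fourier transform nor the divergence of the integral, so the value is the same for every
    \<open>v\<close>.\<close>
  have junk: "sobolev_norm r (dist_diff (dist_of_fun \<psi>) v) = (if ?\<F> (dist_of_fun \<psi>) then 0 else \<kappa>)"
    if \<psi>: "\<psi> \<in> test_functions UNIV" "dist_of_fun \<psi> \<notin> sobolev r" and v: "v \<in> sobolev r" for \<psi> v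
  proof -
    define w where "w = dist_diff (dist_of_fun \<psi>) v"
    have w: "w = dist_lincomb 1 (dist_of_fun \<psi>) (-1) v" by (simp add: w_def dist_diff_eq)
    have split: "dist_of_fun \<psi> = dist_lincomb 1 w 1 v" by (simp add: w)
    have hv: "has_fourier v (dist_fourier v)" and tv: "v \<in> tempered" using v by (simp_all add: sobolev_iff)
    have tw: "w \<in> tempered" unfolding w using dist_of_fun_tempered[OF \<psi>(1)] tv by (rule tempered_lincomb)
    have nw: "w \<notin> sobolev r"
    proof
      assume "w \<in> sobolev r"
      from sobolev_lincomb[OF this v, of 1 1] \<psi>(2) show False unfolding split by blast
    qed
    have "?\<F> (dist_of_fun \<psi>) \<longleftrightarrow> ?\<F> w"
    proof
      assume "?\<F> (dist_of_fun \<psi>)"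
      then obtain g where "has_fourier (dist_of_fun \<psi>) g" ..
      from has_fourier_lincomb[OF this hv, of 1 "-1"] show "?\<F> w"
        unfolding w by (rule exI[where x = "\<lambda>\<xi>. 1 * g \<xi> + (-1) * dist_fourier v \<xi>"])
    next
      assume "?\<F> w"
      then obtain g where "has_fourier w g" ..
      from has_fourier_lincomb[OF this hv, of 1 1] show "?\<F> (dist_of_fun \<psi>)"
        unfolding split by (rule exI[where x = "\<lambda>\<xi>. 1 * g \<xi> + 1 * dist_fourier v \<xi>"])
    qed
    moreover have "sobolev_norm r w = 0" if "?\<F> w"
    proof -
      have "has_fourier w (dist_fourier w)" using that by (auto intro: has_fourier_dist_fourier)
      then have "\<not> integrable lborel (\<lambda>\<xi>. (1 + (norm \<xi>)\<^sup>2) powr r * (cmod (dist_fourier w \<xi>))\<^sup>2)"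
        using nw tw by (auto simp: sobolev_def)
      then show ?thesis by (simp add: sobolev_norm_def not_integrable_integral_eq)
    qed
    moreover have "sobolev_norm r w = \<kappa>" if "\<not> ?\<F> w"
    proof -
      have "has_fourier w = (\<lambda>g. False)" using that by auto
      then show ?thesis by (simp add: sobolev_norm_def dist_fourier_def \<kappa>_def)
    qed
    ultimately show ?thesis by (simp add: w_def)
  qed
  have \<phi>T: "\<phi> j \<in> test_functions UNIV" for j using \<phi> by (simp add: approximates_def)
  \<comment> \<open>A test function whose junk distance to every member of \<open>sobolev r\<close>
    is 0. If \<open>\<kappa>\<close> is positive, late members of the sequence come closer than
    \<open>\<kappa>\<close>, so those outside \<open>sobolev r\<close> must have a Fourier
    transform.\<close>
  obtain \<psi> where \<psi>: "\<psi> \<in> test_functions UNIV" "dist_of_fun \<psi> \<notin> sobolev r"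
    and triv: "?\<F> (dist_of_fun \<psi>) \<or> \<kappa> = 0"
  proof (cases "\<kappa> = 0")
    case True
    obtain j where "dist_of_fun (\<phi> j) \<notin> sobolev r" using frequently_ex[OF freq] by blast
    with that[OF \<phi>T] True show ?thesis by blast
  next
    case False
    with \<kappa> have "0 < \<kappa>" by simp
    moreover have "(\<lambda>j. sobolev_norm r (dist_diff (dist_of_fun (\<phi> j)) u)) \<longlonglongrightarrow> 0" using \<phi> by (simp add: approximates_def)
    ultimately have "eventually (\<lambda>j. sobolev_norm r (dist_diff (dist_of_fun (\<phi> j)) u) < \<kappa>) sequentially"
      by (rule order_tendstoD(2)[rotated])
    with freq have "frequently (\<lambda>j. sobolev_norm r (dist_diff (dist_of_fun (\<phi> j)) u) < \<kappa> \<and> dist_of_fun (\<phi> j) \<notin> sobolev r) sequentially"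
      by (rule frequently_rev_mp[OF _ eventually_mono]) auto
    then obtain j where j: "sobolev_norm r (dist_diff (dist_of_fun (\<phi> j)) u) < \<kappa>" "dist_of_fun (\<phi> j) \<notin> sobolev r"
      by (auto dest: frequently_ex)
    then have "?\<F> (dist_of_fun (\<phi> j))" using junk[OF \<phi>T j(2) u] by (auto split: if_splits)
    with that[OF \<phi>T j(2)] show ?thesis by blast
  qed
  obtain u0 where u0: "u0 \<in> sobolev r" "is_trace r d \<Gamma> u0 g0" using nontriv(1) by (auto simp: HH_iff)
  have g0: "g0 \<in> L2 \<mu>" using u0(2) by (simp add: is_trace_iff)
  \<comment> \<open>The constant sequence \<open>c * \<psi>\<close> approximates \<open>u0\<close>,
    so every nonzero multiple of \<open>\<psi>\<close> has distance 0 from \<open>g0\<close> on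
    \<open>\<Gamma>\<close>.\<close>
  have const: "L2_norm \<mu> (\<lambda>x. c * \<psi> x - g0 x) = 0" if c: "c \<noteq> 0" for c
  proof -
    have T: "(\<lambda>x. c * \<psi> x) \<in> test_functions UNIV" using test_functions_lincomb[OF \<psi>(1) \<psi>(1), of c 0] by simp
    have eq: "dist_of_fun (\<lambda>x. c * \<psi> x) = (\<lambda>\<phi>. c * dist_of_fun \<psi> \<phi>)"
      using dist_of_fun_lincomb[OF \<psi>(1) \<psi>(1), of c 0] by simp
    have inv: "dist_of_fun \<psi> = (\<lambda>\<phi>. (1 / c) * dist_of_fun (\<lambda>x. c * \<psi> x) \<phi>)" using c by (simp add: eq)
    have ns: "dist_of_fun (\<lambda>x. c * \<psi> x) \<notin> sobolev r"
    proof
      assume "dist_of_fun (\<lambda>x. c * \<psi> x) \<in> sobolev r"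
      from sobolev_cmult[OF this, of "1 / c"] \<psi>(2) show False unfolding inv[symmetric] by blast
    qed
    have "?\<F> (dist_of_fun (\<lambda>x. c * \<psi> x))" if "?\<F> (dist_of_fun \<psi>)"
      using that has_fourier_lincomb[of "dist_of_fun \<psi>" _ "dist_of_fun \<psi>" _ c 0] unfolding eq by auto
    then have "sobolev_norm r (dist_diff (dist_of_fun (\<lambda>x. c * \<psi> x)) u0) = 0"
      using junk[OF T ns u0(1)] triv by (auto split: if_splits)
    then have "approximates (\<lambda>j x. c * \<psi> x) u0" using T by (simp add: approximates_def)
    then have "(\<lambda>j::nat. L2_norm \<mu> (\<lambda>x. c * \<psi> x - g0 x)) \<longlonglongrightarrow> 0" using u0(2) by (simp add: is_trace_iff)
    then show ?thesis by (simp only: LIMSEQ_const_iff)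
  qed
  have L: "(\<lambda>x. c * \<psi> x - g0 x) \<in> L2 \<mu>" for c
    using L2_lincomb[OF test_L2[OF \<psi>(1)] g0, of c "-1"] by simp
  \<comment> \<open>-2 (\<psi> - g0) + (2 \<psi> - g0) is \<open>g0\<close>, which therefore has
    norm 0.\<close>
  have "(L2_norm \<mu> (\<lambda>x. (-2) * (1 * \<psi> x - g0 x) + 1 * (2 * \<psi> x - g0 x)))\<^sup>2 \<le> 0"
    using L2_norm_lincomb_sq_le[OF L[of 1] L[of 2], of "-2" 1] const[of 1] const[of 2] by simp
  then have "L2_norm \<mu> g0 = 0" by simp
  with nontriv(2) show False by simp
qed

lemma tendsto_0_if_sq_le_lincomb:
  assumes "eventually (\<lambda>j. (N j)\<^sup>2 \<le> a * (F j)\<^sup>2 + b * (G j)\<^sup>2) sequentially" "F \<longlonglongrightarrow> (0::real)" "G \<longlonglongrightarrow> 0"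
  shows "N \<longlonglongrightarrow> 0"
proof -
  have "(\<lambda>j. a * (F j)\<^sup>2 + b * (G j)\<^sup>2) \<longlonglongrightarrow> a * 0\<^sup>2 + b * 0\<^sup>2" using assms by (intro tendsto_intros)
  then have lim: "(\<lambda>j. a * (F j)\<^sup>2 + b * (G j)\<^sup>2) \<longlonglongrightarrow> 0" by simp
  have "(\<lambda>j. (N j)\<^sup>2) \<longlonglongrightarrow> 0"
    by (rule tendsto_sandwich[OF _ assms(1) tendsto_const lim]) simp
  then show ?thesis by simp
qed

lemma sobolev_norm_tendsto_0_lincomb:
  assumes "eventually (\<lambda>j. u j \<in> sobolev r) sequentially" "eventually (\<lambda>j. v j \<in> sobolev r) sequentially"
    and "(\<lambda>j. sobolev_norm r (u j)) \<longlonglongrightarrow> 0" "(\<lambda>j. sobolev_norm r (v j)) \<longlonglongrightarrow> 0"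
  shows "(\<lambda>j. sobolev_norm r (dist_lincomb a (u j) b (v j))) \<longlonglongrightarrow> 0"
proof (rule tendsto_0_if_sq_le_lincomb[OF _ assms(3,4)])
  show "eventually (\<lambda>j. (sobolev_norm r (dist_lincomb a (u j) b (v j)))\<^sup>2
      \<le> 2 * (cmod a)\<^sup>2 * (sobolev_norm r (u j))\<^sup>2 + 2 * (cmod b)\<^sup>2 * (sobolev_norm r (v j))\<^sup>2) sequentially"
    using assms(1,2) by eventually_elim (rule sobolev_norm_lincomb_sq_le)
qed

lemma L2_norm_tendsto_0_lincomb:
  assumes "\<And>j. f j \<in> L2 \<mu>" "\<And>j. g j \<in> L2 \<mu>"
    and "(\<lambda>j. L2_norm \<mu> (f j)) \<longlonglongrightarrow> 0" "(\<lambda>j. L2_norm \<mu> (g j)) \<longlonglongrightarrow> 0"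
  shows "(\<lambda>j. L2_norm \<mu> (\<lambda>x. a * f j x + b * g j x)) \<longlonglongrightarrow> 0"
  by (rule tendsto_0_if_sq_le_lincomb[OF always_eventually[OF allI] assms(3,4)])
     (rule L2_norm_lincomb_sq_le[OF assms(1,2)])

text \<open>The norm inequality for combinations holds inside \<open>sobolev r\<close>. The
  differences belong to it for large \<open>j\<close> by
  \<open>approximates_eventually_sobolev\<close>, which suffices for a limit.\<close>

lemma approximates_lincomb:
  assumes nontriv: "g0 \<in> HH t d \<Gamma>" "L2_norm \<mu> g0 \<noteq> 0"
    and u: "u \<in> sobolev r" "approximates \<phi> u" and v: "v \<in> sobolev r" "approximates \<psi> v"
  shows "approximates (\<lambda>j x. a * \<phi> j x + b * \<psi> j x) (dist_lincomb a u b v)"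
proof -
  have T: "\<phi> j \<in> test_functions UNIV" "\<psi> j \<in> test_functions UNIV" for j
    using u v by (simp_all add: approximates_def)
  have eq: "dist_diff (dist_of_fun (\<lambda>x. a * \<phi> j x + b * \<psi> j x)) (dist_lincomb a u b v)
      = dist_lincomb a (dist_diff (dist_of_fun (\<phi> j)) u) b (dist_diff (dist_of_fun (\<psi> j)) v)" for j
    unfolding dist_of_fun_lincomb[OF T] by (simp add: dist_diff_def algebra_simps)
  have diff: "eventually (\<lambda>j. dist_diff (dist_of_fun (\<phi> j)) u \<in> sobolev r) sequentially"
    if "u \<in> sobolev r" "approximates \<phi> u" for u \<phi>
    using approximates_eventually_sobolev[OF nontriv that]
    unfolding dist_diff_eq by eventually_elim (rule sobolev_lincomb[OF _ that(1)])
  have "(\<lambda>j. sobolev_norm r (dist_diff (dist_of_fun (\<lambda>x. a * \<phi> j x + b * \<psi> j x)) (dist_lincomb a u b v))) \<longlonglongrightarrow> 0"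
    unfolding eq using diff[OF u] diff[OF v] u(2) v(2)
    by (intro sobolev_norm_tendsto_0_lincomb) (auto simp: approximates_def)
  then show ?thesis using test_functions_lincomb[OF T] by (simp add: approximates_def)
qed

text \<open>If \<open>u\<close> had no approximating sequence, neither would its multiple
  \<open>c u\<close> of norm at most 1. Every L2 function would be a trace of \<open>c u\<close>, so
  all multiples of \<open>f\<close> would lie in the unit ball of the trace space, where their
  pairings with \<open>f\<close> are unbounded.\<close>

lemma ex_approximates:
  assumes f: "f \<in> L2 \<mu>" "L2_norm \<mu> f \<noteq> 0"
    and nontriv: "g0 \<in> HH t d \<Gamma>" "L2_norm \<mu> g0 \<noteq> 0"
    and bdd: "bdd_above {cmod (L2_inner \<mu> f g) | g. g \<in> HH t d \<Gamma> \<and> HH_norm t d \<Gamma> g \<le> 1}"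
    and u: "u \<in> sobolev r"
  shows "\<exists>\<phi>. approximates \<phi> u"
proof (rule ccontr)
  assume none: "\<nexists>\<phi>. approximates \<phi> u"
  \<comment> \<open>Adding 1 covers the case of norm 0.\<close>
  define c where "c = complex_of_real (1 / (sobolev_norm r u + 1))"
  have pos: "0 < sobolev_norm r u + 1" using sobolev_norm_nonneg[of r u] by simp
  then have c: "c \<noteq> 0" "cmod c = 1 / (sobolev_norm r u + 1)" unfolding c_def of_real_eq_0_iff norm_of_real by simp_all
  have cu: "(\<lambda>\<psi>. c * u \<psi>) \<in> sobolev r" using u by (rule sobolev_cmult)
  have "\<not> approximates \<phi> (\<lambda>\<psi>. c * u \<psi>)" for \<phi>
  proof
    assume "approximates \<phi> (\<lambda>\<psi>. c * u \<psi>)"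
    from approximates_lincomb[OF nontriv cu this cu this, of "1 / c" 0] c(1)
    have "approximates (\<lambda>j x. 1 / c * \<phi> j x) u" by simp
    with none show False by blast
  qed
  then have tr: "is_trace r d \<Gamma> (\<lambda>\<psi>. c * u \<psi>) g" if "g \<in> L2 \<mu>" for g using that by (simp add: is_trace_iff)
  have "sobolev_norm r (\<lambda>\<psi>. c * u \<psi>) \<le> 1"
    using sobolev_norm_nonneg[of r u] pos by (simp add: sobolev_norm_cmult[OF u] c(2) field_simps)
  then have norm1: "HH_norm t d \<Gamma> g \<le> 1" if "g \<in> L2 \<mu>" for g
    using HH_norm_le[OF cu tr[OF that]] by simp
  obtain B where B: "\<And>g. g \<in> HH t d \<Gamma> \<Longrightarrow> HH_norm t d \<Gamma> g \<le> 1 \<Longrightarrow> cmod (L2_inner \<mu> f g) \<le> B"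
    using bdd by (auto simp: bdd_above_def)
  have "real m * (L2_norm \<mu> f)\<^sup>2 \<le> B" for m
  proof -
    have g: "(\<lambda>x. complex_of_real (real m) * f x) \<in> L2 \<mu>" using f(1) by (rule L2_cmult)
    then have "cmod (L2_inner \<mu> f (\<lambda>x. complex_of_real (real m) * f x)) \<le> B"
      using tr[OF g] cu norm1[OF g] by (intro B) (auto simp: HH_iff)
    then show ?thesis unfolding L2_inner_cmult_right L2_inner_self by (simp add: norm_mult norm_power)
  qed
  moreover obtain m where "B < real m * (L2_norm \<mu> f)\<^sup>2"
    using reals_Archimedean3[of "(L2_norm \<mu> f)\<^sup>2"] f(2) by auto
  ultimately show False by (meson not_less)
qed

text \<open>For \<open>\<phi> j\<close> converging to \<open>a u + b v\<close> and approximations \<open>\<alpha> j\<close>, \<open>\<beta> j\<close> of \<open>u\<close> and \<open>v\<close>, the error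
  \<open>\<phi> j - a \<alpha> j - b \<beta> j\<close> can be added to \<open>\<alpha> j\<close>, so it is negligible on \<open>\<Gamma>\<close> because \<open>u\<close> has a trace.\<close>

lemma is_trace_lincomb:
  assumes nontriv: "g0 \<in> HH t d \<Gamma>" "L2_norm \<mu> g0 \<noteq> 0"
    and appr: "\<And>u. u \<in> sobolev r \<Longrightarrow> \<exists>\<phi>. approximates \<phi> u"
    and u: "u \<in> sobolev r" "is_trace r d \<Gamma> u f" and v: "v \<in> sobolev r" "is_trace r d \<Gamma> v g"
  shows "is_trace r d \<Gamma> (dist_lincomb a u b v) (\<lambda>x. a * f x + b * g x)"
  unfolding is_trace_iff
proof (intro conjI allI impI)
  have f: "f \<in> L2 \<mu>" and g: "g \<in> L2 \<mu>" using u v by (simp_all add: is_trace_iff)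
  then show "(\<lambda>x. a * f x + b * g x) \<in> L2 \<mu>" by (rule L2_lincomb)
  fix \<phi> assume \<phi>: "approximates \<phi> (dist_lincomb a u b v)"
  obtain \<alpha> \<beta> where \<alpha>: "approximates \<alpha> u" and \<beta>: "approximates \<beta> v" using appr u(1) v(1) by metis
  have TL: "\<psi> j \<in> L2 \<mu>" if "approximates \<psi> w" for \<psi> w j
    using that by (intro test_L2) (simp add: approximates_def)
  define \<gamma> where "\<gamma> j x = a * \<alpha> j x + b * \<beta> j x" for j x
  have \<gamma>: "approximates \<gamma> (dist_lincomb a u b v)"
    unfolding \<gamma>_def[abs_def] by (rule approximates_lincomb[OF nontriv u(1) \<alpha> v(1) \<beta>])
  note w = sobolev_lincomb[OF u(1) v(1), of a b]
  \<comment> \<open>\<open>\<delta>\<close> approximates the zero distribution, so adding it to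
    \<open>\<alpha>\<close> leaves an approximation of \<open>u\<close>.\<close>
  define \<delta> where "\<delta> j x = 1 * \<phi> j x + (-1) * \<gamma> j x" for j x
  have \<delta>: "approximates \<delta> (dist_lincomb 1 (dist_lincomb a u b v) (-1) (dist_lincomb a u b v))"
    unfolding \<delta>_def[abs_def] by (rule approximates_lincomb[OF nontriv w \<phi> w \<gamma>])
  have "approximates (\<lambda>j x. 1 * \<alpha> j x + 1 * \<delta> j x)
      (dist_lincomb 1 u 1 (dist_lincomb 1 (dist_lincomb a u b v) (-1) (dist_lincomb a u b v)))"
    by (rule approximates_lincomb[OF nontriv u(1) \<alpha> sobolev_lincomb[OF w w] \<delta>])
  then have "approximates (\<lambda>j x. 1 * \<alpha> j x + 1 * \<delta> j x) u" by simp
  then have 1: "(\<lambda>j. L2_norm \<mu> (\<lambda>x. 1 * \<alpha> j x + 1 * \<delta> j x - f x)) \<longlonglongrightarrow> 0" using u(2) unfolding is_trace_iff by blast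
  have 2: "(\<lambda>j. L2_norm \<mu> (\<lambda>x. \<alpha> j x - f x)) \<longlonglongrightarrow> 0" using \<alpha> u(2) unfolding is_trace_iff by blast
  have 3: "(\<lambda>j. L2_norm \<mu> (\<lambda>x. \<beta> j x - g x)) \<longlonglongrightarrow> 0" using \<beta> v(2) unfolding is_trace_iff by blast
  have sub: "(\<lambda>x. p x - q x) \<in> L2 \<mu>" if "p \<in> L2 \<mu>" "q \<in> L2 \<mu>" for p q
    using L2_lincomb[OF that, of 1 "-1"] by simp
  have L: "(\<lambda>x. 1 * \<alpha> j x + 1 * \<delta> j x - f x) \<in> L2 \<mu>" "(\<lambda>x. \<alpha> j x - f x) \<in> L2 \<mu>" "(\<lambda>x. \<beta> j x - g x) \<in> L2 \<mu>" for j
    using L2_lincomb[OF TL[OF \<alpha>] TL[OF \<delta>]] by (intro sub f g TL[OF \<alpha>] TL[OF \<beta>]; blast)+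
  \<comment> \<open>(\<alpha> + \<delta> - f) + (a - 1) (\<alpha> - f) + b (\<beta> - g) equals
    \<phi> - (a f + b g).\<close>
  have "(\<lambda>j. L2_norm \<mu> (\<lambda>x. 1 * (1 * \<alpha> j x + 1 * \<delta> j x - f x) + (a - 1) * (\<alpha> j x - f x))) \<longlonglongrightarrow> 0"
    by (rule L2_norm_tendsto_0_lincomb[OF L(1,2) 1 2])
  from L2_norm_tendsto_0_lincomb[OF L2_lincomb[OF L(1,2)] L(3) this 3, of 1 b]
  show "(\<lambda>j. L2_norm \<mu> (\<lambda>x. \<phi> j x - (a * f x + b * g x))) \<longlonglongrightarrow> 0"
    by (simp add: \<delta>_def \<gamma>_def algebra_simps)
qed

text \<open>The hypothesis on all positive multiples of \<open>f\<close> bounds its pairings with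
  the unit ball. A positive supremum also yields a trace \<open>g0\<close> of nonzero norm, on which
  the linearity of traces depends. Linearity then allows the rescaling that turns the bound on the
  ball into a bound by the norm.\<close>

lemma L2_embed_dual:
  assumes f: "f \<in> L2 \<mu>" "0 < L2_norm \<mu> f" and K: "0 \<le> K"
    and inverse: "\<And>c. 0 < c \<Longrightarrow> c * L2_norm \<mu> f \<le> K * HH_dual_norm t d \<Gamma> (L2_embed t d \<Gamma> (\<lambda>x. complex_of_real c * f x))"
  shows "L2_embed t d \<Gamma> f \<in> HH_dual t d \<Gamma>"
proof -
  define X where "X = {cmod (L2_inner \<mu> f g) | g. g \<in> HH t d \<Gamma> \<and> HH_norm t d \<Gamma> g \<le> 1}"
  have "HH_dual_norm t d \<Gamma> (L2_embed t d \<Gamma> (\<lambda>x. complex_of_real c * f x)) = Sup ((*) c ` X)" if "0 < c" for c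
  proof -
    have "{cmod (L2_embed t d \<Gamma> (\<lambda>x. complex_of_real c * f x) g) | g. g \<in> HH t d \<Gamma> \<and> HH_norm t d \<Gamma> g \<le> 1} = (*) c ` X"
      using that by (force simp: X_def L2_embed_def \<mu> L2_inner_cmult_left norm_mult)
    then show ?thesis by (simp add: HH_dual_norm_def)
  qed
  then have X: "bdd_above X" "0 < Sup X" "X \<noteq> {}"
    using Sup_linear_growth_imp_bdd[OF f(2) K, of X] inverse by simp_all
  have fn: "L2_norm \<mu> f \<noteq> 0" using f(2) by simp
  obtain g0 where g0: "g0 \<in> HH t d \<Gamma>" "L2_norm \<mu> g0 \<noteq> 0"
  proof (rule ccontr)
    assume "\<not> thesis"
    then have all0: "L2_norm \<mu> g = 0" if "g \<in> HH t d \<Gamma>" for g using that \<open>\<And>g0. g0 \<in> HH t d \<Gamma> \<Longrightarrow> L2_norm \<mu> g0 \<noteq> 0 \<Longrightarrow> thesis\<close> by blast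
    have "X \<subseteq> {0}" unfolding X_def using L2_norm_eq_0_inner[OF f(1) HH_L2] all0 by auto
    with X(3) have "X = {0}" by blast
    with X(2) show False by simp
  qed
  have appr: "\<exists>\<phi>. approximates \<phi> u" if "u \<in> sobolev r" for u
    by (rule ex_approximates[OF f(1) fn g0 X(1)[unfolded X_def] that])
  have lin: "is_trace r d \<Gamma> (dist_lincomb a u b v) (\<lambda>x. a * g x + b * h x)"
    if "u \<in> sobolev r" "is_trace r d \<Gamma> u g" "v \<in> sobolev r" "is_trace r d \<Gamma> v h" for a b u v g h
    by (rule is_trace_lincomb[OF g0 appr that])
  have HH_lin: "(\<lambda>x. a * g x + b * h x) \<in> HH t d \<Gamma>" if "g \<in> HH t d \<Gamma>" "h \<in> HH t d \<Gamma>" for a b g h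
    using that lin sobolev_lincomb unfolding HH_iff by blast
  obtain B where B: "\<And>g. g \<in> HH t d \<Gamma> \<Longrightarrow> HH_norm t d \<Gamma> g \<le> 1 \<Longrightarrow> cmod (L2_inner \<mu> f g) \<le> B"
    using X(1) by (auto simp: bdd_above_def X_def)
  have bound: "cmod (L2_inner \<mu> f g) \<le> B * HH_norm t d \<Gamma> g" if g: "g \<in> HH t d \<Gamma>" for g
  proof (rule field_le_epsilon)
    fix e :: real assume e: "0 < e"
    \<comment> \<open>The norm of \<open>g\<close> may be 0 and its infimum need not be attained, so
      the scaling uses the norm plus \<open>\<eta>\<close>; with |B| + 1 in the denominator the loss
      \<open>B * \<eta>\<close> is at most \<open>e\<close>.\<close>
    define \<eta> where "\<eta> = e / (\<bar>B\<bar> + 1)"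
    have \<eta>: "0 < \<eta>" using e by (simp add: \<eta>_def)
    define S where "S = {sobolev_norm r u | u. u \<in> sobolev r \<and> is_trace r d \<Gamma> u g}"
    have "Inf S < HH_norm t d \<Gamma> g + \<eta>" using \<eta> by (simp add: HH_norm_def r S_def)
    moreover have "S \<noteq> {}" using g by (auto simp: S_def HH_iff)
    ultimately obtain u where u: "u \<in> sobolev r" "is_trace r d \<Gamma> u g" "sobolev_norm r u < HH_norm t d \<Gamma> g + \<eta>"
      using cInf_lessD[of S] by (auto simp: S_def)
    define \<nu> where "\<nu> = HH_norm t d \<Gamma> g + \<eta>"
    have \<nu>: "0 < \<nu>" using HH_norm_nonneg[OF g] \<eta> by (simp add: \<nu>_def)
    define c where "c = complex_of_real (1 / \<nu>)"
    have c: "cmod c = 1 / \<nu>" using \<nu> unfolding c_def norm_of_real by simp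
    have tr: "is_trace r d \<Gamma> (\<lambda>\<psi>. c * u \<psi>) (\<lambda>x. c * g x)" using lin[OF u(1,2) u(1,2), of c 0] by simp
    have "sobolev_norm r (\<lambda>\<psi>. c * u \<psi>) \<le> 1"
      using u(3) \<nu> by (simp add: sobolev_norm_cmult[OF u(1)] c \<nu>_def[symmetric])
    then have "cmod (L2_inner \<mu> f (\<lambda>x. c * g x)) \<le> B"
      using HH_norm_le[OF sobolev_cmult[OF u(1)] tr] tr sobolev_cmult[OF u(1)] by (intro B) (auto simp: HH_iff)
    then have "cmod (L2_inner \<mu> f g) \<le> B * \<nu>"
      unfolding L2_inner_cmult_right using \<nu> by (simp add: norm_mult c field_simps)
    also have "\<dots> \<le> B * HH_norm t d \<Gamma> g + e"
    proof -
      have "B * \<eta> \<le> (\<bar>B\<bar> + 1) * \<eta>" using \<eta> by (intro mult_right_mono) auto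
      also have "\<dots> = e" by (simp add: \<eta>_def)
      finally show ?thesis by (simp add: \<nu>_def distrib_left)
    qed
    finally show "cmod (L2_inner \<mu> f g) \<le> B * HH_norm t d \<Gamma> g + e" .
  qed
  show ?thesis unfolding HH_dual_def
  proof (intro CollectI conjI ballI allI impI)
    show "\<exists>C. \<forall>g\<in>HH t d \<Gamma>. cmod (L2_embed t d \<Gamma> f g) \<le> C * HH_norm t d \<Gamma> g"
      using bound by (auto simp: L2_embed_def \<mu>)
  qed (auto simp: L2_embed_def \<mu> HH_lin L2_inner_lincomb_right HH_L2 f(1))
qed

end

section \<open>Matrix norms and Galerkin matrices\<close>

lemma vec_norm2_nonneg: "0 \<le> vec_norm2 v"
  by (simp add: vec_norm2_def sum_nonneg)

lemma vec_norm2_sq: "(vec_norm2 v)\<^sup>2 = (\<Sum>i<dim_vec v. (cmod (vec_index v i))\<^sup>2)"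
  by (simp add: vec_norm2_def sum_nonneg)

lemma vec_norm2_eq_0: "vec_norm2 v = 0 \<Longrightarrow> v = 0\<^sub>v (dim_vec v)"
  by (rule eq_vecI) (auto simp: vec_norm2_def sum_nonneg_eq_0_iff)

lemma cscalar_prod_le_vec_norm2:
  assumes "dim_vec v = dim_vec w"
  shows "cmod (v \<bullet>c w) \<le> vec_norm2 v * vec_norm2 w"
proof -
  have "cmod (v \<bullet>c w) \<le> (\<Sum>i<dim_vec w. cmod (vec_index v i) * cmod (vec_index w i))"
    unfolding scalar_prod_def by (rule order_trans[OF norm_sum]) (simp add: norm_mult atLeast0LessThan)
  also have "\<dots> \<le> L2_set (\<lambda>i. cmod (vec_index v i)) {..<dim_vec w} * L2_set (\<lambda>i. cmod (vec_index w i)) {..<dim_vec w}"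
    using L2_set_mult_ineq[of "\<lambda>i. cmod (vec_index v i)" "\<lambda>i. cmod (vec_index w i)" "{..<dim_vec w}"] by simp
  also have "\<dots> = vec_norm2 v * vec_norm2 w" using assms by (simp add: vec_norm2_def L2_set_def)
  finally show ?thesis .
qed

lemma mat_norm2_le:
  assumes "\<And>v. v \<in> carrier_vec (dim_col A) \<Longrightarrow> vec_norm2 v \<le> 1 \<Longrightarrow> vec_norm2 (A *\<^sub>v v) \<le> C"
  shows "mat_norm2 A \<le> C"
  unfolding mat_norm2_def
proof (rule cSup_least)
  have "vec_norm2 (0\<^sub>v (dim_col A)) \<le> 1" by (simp add: vec_norm2_def)
  then show "{vec_norm2 (A *\<^sub>v v) | v. v \<in> carrier_vec (dim_col A) \<and> vec_norm2 v \<le> 1} \<noteq> {}"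
    using zero_carrier_vec[of "dim_col A"] by blast
qed (use assms in auto)

text \<open>The lower bound makes the kernel trivial and the determinant nonzero. For w = B v,
  Cauchy-Schwarz gives c |w|^2 <= |v| |w|, and one factor |w| cancels unless it is 0.\<close>

lemma inverse_bound_of_coercive:
  fixes A :: "complex Matrix.mat"
  assumes A: "A \<in> carrier_mat N N" and c: "0 < c"
    and coercive: "\<And>a. a \<in> carrier_vec N \<Longrightarrow> c * (vec_norm2 a)\<^sup>2 \<le> cmod ((A *\<^sub>v a) \<bullet>c a)"
  shows "\<exists>B\<in>carrier_mat N N. A * B = 1\<^sub>m N \<and> B * A = 1\<^sub>m N \<and> mat_norm2 B \<le> inverse c"
proof -
  have "\<not> (\<exists>v. v \<in> carrier_vec N \<and> v \<noteq> 0\<^sub>v N \<and> A *\<^sub>v v = 0\<^sub>v N)"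
  proof safe
    fix v assume v: "v \<in> carrier_vec N" and ne: "v \<noteq> 0\<^sub>v N" and Av: "A *\<^sub>v v = 0\<^sub>v N"
    have "c * (vec_norm2 v)\<^sup>2 \<le> 0" using coercive[OF v] v unfolding Av by (simp add: scalar_prod_def)
    then have "vec_norm2 v = 0" using c by (simp add: mult_le_0_iff)
    then show False using vec_norm2_eq_0[of v] v ne by auto
  qed
  then have "A \<in> Units (ring_mat TYPE(complex) N ())"
    unfolding det_0_iff_vec_prod_zero[OF A, symmetric] by (rule det_non_zero_imp_unit[OF A])
  then obtain B where B: "B \<in> carrier_mat N N" "A * B = 1\<^sub>m N" "B * A = 1\<^sub>m N"
    by (auto simp: Units_def ring_mat_def)
  have "mat_norm2 B \<le> inverse c"
  proof (rule mat_norm2_le)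
    fix v assume "v \<in> carrier_vec (dim_col B)" and v1: "vec_norm2 v \<le> 1"
    then have v: "v \<in> carrier_vec N" using B by auto
    define w where "w = B *\<^sub>v v"
    have w: "w \<in> carrier_vec N" using B v by (simp add: w_def)
    have Aw: "A *\<^sub>v w = v"
      unfolding w_def assoc_mult_mat_vec[OF A B(1) v, symmetric] B(2) using v by simp
    have "c * (vec_norm2 w)\<^sup>2 \<le> vec_norm2 v * vec_norm2 w"
      using coercive[OF w] cscalar_prod_le_vec_norm2[of v w] v w unfolding Aw by auto
    also have "\<dots> \<le> 1 * vec_norm2 w" using v1 vec_norm2_nonneg by (rule mult_right_mono)
    finally have "c * vec_norm2 w * vec_norm2 w \<le> 1 * vec_norm2 w" by (simp add: power2_eq_square mult.assoc)
    then have "c * vec_norm2 w \<le> 1" if "vec_norm2 w \<noteq> 0"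
      using that vec_norm2_nonneg[of w] by (simp add: mult_le_cancel_right)
    then have "c * vec_norm2 w \<le> 1" by (cases "vec_norm2 w = 0") auto
    then show "vec_norm2 (B *\<^sub>v v) \<le> inverse c" using c by (simp add: w_def field_simps)
  qed
  with B show ?thesis by blast
qed

section \<open>Compressions of operators and sums in sesquilinear forms\<close>

lemma L2_bounded_operator_lincomb:
  assumes "L2_bounded_operator \<mu> T" "f \<in> L2 \<mu>" "g \<in> L2 \<mu>"
  shows "AE x in \<mu>. T (\<lambda>y. a * f y + b * g y) x = a * T f x + b * T g x"
  using assms unfolding L2_bounded_operator_def by simp

lemma L2_bounded_operator_sum:
  assumes T: "L2_bounded_operator \<mu> T" and I: "finite I" and f: "\<And>i. i \<in> I \<Longrightarrow> f i \<in> L2 \<mu>"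
  shows "AE x in \<mu>. T (\<lambda>y. \<Sum>i\<in>I. c i * f i y) x = (\<Sum>i\<in>I. c i * T (f i) x)"
  using I f
proof (induction I rule: finite_induct)
  case empty
  show ?case using L2_bounded_operator_lincomb[OF T L2_zero L2_zero, of 0 0] by simp
next
  case (insert i I)
  have "AE x in \<mu>. T (\<lambda>y. c i * f i y + 1 * (\<Sum>i\<in>I. c i * f i y)) x
      = c i * T (f i) x + 1 * T (\<lambda>y. \<Sum>i\<in>I. c i * f i y) x"
    using insert.prems by (intro L2_bounded_operator_lincomb[OF T] L2_sum) auto
  moreover have "AE x in \<mu>. T (\<lambda>y. \<Sum>i\<in>I. c i * f i y) x = (\<Sum>i\<in>I. c i * T (f i) x)"
    using insert by blast
  ultimately show ?case by eventually_elim (use insert in simp)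
qed

lemma L2_op_norm_bound:
  assumes T: "L2_bounded_operator \<mu> T" and f: "f \<in> L2 \<mu>" "L2_norm \<mu> f \<le> 1"
  shows "L2_norm \<mu> (T f) \<le> L2_op_norm \<mu> T"
  unfolding L2_op_norm_def
proof (rule cSup_upper)
  obtain C where C: "\<And>f. f \<in> L2 \<mu> \<Longrightarrow> L2_norm \<mu> (T f) \<le> C * L2_norm \<mu> f"
    using T unfolding L2_bounded_operator_def by blast
  have "L2_norm \<mu> (T f) \<le> \<bar>C\<bar>" if "f \<in> L2 \<mu>" "L2_norm \<mu> f \<le> 1" for f
  proof -
    have "C * L2_norm \<mu> f \<le> \<bar>C\<bar> * 1"
      using that L2_norm_nonneg[of \<mu> f] by (intro mult_mono) auto
    then show ?thesis using C[OF that(1)] by simp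
  qed
  then show "bdd_above {L2_norm \<mu> (T f) | f. f \<in> L2 \<mu> \<and> L2_norm \<mu> f \<le> 1}" by (auto simp: bdd_above_def)
qed (use f in auto)

lemma mat_norm2_compression_le:
  assumes T: "L2_bounded_operator \<mu> T" and f: "\<And>i. i < N \<Longrightarrow> f i \<in> L2 \<mu>"
    and orth: "\<And>i j. i < N \<Longrightarrow> j < N \<Longrightarrow> L2_inner \<mu> (f i) (f j) = (if i = j then 1 else 0)"
  shows "mat_norm2 (Matrix.mat N N (\<lambda>(i, j). L2_inner \<mu> (T (f j)) (f i))) \<le> L2_op_norm \<mu> T"
proof (rule mat_norm2_le)
  let ?A = "Matrix.mat N N (\<lambda>(i, j). L2_inner \<mu> (T (f j)) (f i))"
  fix v :: "complex Matrix.vec" assume "v \<in> carrier_vec (dim_col ?A)" and v1: "vec_norm2 v \<le> 1"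
  then have v: "dim_vec v = N" by simp
  define F where "F y = (\<Sum>j<N. vec_index v j * f j y)" for y
  \<comment> \<open>\<open>T\<close> is linear only up to null sets, so \<open>T F\<close> and
    \<open>g\<close> agree almost everywhere; inner products are computed with \<open>g\<close>,
    which is a literal sum.\<close>
  define g where "g x = (\<Sum>j<N. vec_index v j * T (f j) x)" for x
  have TL: "T (f i) \<in> L2 \<mu>" if "i < N" for i using T f[OF that] by (simp add: L2_bounded_operator_def)
  have F: "F \<in> L2 \<mu>" unfolding F_def[abs_def] using f by (intro L2_sum) auto
  have g: "g \<in> L2 \<mu>" unfolding g_def[abs_def] using TL by (intro L2_sum) auto
  have TF: "T F \<in> L2 \<mu>" using T F by (simp add: L2_bounded_operator_def)
  have "AE x in \<mu>. T F x = g x"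
    unfolding F_def[abs_def] g_def using f by (intro L2_bounded_operator_sum[OF T]) auto
  then have normg: "L2_norm \<mu> (T F) = L2_norm \<mu> g" by (rule L2_cong_AE(2)[OF L2_measurable[OF TF] g])
  have "(L2_norm \<mu> F)\<^sup>2 = (vec_norm2 v)\<^sup>2"
    unfolding F_def[abs_def] vec_norm2_sq v using f orth by (intro L2_norm_orthonormal_sum) auto
  then have F1: "L2_norm \<mu> F \<le> 1" using v1 L2_norm_nonneg[of \<mu> F] vec_norm2_nonneg[of v] by (simp add: power2_eq_iff_nonneg)
  have entry: "vec_index (?A *\<^sub>v v) i = L2_inner \<mu> g (f i)" if "i < N" for i
  proof -
    have "vec_index (?A *\<^sub>v v) i = (\<Sum>j<N. L2_inner \<mu> (T (f j)) (f i) * vec_index v j)"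
      using that v by (simp add: scalar_prod_def atLeast0LessThan)
    also have "\<dots> = L2_inner \<mu> g (f i)"
      unfolding g_def[abs_def] using TL f that by (subst L2_inner_sum_left) (auto simp: mult.commute)
    finally show ?thesis .
  qed
  have "(vec_norm2 (?A *\<^sub>v v))\<^sup>2 = (\<Sum>i<N. (cmod (L2_inner \<mu> g (f i)))\<^sup>2)"
    unfolding vec_norm2_sq using entry by (intro sum.cong) auto
  also have "\<dots> \<le> (L2_norm \<mu> g)\<^sup>2" using f g orth by (intro L2_bessel) auto
  finally have "vec_norm2 (?A *\<^sub>v v) \<le> L2_norm \<mu> g" using L2_norm_nonneg power2_le_imp_le by blast
  also have "\<dots> \<le> L2_op_norm \<mu> T" using L2_op_norm_bound[OF T F F1] by (simp add: normg)
  finally show "vec_norm2 (?A *\<^sub>v v) \<le> L2_op_norm \<mu> T" .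
qed

lemma continuous_sesquilinear_sum:
  assumes B: "continuous_sesquilinear V nV B" and I: "finite I"
    and zero: "(\<lambda>x. 0) \<in> V" and lin: "\<And>u v a b. u \<in> V \<Longrightarrow> v \<in> V \<Longrightarrow> (\<lambda>x. a * u x + b * v x) \<in> V"
    and u: "\<And>i. i \<in> I \<Longrightarrow> u i \<in> V"
  shows "(\<lambda>x. \<Sum>i\<in>I. c i * u i x) \<in> V"
    and "w \<in> V \<Longrightarrow> B (\<lambda>x. \<Sum>i\<in>I. c i * u i x) w = (\<Sum>i\<in>I. c i * B (u i) w)"
    and "w \<in> V \<Longrightarrow> B w (\<lambda>x. \<Sum>i\<in>I. c i * u i x) = (\<Sum>i\<in>I. cnj (c i) * B w (u i))"
proof -
  have S: "B (\<lambda>x. a * u x + b * v x) w = a * B u w + b * B v w"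
    "B w (\<lambda>x. a * u x + b * v x) = cnj a * B w u + cnj b * B w v" if "u \<in> V" "v \<in> V" "w \<in> V" for u v w a b
    using B that unfolding continuous_sesquilinear_def by blast+
  have "(\<lambda>x. \<Sum>i\<in>I. c i * u i x) \<in> V \<and> (\<forall>w\<in>V. B (\<lambda>x. \<Sum>i\<in>I. c i * u i x) w = (\<Sum>i\<in>I. c i * B (u i) w) \<and>
      B w (\<lambda>x. \<Sum>i\<in>I. c i * u i x) = (\<Sum>i\<in>I. cnj (c i) * B w (u i)))"
    using I u
  proof (induction I rule: finite_induct)
    case empty
    \<comment> \<open>The value at the zero vector follows from linearity with both coefficients
      0.\<close>
    then show ?case using S[OF zero zero, of _ 0 0] zero by simp
  next
    case (insert i I)
    then have IH: "(\<lambda>x. \<Sum>i\<in>I. c i * u i x) \<in> V" "u i \<in> V" by auto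
    show ?case using lin[OF IH(2,1), of "c i" 1] S[OF IH(2,1), of _ "c i" 1] insert by simp
  qed
  then show "(\<lambda>x. \<Sum>i\<in>I. c i * u i x) \<in> V"
    "w \<in> V \<Longrightarrow> B (\<lambda>x. \<Sum>i\<in>I. c i * u i x) w = (\<Sum>i\<in>I. c i * B (u i) w)"
    "w \<in> V \<Longrightarrow> B w (\<lambda>x. \<Sum>i\<in>I. c i * u i x) = (\<Sum>i\<in>I. cnj (c i) * B w (u i))" by blast+
qed

section \<open>Functionals on the trace space and the adjoint trace\<close>

lemma HH_dual_zero: "(\<lambda>g. 0) \<in> HH_dual t d \<Gamma>"
  unfolding HH_dual_def by (auto intro!: exI[of _ 0])

lemma HH_dual_lincomb:
  assumes F: "F \<in> HH_dual t d \<Gamma>" and G: "G \<in> HH_dual t d \<Gamma>"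
  shows "(\<lambda>g. a * F g + b * G g) \<in> HH_dual t d \<Gamma>"
proof -
  obtain C where C: "\<And>g. g \<in> HH t d \<Gamma> \<Longrightarrow> cmod (F g) \<le> C * HH_norm t d \<Gamma> g"
    using F unfolding HH_dual_def by blast
  obtain C' where C': "\<And>g. g \<in> HH t d \<Gamma> \<Longrightarrow> cmod (G g) \<le> C' * HH_norm t d \<Gamma> g"
    using G unfolding HH_dual_def by blast
  have bound: "cmod (a * F g + b * G g) \<le> (cmod a * C + cmod b * C') * HH_norm t d \<Gamma> g" if "g \<in> HH t d \<Gamma>" for g
  proof -
    have "cmod (a * F g + b * G g) \<le> cmod a * cmod (F g) + cmod b * cmod (G g)"
      using norm_triangle_ineq[of "a * F g" "b * G g"] by (simp add: norm_mult)
    also have "\<dots> \<le> cmod a * (C * HH_norm t d \<Gamma> g) + cmod b * (C' * HH_norm t d \<Gamma> g)"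
      using C[OF that] C'[OF that] by (intro add_mono mult_left_mono) auto
    finally show ?thesis by (simp add: algebra_simps)
  qed
  have F0: "F g = 0" "G g = 0" if "g \<notin> HH t d \<Gamma>" for g using F G that by (simp_all add: HH_dual_def)
  have lin: "F (\<lambda>x. a * g1 x + b * g2 x) = cnj a * F g1 + cnj b * F g2"
    "G (\<lambda>x. a * g1 x + b * g2 x) = cnj a * G g1 + cnj b * G g2"
    if "g1 \<in> HH t d \<Gamma>" "g2 \<in> HH t d \<Gamma>" for g1 g2 a b
    using F G that by (simp_all add: HH_dual_def)
  show ?thesis unfolding HH_dual_def
  proof (intro CollectI conjI)
    show "\<exists>C. \<forall>g\<in>HH t d \<Gamma>. cmod (a * F g + b * G g) \<le> C * HH_norm t d \<Gamma> g" using bound by blast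
  qed (simp_all add: F0 lin algebra_simps)
qed

lemma (in trace_setting) L2_embed_sum:
  assumes "\<And>i. i \<in> I \<Longrightarrow> f i \<in> L2 \<mu>"
  shows "L2_embed t d \<Gamma> (\<lambda>x. \<Sum>i\<in>I. c i * f i x) = (\<lambda>h. \<Sum>i\<in>I. c i * L2_embed t d \<Gamma> (f i) h)"
  using assms by (auto simp: L2_embed_def \<mu> L2_inner_sum_left HH_L2)

lemma HH_dual_sum:
  assumes "finite I" "\<And>i. i \<in> I \<Longrightarrow> F i \<in> HH_dual t d \<Gamma>"
  shows "(\<lambda>h. \<Sum>i\<in>I. c i * F i h) \<in> HH_dual t d \<Gamma>"
  using assms
proof (induction I rule: finite_induct)
  case empty
  show ?case by (simp add: HH_dual_zero)
next
  case (insert i I)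
  then show ?case using HH_dual_lincomb[of "F i" t d \<Gamma> "\<lambda>h. \<Sum>i\<in>I. c i * F i h" "c i" 1] by simp
qed

lemma unitary_isomorphism_lincomb:
  assumes "unitary_isomorphism V nV W nW T" "u \<in> V" "v \<in> V"
  shows "T (\<lambda>x. a * u x + b * v x) = (\<lambda>y. a * T u y + b * T v y)"
  using assms unfolding unitary_isomorphism_def by simp

lemma unitary_isomorphism_sum:
  assumes T: "unitary_isomorphism (HH_dual t d \<Gamma>) nV W nW T"
    and "finite I" "\<And>i. i \<in> I \<Longrightarrow> F i \<in> HH_dual t d \<Gamma>"
  shows "T (\<lambda>h. \<Sum>i\<in>I. c i * F i h) = (\<lambda>y. \<Sum>i\<in>I. c i * T (F i) y)"
  using assms(2,3)
proof (induction I rule: finite_induct)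
  case empty
  show ?case using unitary_isomorphism_lincomb[OF T HH_dual_zero HH_dual_zero, of 0 0] by simp
next
  case (insert i I)
  have "T (\<lambda>x. c i * F i x + 1 * (\<Sum>i\<in>I. c i * F i x)) = (\<lambda>y. c i * T (F i) y + 1 * T (\<lambda>h. \<Sum>i\<in>I. c i * F i h) y)"
    using insert by (intro unitary_isomorphism_lincomb[OF T] HH_dual_sum) auto
  with insert show ?case by simp
qed

lemma (in osc_system) test_functions_L2:
  assumes "\<phi> \<in> test_functions UNIV"
  shows "\<phi> \<in> L2 \<mu>"
proof -
  interpret finite_measure \<mu> by (rule finite_measure_mu)
  have sm: "smooth_fun \<phi>" using assms by (simp add: test_functions_def)
  then have m [measurable]: "\<phi> \<in> borel_measurable \<mu>" by (intro measurable_mu smooth_fun_measurable)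
  have "bounded (\<phi> ` \<Gamma>)"
    using continuous_on_subset[OF smooth_fun_continuous[OF sm]] compact_attr
    by (intro compact_imp_bounded compact_continuous_image) auto
  then obtain B where B: "\<And>x. x \<in> \<Gamma> \<Longrightarrow> cmod (\<phi> x) \<le> B" by (auto simp: bounded_iff)
  have "integrable \<mu> (\<lambda>x. (cmod (\<phi> x))\<^sup>2)"
  proof (rule integrable_const_bound)
    show "AE x in \<mu>. norm ((cmod (\<phi> x))\<^sup>2) \<le> B\<^sup>2" using B by (auto simp: space_mu intro!: power_mono)
  qed measurable
  then show ?thesis by (simp add: L2_def)
qed

lemma (in osc_system) Y_space_sum:
  assumes "basis_ordering d M s \<Gamma> h N f"
  shows "(\<lambda>x. \<Sum>i<N. c i * f i x) \<in> Y_space d M s \<Gamma> h"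
proof -
  obtain w where w: "bij_betw w {..<N} (L_index M s \<Gamma> h)" and f: "\<And>i. i < N \<Longrightarrow> f i = chi d s \<Gamma> (w i)"
    using assms by (auto simp: basis_ordering_def)
  define c' where "c' u = c (inv_into {..<N} w u)" for u
  have "(\<Sum>i<N. c i * f i x) = (\<Sum>u\<in>L_index M s \<Gamma> h. c' u * chi d s \<Gamma> u x)" for x
  proof -
    have "(\<Sum>i<N. c i * f i x) = (\<Sum>i<N. c' (w i) * chi d s \<Gamma> (w i) x)"
      using w f by (intro sum.cong) (auto simp: c'_def bij_betw_def inv_into_f_f)
    also have "\<dots> = (\<Sum>u\<in>L_index M s \<Gamma> h. c' u * chi d s \<Gamma> u x)"
      using w by (rule sum.reindex_bij_betw)
    finally show ?thesis .
  qed
  then show ?thesis unfolding Y_space_def by auto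
qed

text \<open>Coercivity and the inverse estimate meet at the -1/2 norm of \<open>\<Phi>\<close>, the
  image of \<open>\<Psi>\<close>. With \<open>K\<close> the constant of the inverse estimate at
  \<open>h\<close>, the bound is \<open>\<alpha>\<close> divided by the square of \<open>K\<close>;
  \<open>Kinv\<close> rewrites this in powers of \<open>c\<^sub>t\<close> and
  \<open>h\<close>.\<close>

lemma (in osc_system) galerkin_coercive:
  assumes t: "t = t_exp d \<Gamma>"
    and trace_adjoint: "unitary_isomorphism (HH_dual t d \<Gamma>) (HH_dual_norm t d \<Gamma>)
         (sobolev_supp (-1/2) \<Gamma>) (sobolev_norm (-1/2)) (tr_adj t d \<Gamma>)"
    and form: "continuous_sesquilinear (sobolev_supp (-1/2) \<Gamma>) (sobolev_norm (-1/2)) (slp_form k \<Gamma>)"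
    and coercive: "slp_coercive k \<Gamma> \<alpha>" and \<alpha>: "0 < \<alpha>"
    and inverse: "inverse_estimate d M s \<Gamma> c\<^sub>t" and ct: "0 < c\<^sub>t"
    and h: "0 < h" "h \<le> diameter \<Gamma>"
    and f: "basis_ordering d M s \<Gamma> h N f"
    and A: "A = Matrix.mat N N (\<lambda>(i, j). slp_form k \<Gamma> (tr_adj t d \<Gamma> (L2_embed t d \<Gamma> (f j))) (tr_adj t d \<Gamma> (L2_embed t d \<Gamma> (f i))))"
    and a: "a \<in> carrier_vec N"
  shows "\<alpha> * c\<^sub>t powr (- 2) * h powr (2 * t) * (vec_norm2 a)\<^sup>2 \<le> cmod ((A *\<^sub>v a) \<bullet>c a)"
proof -
  have "lift_exp t d \<Gamma> = 1/2" by (simp add: t t_exp_def lift_exp_def)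
  then interpret T: trace_setting t d "1/2" \<Gamma> \<mu>
    using test_functions_L2 by unfold_locales (simp_all add: \<mu>_def)
  let ?V = "sobolev_supp (-1/2) \<Gamma>" and ?T = "tr_adj t d \<Gamma>" and ?E = "L2_embed t d \<Gamma>"
  note fL2 = basis_ordering_orthonormal(1)[OF f] and orth = basis_ordering_orthonormal(2)[OF f]
  have norm_f: "L2_norm \<mu> (f i) = 1" if "i < N" for i
    using orth[OF that that] L2_norm_nonneg[of \<mu> "f i"] unfolding L2_inner_self
    by (simp add: power2_eq_1_iff del: of_real_power)
  define K where "K = c\<^sub>t * h powr (- t)"
  have K: "0 < K" using ct h by (simp add: K_def)
  have est: "L2_norm \<mu> (\<lambda>x. \<Sum>i<N. c i * f i x) \<le> K * HH_dual_norm t d \<Gamma> (?E (\<lambda>x. \<Sum>i<N. c i * f i x))" for c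
    using inverse h Y_space_sum[OF f, of c] unfolding inverse_estimate_def t[symmetric] K_def \<mu>_def by simp
  \<comment> \<open>Every multiple of \<open>f j\<close> lies in \<open>Y_space\<close>, so the
    inverse estimate supplies the growth in \<open>c\<close> that \<open>L2_embed_dual\<close> asks
    for.\<close>
  have dual: "?E (f j) \<in> HH_dual t d \<Gamma>" if j: "j < N" for j
  proof (rule T.L2_embed_dual[OF fL2[OF j]])
    fix c :: real assume c: "0 < c"
    have eq: "(\<lambda>x. \<Sum>i<N. (if i = j then complex_of_real c else 0) * f i x) = (\<lambda>x. complex_of_real c * f j x)"
      using j by (simp add: if_distrib[of "\<lambda>z. z * _"] cong: if_cong)
    show "c * L2_norm \<mu> (f j) \<le> K * HH_dual_norm t d \<Gamma> (?E (\<lambda>x. complex_of_real c * f j x))"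
      using est[of "\<lambda>i. if i = j then complex_of_real c else 0"] c unfolding eq L2_norm_cmult by simp
  qed (use K norm_f[OF j] in simp_all)
  \<comment> \<open>Closure of the support space under linear combinations is read off from its
    being the image of the linear space \<open>HH_dual\<close> under a linear map, with no look at
    supports.\<close>
  have V: "?V = ?T ` HH_dual t d \<Gamma>" using trace_adjoint by (simp add: unitary_isomorphism_def bij_betw_def)
  have V_lin: "(\<lambda>x. b * u x + c * v x) \<in> ?V" if "u \<in> ?V" "v \<in> ?V" for u v b c
  proof -
    obtain F G where FG: "F \<in> HH_dual t d \<Gamma>" "G \<in> HH_dual t d \<Gamma>" "u = ?T F" "v = ?T G" using \<open>u \<in> ?V\<close> \<open>v \<in> ?V\<close> V by blast
    have "(\<lambda>x. b * u x + c * v x) = ?T (\<lambda>g. b * F g + c * G g)"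
      unfolding FG(3,4) by (rule unitary_isomorphism_lincomb[OF trace_adjoint FG(1,2), symmetric])
    then show ?thesis using HH_dual_lincomb[OF FG(1,2)] V by blast
  qed
  have "?T (\<lambda>g. 0) \<in> ?V" using V HH_dual_zero by blast
  from V_lin[OF this this, of 0 0] have V_zero: "(\<lambda>x. 0) \<in> ?V" by simp
  define \<phi> where "\<phi> j = ?T (?E (f j))" for j
  have \<phi>V: "\<phi> j \<in> ?V" if "j < N" for j using dual[OF that] V by (simp add: \<phi>_def)
  define \<Psi> where "\<Psi> = (\<lambda>x. \<Sum>i<N. vec_index a i * f i x)"
  have E\<Psi>: "?E \<Psi> = (\<lambda>g. \<Sum>i<N. vec_index a i * ?E (f i) g)"
    unfolding \<Psi>_def using fL2 by (intro T.L2_embed_sum) auto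
  have E\<Psi>_dual: "?E \<Psi> \<in> HH_dual t d \<Gamma>" unfolding E\<Psi> using dual by (intro HH_dual_sum) auto
  define \<Phi> where "\<Phi> = ?T (?E \<Psi>)"
  have \<Phi>: "\<Phi> = (\<lambda>x. \<Sum>i<N. vec_index a i * \<phi> i x)"
    unfolding \<Phi>_def E\<Psi> \<phi>_def using dual by (intro unitary_isomorphism_sum[OF trace_adjoint]) auto
  have \<Phi>V: "\<Phi> \<in> ?V" using E\<Psi>_dual V by (simp add: \<Phi>_def)
  have dims: "dim_vec a = N" using a by simp
  \<comment> \<open>The second argument carries the row index, and its antilinearity produces the
    conjugates of the conjugate transpose.\<close>
  have "slp_form k \<Gamma> \<Phi> \<Phi> = (\<Sum>i<N. cnj (vec_index a i) * slp_form k \<Gamma> \<Phi> (\<phi> i))"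
    unfolding \<Phi> using \<phi>V \<Phi>V[unfolded \<Phi>]
    by (intro continuous_sesquilinear_sum(3)[OF form _ V_zero V_lin]) auto
  also have "\<dots> = (\<Sum>i<N. cnj (vec_index a i) * (\<Sum>j<N. vec_index a j * slp_form k \<Gamma> (\<phi> j) (\<phi> i)))"
    unfolding \<Phi> using \<phi>V
    by (intro sum.cong arg_cong2[where f = "(*)"] refl continuous_sesquilinear_sum(2)[OF form _ V_zero V_lin]) auto
  also have "\<dots> = (A *\<^sub>v a) \<bullet>c a"
    unfolding A scalar_prod_def using dims
    by (auto simp: atLeast0LessThan \<phi>_def scalar_prod_def mult.commute intro!: sum.cong)
  finally have form_eq: "(A *\<^sub>v a) \<bullet>c a = slp_form k \<Gamma> \<Phi> \<Phi>" by simp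
  have "sobolev_norm (-1/2) \<Phi> = HH_dual_norm t d \<Gamma> (?E \<Psi>)"
    using trace_adjoint E\<Psi>_dual unfolding unitary_isomorphism_def \<Phi>_def by simp
  then have "L2_norm \<mu> \<Psi> \<le> K * sobolev_norm (-1/2) \<Phi>" using est[of "vec_index a"] by (simp add: \<Psi>_def)
  then have "(L2_norm \<mu> \<Psi>)\<^sup>2 \<le> (K * sobolev_norm (-1/2) \<Phi>)\<^sup>2" by (intro power_mono L2_norm_nonneg)
  moreover have "(L2_norm \<mu> \<Psi>)\<^sup>2 = (vec_norm2 a)\<^sup>2"
    unfolding \<Psi>_def vec_norm2_sq dims using fL2 orth by (intro L2_norm_orthonormal_sum) auto
  ultimately have le: "(vec_norm2 a)\<^sup>2 \<le> K\<^sup>2 * (sobolev_norm (-1/2) \<Phi>)\<^sup>2" by (simp add: power_mult_distrib)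
  have Kinv: "c\<^sub>t powr (- 2) * h powr (2 * t) = inverse (K\<^sup>2)"
  proof -
    have "(h powr (- t))\<^sup>2 = h powr (- (2 * t))" by (simp add: power2_eq_square flip: powr_add)
    moreover have "c\<^sub>t powr (- 2) = inverse (c\<^sub>t\<^sup>2)" using ct by (simp add: powr_minus)
    ultimately show ?thesis by (simp add: K_def power_mult_distrib powr_minus)
  qed
  have "\<alpha> * (c\<^sub>t powr (- 2) * h powr (2 * t) * (vec_norm2 a)\<^sup>2) \<le> \<alpha> * (sobolev_norm (-1/2) \<Phi>)\<^sup>2"
    unfolding Kinv using le K \<alpha> by (intro mult_left_mono) (simp_all add: field_simps)
  also have "\<dots> \<le> cmod (slp_form k \<Gamma> \<Phi> \<Phi>)" using coercive \<Phi>V unfolding slp_coercive_def by blast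
  finally show ?thesis unfolding form_eq by (simp add: mult.assoc)
qed

theorem theorem5p13:
  fixes k d t :: real and M :: nat and \<rho> :: "nat \<Rightarrow> real"
    and s :: "nat \<Rightarrow> real ^ 'n \<Rightarrow> real ^ 'n" and \<Gamma> :: "(real ^ 'n) set"
  assumes n: "CARD('n) = 1 \<or> CARD('n) = 2"
    and k: "k > 0"
    and ifs: "ifs M s \<rho>" "ifs_attractor M s \<Gamma>" "open_set_condition M s"
    and d: "d = hausdorff_dim \<Gamma>" "real CARD('n) - 1 < d" "d < real CARD('n)"
    and t: "t = t_exp d \<Gamma>"
    and known_trace_adjoint:
      "unitary_isomorphism (HH_dual t d \<Gamma>) (HH_dual_norm t d \<Gamma>)
         (sobolev_supp (-1/2) \<Gamma>) (sobolev_norm (-1/2)) (tr_adj t d \<Gamma>)"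
    and known_form_continuous:
      "continuous_sesquilinear (sobolev_supp (-1/2) \<Gamma>) (sobolev_norm (-1/2)) (slp_form k \<Gamma>)"
    and known_form_coercive: "\<exists>\<alpha>>0. slp_coercive k \<Gamma> \<alpha>"
    and known_bounded: "L2_bounded_operator (hausdorff_on d \<Gamma>) (SS_L2 k d \<Gamma>)"
    and known_entries:
      "\<And>h N f i j. \<lbrakk>0 < h; h \<le> diameter \<Gamma>; N = card (L_index M s \<Gamma> h);
          basis_ordering d M s \<Gamma> h N f; i < N; j < N\<rbrakk> \<Longrightarrow>
        galerkin_entry k d \<Gamma> (f j) (f i) =
          slp_form k \<Gamma> (tr_adj t d \<Gamma> (L2_embed t d \<Gamma> (f j))) (tr_adj t d \<Gamma> (L2_embed t d \<Gamma> (f i))) \<and>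
        galerkin_entry k d \<Gamma> (f j) (f i) =
          L2_inner (hausdorff_on d \<Gamma>) (SS_L2 k d \<Gamma> (f j)) (f i)"
    and known_inverse_estimate: "ifs_disjoint M s \<Gamma> \<Longrightarrow> \<exists>c>0. inverse_estimate d M s \<Gamma> c"
  shows
    "(\<forall>h N f. 0 < h \<and> h \<le> diameter \<Gamma> \<and> N = card (L_index M s \<Gamma> h) \<and> basis_ordering d M s \<Gamma> h N f \<longrightarrow>
        mat_norm2 (galerkin_matrix k d \<Gamma> N f) \<le> L2_op_norm (hausdorff_on d \<Gamma>) (SS_L2 k d \<Gamma>)) \<and>
     (ifs_disjoint M s \<Gamma> \<longrightarrow>
       (let bounds_hold = (\<lambda>c. \<forall>h N f A.
              0 < h \<and> h \<le> diameter \<Gamma> \<and> N = card (L_index M s \<Gamma> h) \<and> basis_ordering d M s \<Gamma> h N f \<and>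
              A = galerkin_matrix k d \<Gamma> N f \<longrightarrow>
                (\<forall>a\<in>carrier_vec N. cmod ((A *\<^sub>v a) \<bullet>c a) \<ge> c * h powr (2 * t) * (vec_norm2 a)\<^sup>2) \<and>
                (\<exists>B\<in>carrier_mat N N. A * B = 1\<^sub>m N \<and> B * A = 1\<^sub>m N \<and>
                   mat_norm2 B \<le> inverse c * h powr (- 2 * t)))
        in (\<exists>c>0. bounds_hold c) \<and>
           (\<forall>\<alpha> c\<^sub>t. \<alpha> > 0 \<and> slp_coercive k \<Gamma> \<alpha> \<and> c\<^sub>t > 0 \<and> inverse_estimate d M s \<Gamma> c\<^sub>t \<longrightarrow>
              bounds_hold (\<alpha> * c\<^sub>t powr (- 2)))))"
proof -
  interpret osc_system M s \<rho> \<Gamma> d "hausdorff_on d \<Gamma>"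
    using ifs d(1) by unfold_locales simp_all
  have upper: "mat_norm2 (galerkin_matrix k d \<Gamma> N f) \<le> L2_op_norm (hausdorff_on d \<Gamma>) (SS_L2 k d \<Gamma>)"
    if "0 < h" "h \<le> diameter \<Gamma>" "N = card (L_index M s \<Gamma> h)" "basis_ordering d M s \<Gamma> h N f" for h N f
  proof -
    have "galerkin_matrix k d \<Gamma> N f = Matrix.mat N N (\<lambda>(i, j). L2_inner (hausdorff_on d \<Gamma>) (SS_L2 k d \<Gamma> (f j)) (f i))"
      unfolding galerkin_matrix_def using known_entries[OF that, THEN conjunct2] by (intro eq_matI) auto
    then show ?thesis
      using mat_norm2_compression_le[OF known_bounded, of N f] basis_ordering_orthonormal[OF that(4)] by simp
  qed
  \<comment> \<open>The existence claim and the explicit constant concern the same predicate;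
    existence follows from the explicit form at any admissible \<open>\<alpha>\<close> and
    \<open>c\<^sub>t\<close>.\<close>
  define bounds_hold where "bounds_hold c \<longleftrightarrow> (\<forall>h N f A.
              0 < h \<and> h \<le> diameter \<Gamma> \<and> N = card (L_index M s \<Gamma> h) \<and> basis_ordering d M s \<Gamma> h N f \<and>
              A = galerkin_matrix k d \<Gamma> N f \<longrightarrow>
                (\<forall>a\<in>carrier_vec N. cmod ((A *\<^sub>v a) \<bullet>c a) \<ge> c * h powr (2 * t) * (vec_norm2 a)\<^sup>2) \<and>
                (\<exists>B\<in>carrier_mat N N. A * B = 1\<^sub>m N \<and> B * A = 1\<^sub>m N \<and>
                   mat_norm2 B \<le> inverse c * h powr (- 2 * t)))" for c
  have bounds: "bounds_hold (\<alpha> * c\<^sub>t powr (- 2))"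
    if \<alpha>: "0 < \<alpha>" "slp_coercive k \<Gamma> \<alpha>" and ct: "0 < c\<^sub>t" "inverse_estimate d M s \<Gamma> c\<^sub>t" for \<alpha> c\<^sub>t
    unfolding bounds_hold_def
  proof (intro allI impI, elim conjE)
    fix h N f A
    assume hN: "0 < h" "h \<le> diameter \<Gamma>" "N = card (L_index M s \<Gamma> h)" "basis_ordering d M s \<Gamma> h N f"
      and A: "A = galerkin_matrix k d \<Gamma> N f"
    have Aform: "A = Matrix.mat N N (\<lambda>(i, j). slp_form k \<Gamma> (tr_adj t d \<Gamma> (L2_embed t d \<Gamma> (f j))) (tr_adj t d \<Gamma> (L2_embed t d \<Gamma> (f i))))"
      unfolding A galerkin_matrix_def using known_entries[OF hN, THEN conjunct1] by (intro eq_matI) auto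
    let ?c = "\<alpha> * c\<^sub>t powr (- 2) * h powr (2 * t)"
    have low: "?c * (vec_norm2 a)\<^sup>2 \<le> cmod ((A *\<^sub>v a) \<bullet>c a)" if "a \<in> carrier_vec N" for a
      by (rule galerkin_coercive[OF t known_trace_adjoint known_form_continuous \<alpha>(2,1) ct(2,1) hN(1,2,4) Aform that])
    have "0 < ?c" using \<alpha>(1) ct(1) hN(1) by simp
    moreover have "A \<in> carrier_mat N N" by (simp add: Aform)
    moreover have "inverse ?c = inverse (\<alpha> * c\<^sub>t powr (- 2)) * h powr (- 2 * t)"
      by (simp add: powr_minus)
    ultimately show "(\<forall>a\<in>carrier_vec N. ?c * (vec_norm2 a)\<^sup>2 \<le> cmod ((A *\<^sub>v a) \<bullet>c a)) \<and>
        (\<exists>B\<in>carrier_mat N N. A * B = 1\<^sub>m N \<and> B * A = 1\<^sub>m N \<and>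
           mat_norm2 B \<le> inverse (\<alpha> * c\<^sub>t powr (- 2)) * h powr (- 2 * t))"
      using low inverse_bound_of_coercive[of A N ?c] by metis
  qed
  have "\<exists>c>0. bounds_hold c" if disjoint: "ifs_disjoint M s \<Gamma>"
  proof -
    obtain \<alpha> c\<^sub>t where "0 < \<alpha>" "slp_coercive k \<Gamma> \<alpha>" "0 < c\<^sub>t" "inverse_estimate d M s \<Gamma> c\<^sub>t"
      using known_form_coercive known_inverse_estimate[OF disjoint] by blast
    then show ?thesis using bounds[of \<alpha> c\<^sub>t] by (intro exI[of _ "\<alpha> * c\<^sub>t powr (- 2)"]) simp
  qed
  then show ?thesis
    unfolding Let_def bounds_hold_def[symmetric] using upper bounds by blast
qed

end
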